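(* Let $U=\{0,1,\dots,|U|-1\}$ with $|U|>1$, and let $k$ be an integer with $2\le k\le |U|$. Consider Algorithm 1: let $u,d$ be the unique positive integers with $2^{u-1}<|U|\le 2^u$ and $2^{d-1}<\frac{k}{\ln k}\le 2^d$; choose $f$ uniformly at random from a $\lceil 12\ln k\rceil$-wise independent family $\{0,1\}^u\to\{0,1\}^d$ given by the standard polynomial construction (random polynomials of degree $<\lceil 12\ln k\rceil$ over a finite field), for which choosing and storing a random function takes space $O(\kappa(u+d))$ with $\kappa=\lceil 12\ln k\rceil$ and evaluating it takes time polynomial in $u,d,\kappa$; let $\mathcal{H}'$ be the universal family $\{x\mapsto((ax+b)\bmod p)\bmod r\}$ from $U$ to $\{0,\dots,r-1\}$ with $r=\lceil 13\ln k\rceil^2$ and a prime $p\ge|U|$; for each $i\in\{0,\dots,2^d-1\}$ let $F_i$ be a set of $\lceil 8\ln k\rceil$ functions chosen independently and uniformly at random from $\mathcal{H}'$; output $\{f,F_0,\dots,F_{2^d-1}\}$. Consider Algorithm 2: given $x\in U$ and this output, with $d_2=\lceil 8\ln k\rceil$, $d_3=\lceil 13\ln k\rceil^2$, compute the integer $j$ whose $d$-bit binary representation is $f(\mathrm{bin}(x))$ ($\mathrm{bin}(x)$ the $u$-bit binary representation of $x$) and return $\mathcal{G}(x)=\{\,j d_2 d_3+(i-1)d_3+h_i(x): i=1,\dots,d_2\,\}$, where $h_i$ is the $i$-th function of $F_j$. Then Algorithm 1 runs in space $O(k+(\log k)(\log|U|))$, and Algorithm 2 runs in space $O(\log k)$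 and in time polynomial in $\log|U|$.
   Context: Space is measured in machine words, and each basic operation on words takes constant time and space. A family $\mathcal{H}$ of functions to $\{0,\dots,r-1\}$ is universal if distinct keys collide with probability at most $1/r$ under a uniformly random $h\in\mathcal{H}$; it is $\kappa$-wise independent if any $\kappa$ distinct keys are mapped to any prescribed $\kappa$ values with probability exactly $r^{-\kappa}$. *)

theory Defs
  imports
    "HOL-Probability.Probability"
    "HOL-Computational_Algebra.Computational_Algebra"
    "HOL-Library.Z2"
begin

text \<open>
  The machine has \<open>w\<close>-bit words, \<open>S\<close> cells of working memory, one register for each register
  name occurring in the program, and a read-only input. A value that does not fit into a word, an
  access outside the working memory or the input, and a division by zero are faults: evaluation
  yields \<open>None\<close> and the execution relation below has no derivation. Every operator costs one time
  unit. The rounded products \<open>\<lfloor>x * ln y\<rfloor>\<close> and \<open>\<lceil>x * ln y\<rceil>\<close> are basic operations, as they are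
  the only access to the real numbers by which the parameters of the algorithms are specified.
\<close>

datatype binop = Add | Sub | Mul | Div | Mod | And | Xor | Shl | Shr | Less | LessEq | Equal
  | FloorLn | CeilLn

datatype 'r exp =
    Num nat
  | Var 'r  ("\<acute>_" [1000] 1000)
  | Mem "'r exp"
  | Inp "'r exp"
  | Op binop "'r exp" "'r exp"

datatype 'r com =
    Assign 'r "'r exp"  ("_ ::= _" [1000, 61] 61)
  | Store "'r exp" "'r exp"
  | Rand 'r "'r exp"
  | Seq "'r com" "'r com"  (infixr ";;" 60)
  | If "'r exp" "'r com" "'r com"
  | When "'r exp" "'r com"
  | While "'r exp" "'r com"

abbreviation add_exp (infixl "[+]" 65) where "a [+] b \<equiv> Op Add a b"
abbreviation sub_exp (infixl "[-]" 65) where "a [-] b \<equiv> Op Sub a b"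
abbreviation mul_exp (infixl "[*]" 70) where "a [*] b \<equiv> Op Mul a b"
abbreviation mod_exp (infixl "[mod]" 70) where "a [mod] b \<equiv> Op Mod a b"
abbreviation xor_exp (infixl "[xor]" 64) where "a [xor] b \<equiv> Op Xor a b"
abbreviation shl_exp (infixl "[<<]" 75) where "a [<<] b \<equiv> Op Shl a b"
abbreviation shr_exp (infixl "[>>]" 75) where "a [>>] b \<equiv> Op Shr a b"
abbreviation less_exp (infix "[<]" 50) where "a [<] b \<equiv> Op Less a b"
abbreviation le_exp (infix "[<=]" 50) where "a [<=] b \<equiv> Op LessEq a b"
abbreviation eq_exp (infix "[=]" 50) where "a [=] b \<equiv> Op Equal a b"

fun apply_op :: "binop \<Rightarrow> nat \<Rightarrow> nat \<Rightarrow> nat option" where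
  "apply_op Add x y = Some (x + y)"
| "apply_op Sub x y = Some (x - y)"
| "apply_op Mul x y = Some (x * y)"
| "apply_op Div x y = (if y = 0 then None else Some (x div y))"
| "apply_op Mod x y = (if y = 0 then None else Some (x mod y))"
| "apply_op And x y = Some (and x y)"
| "apply_op Xor x y = Some (xor x y)"
| "apply_op Shl x y = Some (x * 2 ^ y)"
| "apply_op Shr x y = Some (x div 2 ^ y)"
| "apply_op Less x y = Some (of_bool (x < y))"
| "apply_op LessEq x y = Some (of_bool (x \<le> y))"
| "apply_op Equal x y = Some (of_bool (x = y))"
| "apply_op FloorLn x y = (if y = 0 then None else Some (nat \<lfloor>real x * ln (real y)\<rfloor>))"
| "apply_op CeilLn x y = (if y = 0 then None else Some (nat \<lceil>real x * ln (real y)\<rceil>))"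

definition word :: "nat \<Rightarrow> nat \<Rightarrow> nat option" where
  "word w v = (if v < 2 ^ w then Some v else None)"

type_synonym 'r state = "('r \<Rightarrow> nat) \<times> (nat \<Rightarrow> nat)"

fun eval :: "nat \<Rightarrow> nat \<Rightarrow> nat list \<Rightarrow> 'r state \<Rightarrow> 'r exp \<Rightarrow> nat option" where
  "eval w S inp s (Num n) = word w n"
| "eval w S inp s (Var x) = word w (fst s x)"
| "eval w S inp s (Mem e) =
     Option.bind (eval w S inp s e) (\<lambda>a. if a < S then word w (snd s a) else None)"
| "eval w S inp s (Inp e) =
     Option.bind (eval w S inp s e) (\<lambda>a. if a < length inp then word w (inp ! a) else None)"
| "eval w S inp s (Op f e1 e2) =
     Option.bind (eval w S inp s e1) (\<lambda>x.
     Option.bind (eval w S inp s e2) (\<lambda>y.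
     Option.bind (apply_op f x y) (word w)))"

fun cost :: "'r exp \<Rightarrow> nat" where
  "cost (Num n) = 1"
| "cost (Var x) = 1"
| "cost (Mem e) = cost e + 1"
| "cost (Inp e) = cost e + 1"
| "cost (Op f e1 e2) = cost e1 + cost e2 + 1"

fun regs_exp :: "'r exp \<Rightarrow> 'r set" where
  "regs_exp (Num n) = {}"
| "regs_exp (Var x) = {x}"
| "regs_exp (Mem e) = regs_exp e"
| "regs_exp (Inp e) = regs_exp e"
| "regs_exp (Op f e1 e2) = regs_exp e1 \<union> regs_exp e2"

fun regs :: "'r com \<Rightarrow> 'r set" where
  "regs (Assign x e) = insert x (regs_exp e)"
| "regs (Store a e) = regs_exp a \<union> regs_exp e"
| "regs (Rand x e) = insert x (regs_exp e)"
| "regs (Seq c1 c2) = regs c1 \<union> regs c2"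
| "regs (If b c1 c2) = regs_exp b \<union> regs c1 \<union> regs c2"
| "regs (When b c) = regs_exp b \<union> regs c"
| "regs (While b c) = regs_exp b \<union> regs c"

abbreviation delay :: "nat \<Rightarrow> ('r state \<times> nat) pmf \<Rightarrow> ('r state \<times> nat) pmf" where
  "delay t \<equiv> map_pmf (\<lambda>(s, t'). (s, t + t'))"

text \<open>
  \<open>exec w S inp c s D\<close>: whatever the random choices, \<open>c\<close> started in \<open>s\<close> terminates without a fault,
  and \<open>D\<close> is the joint distribution of the final state and the running time. \<open>Rand x e\<close> draws
  uniformly from \<open>{0..<v}\<close>, where \<open>v\<close> is the value of \<open>e\<close>.
\<close>

inductive exec ::
  "nat \<Rightarrow> nat \<Rightarrow> nat list \<Rightarrow> 'r com \<Rightarrow> 'r state \<Rightarrow> ('r state \<times> nat) pmf \<Rightarrow> bool"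
  for w S :: nat and inp :: "nat list" where
  exec_Assign: "eval w S inp (r, m) e = Some v \<Longrightarrow>
    exec w S inp (Assign x e) (r, m) (return_pmf ((r(x := v), m), cost e + 1))"
| exec_Store: "eval w S inp (r, m) ea = Some a \<Longrightarrow> a < S \<Longrightarrow> eval w S inp (r, m) e = Some v \<Longrightarrow>
    exec w S inp (Store ea e) (r, m) (return_pmf ((r, m(a := v)), cost ea + cost e + 1))"
| exec_Rand: "eval w S inp (r, m) e = Some v \<Longrightarrow> 0 < v \<Longrightarrow>
    exec w S inp (Rand x e) (r, m)
      (map_pmf (\<lambda>z. ((r(x := z), m), cost e + 1)) (pmf_of_set {0..<v}))"
| exec_Seq: "exec w S inp c1 s D1 \<Longrightarrow>
    (\<And>s1 t1. (s1, t1) \<in> set_pmf D1 \<Longrightarrow> exec w S inp c2 s1 (D2 s1)) \<Longrightarrow>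
    exec w S inp (Seq c1 c2) s (bind_pmf D1 (\<lambda>(s1, t1). delay t1 (D2 s1)))"
| exec_If: "eval w S inp s b = Some v \<Longrightarrow>
    exec w S inp (if v \<noteq> 0 then c1 else c2) s D \<Longrightarrow>
    exec w S inp (If b c1 c2) s (delay (cost b + 1) D)"
| exec_When_True: "eval w S inp s b = Some v \<Longrightarrow> v \<noteq> 0 \<Longrightarrow> exec w S inp c s D \<Longrightarrow>
    exec w S inp (When b c) s (delay (cost b + 1) D)"
| exec_When_False: "eval w S inp s b = Some 0 \<Longrightarrow>
    exec w S inp (When b c) s (return_pmf (s, cost b + 1))"
| exec_While_True: "eval w S inp s b = Some v \<Longrightarrow> v \<noteq> 0 \<Longrightarrow>
    exec w S inp (Seq c (While b c)) s D \<Longrightarrow>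
    exec w S inp (While b c) s (delay (cost b + 1) D)"
| exec_While_False: "eval w S inp s b = Some 0 \<Longrightarrow>
    exec w S inp (While b c) s (return_pmf (s, cost b + 1))"

text \<open>The space of a run counts the registers and the working memory, not the read-only input.\<close>

definition runs :: "nat \<Rightarrow> nat \<Rightarrow> nat list \<Rightarrow> 'r com \<Rightarrow> ('r state \<times> nat) pmf \<Rightarrow> bool" where
  "runs w sp inp c D \<longleftrightarrow>
     (\<exists>S. S + card (regs c) \<le> sp \<and> exec w S inp c (\<lambda>_. 0, \<lambda>_. 0) D)"

definition u_par :: "nat \<Rightarrow> nat" where
  "u_par N = (THE u. 0 < u \<and> 2 ^ (u - 1) < N \<and> N \<le> 2 ^ u)"

definition d_par :: "nat \<Rightarrow> nat" where
  "d_par k = (THE d. 0 < d \<and> 2 ^ (d - 1) < real k / ln (real k) \<and> real k / ln (real k) \<le> 2 ^ d)"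

definition kappa :: "nat \<Rightarrow> nat" where "kappa k = nat \<lceil>12 * ln (real k)\<rceil>"

definition d2_par :: "nat \<Rightarrow> nat" where "d2_par k = nat \<lceil>8 * ln (real k)\<rceil>"

definition d3_par :: "nat \<Rightarrow> nat" where "d3_par k = (nat \<lceil>13 * ln (real k)\<rceil>)\<^sup>2"

text \<open>Bit strings are Boolean lists, least significant bit first.\<close>

definition bin :: "nat \<Rightarrow> nat \<Rightarrow> bool list" where
  "bin n x = map (Bit_Operations.bit x) [0..<n]"

definition bin_val :: "bool list \<Rightarrow> nat" where
  "bin_val bs = horner_sum of_bool 2 bs"

text \<open>
  The field with \<open>2 ^ n\<close> elements is \<open>GF(2)[X] / (P)\<close> for an irreducible \<open>P\<close> of degree \<open>n\<close>, its
  elements being the polynomials of degree below \<open>n\<close>. With \<open>n = max u d\<close>, a string in \<open>{0,1}\<^sup>u\<close> is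
  read as a field element (missing bits are zero), the polynomial with coefficient list \<open>cs\<close> is
  evaluated there, and the result is truncated to \<open>d\<close> bits.
\<close>

definition field_modulus :: "nat \<Rightarrow> nat \<Rightarrow> bit poly \<Rightarrow> bool" where
  "field_modulus N k P \<longleftrightarrow> irreducible P \<and> degree P = max (u_par N) (d_par k)"

definition poly_hash :: "bit poly \<Rightarrow> nat \<Rightarrow> bit poly list \<Rightarrow> bool list \<Rightarrow> bool list" where
  "poly_hash P d cs bs =
     (let y = Poly (map of_bool bs);
          z = (\<Sum>i<length cs. cs ! i * y ^ i) mod P
      in map (\<lambda>i. coeff z i = 1) [0..<d])"

definition lin_hash :: "nat \<Rightarrow> nat \<Rightarrow> nat \<times> nat \<Rightarrow> nat \<Rightarrow> nat" where
  "lin_hash p r = (\<lambda>(a, b) x. ((a * x + b) mod p) mod r)"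

text \<open>
  An output is \<open>(P, cs, p, Fs)\<close>: \<open>f\<close> is given by \<open>P\<close> and \<open>cs\<close>, and \<open>Fs ! i\<close> lists the pairs
  \<open>(a, b)\<close> of the functions of \<open>F\<^sub>i\<close> modulo \<open>p\<close>.
\<close>

type_synonym hashes = "bit poly \<times> bit poly list \<times> nat \<times> (nat \<times> nat) list list"

definition algorithm1 :: "nat \<Rightarrow> nat \<Rightarrow> bit poly \<Rightarrow> nat \<Rightarrow> hashes pmf" where
  "algorithm1 N k P p = do {
     cs \<leftarrow> pmf_of_set {cs. length cs = kappa k \<and> (\<forall>c\<in>set cs. degree c < degree P)};
     Fs \<leftarrow> replicate_pmf (2 ^ d_par k)
            (replicate_pmf (d2_par k) (pmf_of_set ({1..<p} \<times> {0..<p})));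
     return_pmf (P, cs, p, Fs)
   }"

definition algorithm2 :: "nat \<Rightarrow> nat \<Rightarrow> hashes \<Rightarrow> nat \<Rightarrow> nat set" where
  "algorithm2 N k = (\<lambda>(P, cs, p, Fs) x.
     (let j = bin_val (poly_hash P (d_par k) cs (bin (u_par N) x))
      in {j * d2_par k * d3_par k + (i - 1) * d3_par k + lin_hash p (d3_par k) (Fs ! j ! (i - 1)) x
          | i. i \<in> {1..d2_par k}}))"

definition poly_word :: "bit poly \<Rightarrow> nat" where
  "poly_word q = bin_val (map (\<lambda>i. coeff q i = 1) [0..<Suc (degree q)])"

definition encode :: "hashes \<Rightarrow> nat list" where
  "encode = (\<lambda>(P, cs, p, Fs).
     poly_word P # p # map poly_word cs @ concat (map (\<lambda>(a, b). [a, b]) (concat Fs)))"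

datatype var = vN | vK | vX | vU | vD | vn | vKappa | vD2 | vR | vD3 | vP | vp | vQ | vT | vY | vZ
  | vi | vl | vj | vb | vLen

text \<open>Both programs leave their output in the memory cells below the value of \<open>vLen\<close>.\<close>

definition result_of :: "var state \<times> nat \<Rightarrow> nat list" where
  "result_of = (\<lambda>((r, m), t). map m [0..<r vLen])"

definition emit :: "var exp \<Rightarrow> var com" where
  "emit e = (Store \<acute>vLen e;; vLen ::= \<acute>vLen [+] Num 1)"

definition params_prog :: "var com" where
  "params_prog = (
     vN ::= Inp (Num 0);;
     vK ::= Inp (Num 1);;
     vU ::= Num 1;;
     While (Num 1 [<<] \<acute>vU [<] \<acute>vN) (vU ::= \<acute>vU [+] Num 1);;
     vD ::= Num 1;;
     While (Op FloorLn (Num 1 [<<] \<acute>vD) \<acute>vK [<] \<acute>vK) (vD ::= \<acute>vD [+] Num 1);;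
     If (\<acute>vU [<] \<acute>vD) (vn ::= \<acute>vD) (vn ::= \<acute>vU);;
     vKappa ::= Op CeilLn (Num 12) \<acute>vK;;
     vD2 ::= Op CeilLn (Num 8) \<acute>vK;;
     vR ::= Op CeilLn (Num 13) \<acute>vK;;
     vD3 ::= \<acute>vR [*] \<acute>vR)"

text \<open>Trial division for the least prime \<open>p \<ge> N\<close>.\<close>

definition prime_prog :: "var com" where
  "prime_prog = (
     vp ::= \<acute>vN;;
     vQ ::= Num 2;;
     While (\<acute>vQ [<] \<acute>vp)
       (If (\<acute>vp [mod] \<acute>vQ [=] Num 0)
          (vp ::= \<acute>vp [+] Num 1;; vQ ::= Num 2)
          (vQ ::= \<acute>vQ [+] Num 1)))"

text \<open>
  Trial division for the least (as a bit pattern) irreducible polynomial of degree \<open>n\<close> over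
  \<open>GF(2)\<close>. The inner loop reduces \<open>T\<close>, initially \<open>P\<close>, modulo the candidate divisor \<open>Q\<close>; the test
  \<open>T xor (Q << i) < T\<close> asks whether the bit of \<open>T\<close> at the leading position of \<open>Q << i\<close> is set.
\<close>

definition irreducible_prog :: "var com" where
  "irreducible_prog = (
     vP ::= Num 1 [<<] \<acute>vn;;
     vQ ::= Num 2;;
     While (\<acute>vQ [<] Num 1 [<<] \<acute>vn)
       (vT ::= \<acute>vP;;
        vi ::= \<acute>vn [+] Num 1;;
        While (Num 0 [<] \<acute>vi)
          (vi ::= \<acute>vi [-] Num 1;;
           When ((\<acute>vT [xor] \<acute>vQ [<<] \<acute>vi) [<] \<acute>vT)
             (vT ::= \<acute>vT [xor] \<acute>vQ [<<] \<acute>vi));;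
        If (\<acute>vT [=] Num 0)
          (vP ::= \<acute>vP [+] Num 1;; vQ ::= Num 2)
          (vQ ::= \<acute>vQ [+] Num 1)))"

definition algorithm1_prog :: "var com" where
  "algorithm1_prog = (
     params_prog;;
     irreducible_prog;;
     prime_prog;;
     vLen ::= Num 0;;
     emit \<acute>vP;;
     emit \<acute>vp;;
     vi ::= Num 0;;
     While (\<acute>vi [<] \<acute>vKappa)
       (Rand vT (Num 1 [<<] \<acute>vn);;
        emit \<acute>vT;;
        vi ::= \<acute>vi [+] Num 1);;
     vi ::= Num 0;;
     While (\<acute>vi [<] Num 1 [<<] \<acute>vD)
       (vl ::= Num 0;;
        While (\<acute>vl [<] \<acute>vD2)
          (Rand vT (\<acute>vp [-] Num 1);;
           emit (\<acute>vT [+] Num 1);;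
           Rand vT \<acute>vp;;
           emit \<acute>vT;;
           vl ::= \<acute>vl [+] Num 1);;
        vi ::= \<acute>vi [+] Num 1))"

text \<open>
  The input is \<open>N, k, x\<close> followed by an encoded output of \<open>algorithm1\<close>. The nested loop is Horner's
  rule with shift-and-add multiplication by \<open>x\<close> in \<open>GF(2)[X] / (P)\<close>.
\<close>

definition algorithm2_prog :: "var com" where
  "algorithm2_prog = (
     params_prog;;
     vX ::= Inp (Num 2);;
     vP ::= Inp (Num 3);;
     vp ::= Inp (Num 4);;
     vY ::= Num 0;;
     vi ::= \<acute>vKappa;;
     While (Num 0 [<] \<acute>vi)
       (vi ::= \<acute>vi [-] Num 1;;
        vZ ::= Num 0;;
        vl ::= \<acute>vn;;
        While (Num 0 [<] \<acute>vl)
          (vl ::= \<acute>vl [-] Num 1;;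
           vZ ::= \<acute>vZ [<<] Num 1;;
           When (Num 1 [<<] \<acute>vn [<=] \<acute>vZ) (vZ ::= \<acute>vZ [xor] \<acute>vP);;
           When (\<acute>vX [>>] \<acute>vl [mod] Num 2) (vZ ::= \<acute>vZ [xor] \<acute>vY));;
        vY ::= \<acute>vZ [xor] Inp (Num 5 [+] \<acute>vi));;
     vj ::= \<acute>vY [mod] (Num 1 [<<] \<acute>vD);;
     vLen ::= Num 0;;
     vi ::= Num 1;;
     While (\<acute>vi [<=] \<acute>vD2)
       (vb ::= Num 5 [+] \<acute>vKappa [+] Num 2 [*] (\<acute>vj [*] \<acute>vD2 [+] (\<acute>vi [-] Num 1));;
        vT ::= (Inp \<acute>vb [*] \<acute>vX [+] Inp (\<acute>vb [+] Num 1)) [mod] \<acute>vp [mod] \<acute>vD3;;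
        emit (\<acute>vj [*] \<acute>vD2 [*] \<acute>vD3 [+] (\<acute>vi [-] Num 1) [*] \<acute>vD3 [+] \<acute>vT);;
        vi ::= \<acute>vi [+] Num 1))"

end

theory Submission
  imports Defs "HOL-Computational_Algebra.Field_as_Ring"
begin

text \<open>
  Both programs are executed symbolically. Every register stays polynomial in \<open>N\<close>, hence fits into
  \<open>O(log N)\<close> bits; for the two searches this needs a prime in \<open>[N, N ^ 6]\<close> (from
  \<open>2 ^ M \<le> (M + 1) * lcm(1, ..., M) \<le> (M + 1) * M ^ \<pi>(M)\<close>) and an irreducible polynomial of
  every degree \<open>n\<close> over \<open>GF(2)\<close> (from Gauss's count \<open>\<Sum>m | n. m * I(m) = 2 ^ n\<close>, where the proper
  divisors of \<open>n\<close> contribute less than \<open>2 ^ n\<close>). The space bound for Algorithm 1 holds because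
  \<open>2 ^ d \<le> 2 k / ln k\<close>, so the \<open>2 ^ d\<close> lists of \<open>O(log k)\<close> functions occupy \<open>O(k)\<close> words.
\<close>

section \<open>A polynomial bound for the next prime\<close>

text \<open>A fault leaves a program without any derivation, so correctness includes the absence of
  overflow in every intermediate value. This shapes the proof. Knowing that some prime lies above
  \<open>N\<close> would make the prime search terminate, but not within words of
  \<open>O(log N)\<close> bits; only a bound polynomial in \<open>N\<close> does. For the polynomial
  search existence in every degree is enough, since all candidates of degree \<open>n\<close> stay
  below \<open>2 ^ (n + 1)\<close>. Two judgements divide the work. \<open>run\<close> describes
  deterministic code by a time bound and a postcondition. \<open>samples\<close> describes
  randomised code by the distribution of its output list and records no time, because only space is
  claimed for Algorithm 1; hence the two searches need no running time. The specification draws the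
  coefficient list and each pair \<open>(a, b)\<close> at once, whereas the program draws word by
  word; the two distributions are identified by writing uniform draws from lists and products as
  independent draws.\<close>

lemma multiple_binomial_dvd_Lcm:
  fixes m n :: nat
  assumes "1 \<le> m" "m \<le> n"
  shows "m * (n choose m) dvd Lcm {1..n}"
proof -
  define L :: "nat \<Rightarrow> nat" where "L n = Lcm {1..n}" for n
  have L_mono: "L (n - 1) dvd L n" for n
    by (auto simp: L_def intro!: Lcm_subset)
  have "real (L n) / (real m * real (n choose m)) \<in> \<int>" if "1 \<le> m" "m \<le> n" for m n
    using that
  proof (induction m arbitrary: n rule: nat_induct_at_least)
    case base
    have "n dvd L n" unfolding L_def using base by (intro dvd_Lcm) auto
    then show ?case by (auto elim!: dvdE)
  next
    case (Suc m)
    let ?r = "\<lambda>n m. 1 / (real m * real (n choose m))"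
    have n: "n = Suc (n - 1)" "m \<le> n - 1" "m \<le> n" using Suc by auto
    have pos: "0 < (n - 1 choose m)" "0 < n choose m" "0 < n choose Suc m"
      using Suc by auto
    let ?C = "real (n - 1 choose (m - 1))"
    have a: "real m * real (n choose m) = real n * ?C"
      using Suc binomial_absorption[of "m - 1" n] by (simp flip: of_nat_mult)
    have b: "real (Suc m) * real (n choose Suc m) = real n * real (n - 1 choose m)"
      using binomial_absorption[of m n] by (metis of_nat_mult)
    have "m * (n - 1 choose m) = (n - m) * (n - 1 choose (m - 1))"
      using Suc binomial_absorption[of "m - 1" "n - 1"] binomial_absorb_comp[of "n - 1" "m - 1"]
      by simp
    then have c: "real m * real (n - 1 choose m) = (real n - real m) * ?C"
      using n by (metis of_nat_diff of_nat_mult)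
    then have d: "real (n - 1 choose m) = (real n - real m) * ?C / real m"
      using Suc by (simp add: field_simps)
    have "0 < real m" "real m < real n" "0 < ?C"
      using Suc by auto
    \<comment> \<open>This is the rule of the Leibniz harmonic triangle: an entry of one row is a
      difference of entries of this row and of the row above.\<close>
    then have eq: "?r n (Suc m) = ?r (n - 1) m - ?r n m"
      unfolding a b c unfolding d by (simp add: field_simps)
    \<comment> \<open>The induction hypothesis for row \<open>n - 1\<close> clears denominators with
      \<open>L (n - 1)\<close>; as this divides \<open>L n\<close>, the same holds with
      \<open>L n\<close>.\<close>
    obtain c where c: "L n = L (n - 1) * c" using L_mono by (auto elim: dvdE)
    have "real (L n) / (real (Suc m) * real (n choose Suc m)) =
        real c * (real (L (n - 1)) / (real m * real (n - 1 choose m))) - real (L n) / (real m * real (n choose m))"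
      using arg_cong[OF eq, of "\<lambda>x. real (L n) * x"] by (simp add: c algebra_simps)
    also have "\<dots> \<in> \<int>"
      by (intro Ints_diff Ints_mult Suc.IH Ints_of_nat n)
    finally show ?case .
  qed
  from this[OF assms] obtain z where z: "real (L n) / (real m * real (n choose m)) = of_int z"
    by (auto elim: Ints_cases)
  have "real (L n) = of_int z * real (m * (n choose m))"
    using z assms by (simp add: field_simps)
  then have "int (L n) = z * int (m * (n choose m))"
    by (metis of_int_eq_iff of_int_mult of_int_of_nat_eq)
  then have "int (m * (n choose m)) dvd int (L n)" by simp
  then show ?thesis unfolding L_def int_dvd_int_iff .
qed

text \<open>The \<open>n + 1\<close> binomial coefficients of row \<open>n\<close> sum to
  \<open>2 ^ n\<close>, and each divides the least common multiple.\<close>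

lemma power_2_le_Lcm: "2 ^ n \<le> (n + 1) * Lcm {1..n::nat}"
proof -
  have pos: "Lcm {1..n} \<noteq> 0" by (simp add: Lcm_0_iff)
  have "(n choose m) \<le> Lcm {1..n}" if "m \<le> n" for m
  proof (cases "m = 0")
    case True
    then show ?thesis using pos by (metis One_nat_def Suc_leI binomial_n_0 gr0I)
  next
    case False
    with that have "m * (n choose m) \<le> Lcm {1..n}"
      using multiple_binomial_dvd_Lcm[of m n] pos by (intro dvd_imp_le gr0I) auto
    moreover have "(n choose m) \<le> m * (n choose m)" using False by simp
    ultimately show ?thesis by linarith
  qed
  then have "(\<Sum>m\<le>n. n choose m) \<le> (\<Sum>m\<le>n. Lcm {1..n})"
    by (intro sum_mono) auto
  then show ?thesis by (simp add: choose_row_sum)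
qed

text \<open>In the factorization of any number up to \<open>n\<close>, each prime power is itself at
  most \<open>n\<close>. So the product over the primes \<open>p \<le> n\<close> of the largest
  power of \<open>p\<close> not above \<open>n\<close> is a common multiple, and each of its factors
  is at most \<open>n\<close>.\<close>

lemma Lcm_le_power_card_primes:
  "Lcm {1..n::nat} \<le> n ^ card {p. prime p \<and> p \<le> n}"
proof (cases "n = 0")
  case False
  define S where "S = {p. prime p \<and> p \<le> n}"
  define e where "e p = Max {e. p ^ e \<le> n}" for p
  have fin: "finite S" unfolding S_def by (rule finite_subset[of _ "{..n}"]) auto
  have fin_e: "finite {e. p ^ e \<le> n}" if "2 \<le> p" for p
  proof (rule finite_subset[of _ "{..n}"])
    show "{e. p ^ e \<le> n} \<subseteq> {..n}"
    proof safe
      fix e assume "p ^ e \<le> n"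
      moreover have "e < 2 ^ e" by simp
      moreover have "2 ^ e \<le> p ^ e" using that by (rule power_mono) simp
      ultimately show "e \<le> n" by linarith
    qed
  qed simp
  define M where "M = (\<Prod>p\<in>S. p ^ e p)"
  have "Lcm {1..n} dvd M"
  proof (rule Lcm_least)
    fix m assume m: "m \<in> {1..n}"
    have "prime_factors m \<subseteq> S"
    proof
      fix p assume "p \<in> prime_factors m"
      then have "prime p" "p dvd m" by (auto simp: in_prime_factors_iff)
      moreover have "p \<le> m" using m \<open>p dvd m\<close> by (intro dvd_imp_le) auto
      ultimately show "p \<in> S" using m by (simp add: S_def)
    qed
    have "m = (\<Prod>p\<in>prime_factors m. p ^ multiplicity p m)"
      using m by (intro prime_factorization_nat) auto
    also have "\<dots> dvd (\<Prod>p\<in>prime_factors m. p ^ e p)"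
    proof (rule prod_dvd_prod, rule le_imp_power_dvd)
      fix p assume p: "p \<in> prime_factors m"
      then have "2 \<le> p" by (simp add: in_prime_factors_iff prime_ge_2_nat)
      have "p ^ multiplicity p m \<le> m" using m by (intro dvd_imp_le multiplicity_dvd) auto
      then have "multiplicity p m \<in> {e. p ^ e \<le> n}" using m by simp
      then show "multiplicity p m \<le> e p"
        unfolding e_def using fin_e[OF \<open>2 \<le> p\<close>] by (rule Max_ge[rotated])
    qed
    also have "\<dots> dvd M"
      unfolding M_def by (rule prod_dvd_prod_subset) fact+
    finally show "m dvd M" .
  qed
  moreover have "M \<noteq> 0" using fin by (auto simp: M_def S_def)
  ultimately have "Lcm {1..n} \<le> M" by (intro dvd_imp_le) auto
  also have "M \<le> (\<Prod>p\<in>S. n)"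
    unfolding M_def
  proof (rule prod_mono, safe)
    fix p assume "p \<in> S"
    then have "finite {e. p ^ e \<le> n}" by (intro fin_e) (auto simp: S_def prime_ge_2_nat)
    moreover have "0 \<in> {e. p ^ e \<le> n}" using False by simp
    ultimately have "e p \<in> {e. p ^ e \<le> n}" unfolding e_def by (intro Max_in) (auto intro: exI[of _ 0])
    then show "p ^ e p \<le> n" by simp
  qed
  finally show ?thesis by (simp add: S_def)
next
  case True
  then have "{p. prime p \<and> p \<le> n} = {}" by (auto simp: prime_gt_0_nat)
  then show ?thesis using True by (simp only: card.empty) simp
qed

text \<open>If there were none, the primes up to \<open>M = N ^ 6\<close> would all lie below
  \<open>N\<close>, and \<open>2 ^ M\<close> would be at most \<open>(M + 1) * M ^ N\<close>, which
  is below \<open>2 ^ (6 * (N + 2) * N)\<close>. The number 6 is the least positive \<open>e\<close>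
  with \<open>e * (N + 2) * N \<le> N ^ e\<close> at \<open>N = 2\<close>.\<close>

lemma ex_prime_le_power:
  fixes N :: nat
  assumes "2 \<le> N"
  shows "\<exists>p. prime p \<and> N \<le> p \<and> p \<le> N ^ 6"
proof (rule ccontr)
  assume none: "\<nexists>p. prime p \<and> N \<le> p \<and> p \<le> N ^ 6"
  define M where "M = N ^ 6"
  have "{p. prime p \<and> p \<le> M} \<subseteq> {1..<N}"
    using none by (auto simp: M_def not_le[symmetric] prime_gt_0_nat Suc_leI)
  then have "card {p. prime p \<and> p \<le> M} \<le> card {1..<N}"
    by (intro card_mono) auto
  then have card: "card {p. prime p \<and> p \<le> M} \<le> N" by simp
  have M1: "1 \<le> M" using assms by (simp add: M_def)
  have "2 ^ M \<le> (M + 1) * M ^ card {p. prime p \<and> p \<le> M}"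
    by (rule order.trans[OF power_2_le_Lcm mult_le_mono2[OF Lcm_le_power_card_primes]])
  also have "\<dots> \<le> (M * M) * M ^ N"
  proof (intro mult_mono power_increasing card M1)
    have "2 ^ 6 \<le> M" unfolding M_def using assms by (rule power_mono) simp
    then have "2 * M \<le> M * M" by (intro mult_right_mono) auto
    then show "M + 1 \<le> M * M" using M1 by linarith
  qed auto
  also have "\<dots> = N ^ (6 * (N + 2))"
    by (simp add: M_def algebra_simps flip: power_add power_mult)
  also have "\<dots> < (2 ^ N) ^ (6 * (N + 2))"
    by (rule power_strict_mono) auto
  also have "\<dots> = 2 ^ (6 * (N + 2) * N)"
    by (simp add: mult.commute flip: power_mult)
  also have "\<dots> \<le> 2 ^ M"
  proof (rule power_increasing)
    have "2 ^ 4 * (N * N) \<le> N ^ 4 * (N * N)"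
      using assms by (intro mult_right_mono power_mono) auto
    also have "\<dots> = M"
      by (simp add: M_def mult.assoc eval_nat_numeral)
    finally have "16 * (N * N) \<le> M" by simp
    moreover have "2 * N \<le> N * N" using assms by (rule mult_right_mono) simp
    ultimately show "6 * (N + 2) * N \<le> M" unfolding distrib_left distrib_right mult.assoc by linarith
  qed simp
  finally show False by simp
qed

section \<open>Irreducible polynomials over \<open>GF(2)\<close>\<close>

instantiation bit ::
  "{unique_euclidean_ring, normalization_euclidean_semiring, normalization_semidom_multiplicative}"
begin

definition [simp]: "normalize_bit = (normalize_field :: bit \<Rightarrow> _)"
definition [simp]: "unit_factor_bit = (unit_factor_field :: bit \<Rightarrow> _)"
definition [simp]: "euclidean_size_bit = (euclidean_size_field :: bit \<Rightarrow> _)"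
definition [simp]: "division_segment (x :: bit) = 1"

instance
  by standard (auto simp: dvd_field_iff split: if_splits)

end

instantiation bit :: euclidean_ring_gcd
begin

definition gcd_bit :: "bit \<Rightarrow> bit \<Rightarrow> bit" where
  "gcd_bit = Euclidean_Algorithm.gcd"
definition lcm_bit :: "bit \<Rightarrow> bit \<Rightarrow> bit" where
  "lcm_bit = Euclidean_Algorithm.lcm"
definition Gcd_bit :: "bit set \<Rightarrow> bit" where
  "Gcd_bit = Euclidean_Algorithm.Gcd"
definition Lcm_bit :: "bit set \<Rightarrow> bit" where
  "Lcm_bit = Euclidean_Algorithm.Lcm"

instance by standard (simp_all add: gcd_bit_def lcm_bit_def Gcd_bit_def Lcm_bit_def)

end

instance bit :: field_gcd ..

section \<open>Bit patterns as polynomials over the two-element field\<close>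

text \<open>The inverse of \<open>poly_word\<close>. The list length \<open>v\<close> is a crude but
  sufficient bound, as every set bit of \<open>v\<close> has an index below
  \<open>v\<close>.\<close>

definition word_poly :: "nat \<Rightarrow> bit poly" where
  "word_poly v = Poly (map (\<lambda>i. of_bool (bit v i)) [0..<v])"

lemma bit_nat_imp_less: "bit v i \<Longrightarrow> i < (v :: nat)"
  by (metis Bit_Operations.bit_iff_odd bot_nat_0.not_eq_extremum div_less even_zero less_exp linorder_neqE_nat
      order.strict_trans)

lemma coeff_word_poly [simp]: "coeff (word_poly v) i = of_bool (bit v i)"
  by (auto simp: word_poly_def coeff_Poly_eq nth_default_def dest: bit_nat_imp_less)

lemma word_poly_eq_iff: "word_poly v = word_poly v' \<longleftrightarrow> v = v'"
proof
  assume "word_poly v = word_poly v'"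
  then have "coeff (word_poly v) i = coeff (word_poly v') i" for i by simp
  then have "bit v i = bit v' i" for i by (metis coeff_word_poly of_bool_eq_iff)
  then show "v = v'" by (rule bit_eqI)
qed simp

lemma word_poly_0 [simp]: "word_poly 0 = 0"
  by (simp add: poly_eq_iff)

lemma word_poly_eq_0_iff [simp]: "word_poly v = 0 \<longleftrightarrow> v = 0"
  using word_poly_eq_iff[of v 0] by simp

lemma bit_cases_of_bool: "of_bool (x = 1) = (x :: bit)"
  by (cases x) auto

text \<open>In characteristic 2 coefficients are added without carries. Together with the next lemma
  this turns the xor and shift operations of the programs into polynomial arithmetic.\<close>

lemma word_poly_xor: "word_poly (xor v v') = word_poly v + word_poly v'"
  by (auto simp: poly_eq_iff bit_xor_iff)

lemma word_poly_shift: "word_poly (v * 2 ^ i) = word_poly v * monom 1 i"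
  by (auto simp: poly_eq_iff coeff_monom_mult mult.commute[of _ "monom _ _"]
      simp flip: push_bit_eq_mult simp: bit_push_bit_iff)

lemma bit_poly_word [simp]: "bit (poly_word q) i \<longleftrightarrow> coeff q i = 1"
proof -
  have "coeff q i = 1 \<Longrightarrow> i < Suc (degree q)" by (simp add: le_degree less_Suc_eq_le)
  then show ?thesis
    by (auto simp: poly_word_def bin_val_def bit_horner_sum_bit_iff simp del: upt_Suc)
qed

lemma word_poly_poly_word [simp]: "word_poly (poly_word q) = q"
  by (simp add: poly_eq_iff bit_cases_of_bool)

lemma poly_word_word_poly [simp]: "poly_word (word_poly v) = v"
  by (rule bit_eqI) simp

lemma less_power_2_iff_bits: "v < 2 ^ n \<longleftrightarrow> (\<forall>i\<ge>n. \<not> bit (v::nat) i)"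
proof
  assume "v < 2 ^ n"
  then have "take_bit n v = v" by (simp add: take_bit_nat_eq_self_iff)
  then show "\<forall>i\<ge>n. \<not> bit v i" by (metis bit_take_bit_iff not_less)
next
  assume *: "\<forall>i\<ge>n. \<not> bit v i"
  have "take_bit n v = v"
  proof (rule bit_eqI)
    fix i
    show "bit (take_bit n v) i = bit v i"
      using *[rule_format, of i] by (cases "i < n") (simp_all add: bit_take_bit_iff)
  qed
  then show "v < 2 ^ n" by (simp add: take_bit_nat_eq_self_iff)
qed

text \<open>Zero is listed separately because its degree is 0, which is not below \<open>n\<close>
  when \<open>n = 0\<close>.\<close>

lemma word_poly_degree_less: "v < 2 ^ n \<longleftrightarrow> word_poly v = 0 \<or> degree (word_poly v) < n"
proof
  assume v: "v < 2 ^ n"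
  show "word_poly v = 0 \<or> degree (word_poly v) < n"
  proof (rule ccontr)
    assume *: "\<not> ?thesis"
    then have "coeff (word_poly v) (degree (word_poly v)) \<noteq> 0"
      unfolding leading_coeff_0_iff by blast
    then have "bit v (degree (word_poly v))" unfolding coeff_word_poly by (cases "bit v (degree (word_poly v))") simp_all
    moreover have "n \<le> degree (word_poly v)" using * by linarith
    ultimately show False using v unfolding less_power_2_iff_bits by blast
  qed
next
  assume *: "word_poly v = 0 \<or> degree (word_poly v) < n"
  show "v < 2 ^ n"
    unfolding less_power_2_iff_bits
  proof safe
    fix i assume "n \<le> i" "bit v i"
    then have c: "coeff (word_poly v) i \<noteq> 0" by simp
    then have "i \<le> degree (word_poly v)" by (rule le_degree)
    moreover have "word_poly v \<noteq> 0" using c by (metis coeff_0)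
    ultimately show False using * \<open>n \<le> i\<close> by linarith
  qed
qed

lemma degree_word_poly:
  assumes "2 ^ n \<le> v" "v < 2 ^ Suc n"
  shows "degree (word_poly v) = n"
proof -
  have "\<not> v < 2 ^ n" using assms(1) by linarith
  with assms(2) show ?thesis unfolding word_poly_degree_less by linarith
qed

lemma poly_word_less: "q \<noteq> 0 \<Longrightarrow> poly_word q < 2 ^ Suc (degree q)"
  using word_poly_degree_less[of "poly_word q" "Suc (degree q)"] by simp

lemma poly_word_ge: "q \<noteq> 0 \<Longrightarrow> 2 ^ degree q \<le> poly_word q"
  using word_poly_degree_less[of "poly_word q" "degree q"] by (simp add: not_less)

section \<open>Counting polynomials and their irreducible factors by degree\<close>

text \<open>Excluding 0 makes the count \<open>2 ^ n\<close> correct for \<open>n = 0\<close> as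
  well, where 1 is the only member.\<close>

definition polys_of_degree :: "nat \<Rightarrow> bit poly set" where
  "polys_of_degree n = {q. q \<noteq> 0 \<and> degree q = n}"

lemma bij_betw_polys_of_degree: "bij_betw word_poly {2 ^ n..<2 ^ Suc n} (polys_of_degree n)"
proof (rule bij_betwI[where g = poly_word])
  show "word_poly \<in> {2 ^ n..<2 ^ Suc n} \<rightarrow> polys_of_degree n"
    by (auto simp: polys_of_degree_def degree_word_poly) 
  show "poly_word \<in> polys_of_degree n \<rightarrow> {2 ^ n..<2 ^ Suc n}"
    using poly_word_less poly_word_ge by (fastforce simp: polys_of_degree_def)
qed auto

lemma finite_polys_of_degree [simp]: "finite (polys_of_degree n)"
  using bij_betw_finite[OF bij_betw_polys_of_degree] by blast

lemma card_polys_of_degree: "card (polys_of_degree n) = 2 ^ n"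
  using bij_betw_same_card[OF bij_betw_polys_of_degree] by simp

definition irreducibles :: "nat \<Rightarrow> bit poly set" where
  "irreducibles n = {q. irreducible q \<and> degree q = n}"

lemma irreducibles_subset: "irreducibles n \<subseteq> polys_of_degree n"
  by (auto simp: irreducibles_def polys_of_degree_def)

lemma finite_irreducibles [simp]: "finite (irreducibles n)"
  using irreducibles_subset by (rule finite_subset) simp

lemma bit_poly_is_unit_iff: "is_unit (q :: bit poly) \<longleftrightarrow> q = 1"
proof
  assume "is_unit q"
  then obtain c where "q = [:c:]" "c \<noteq> 0" by (auto simp: is_unit_poly_iff)
  then show "q = 1" by (simp add: pCons_one)
qed simp

lemma ex_irreducible_factor:
  fixes f :: "bit poly"
  assumes "0 < degree f"
  shows "\<exists>q g. irreducible q \<and> f = q * g"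
  using assms
proof (induction "degree f" arbitrary: f rule: less_induct)
  case less
  show ?case
  proof (cases "irreducible f")
    case True
    then show ?thesis by (intro exI[of _ f] exI[of _ 1]) simp
  next
    case False
    have "f \<noteq> 0" "\<not> is_unit f" using less by (auto simp: bit_poly_is_unit_iff)
    with False obtain a b where ab: "f = a * b" "\<not> is_unit a" "\<not> is_unit b"
      by (auto simp: irreducible_def)
    with \<open>f \<noteq> 0\<close> have "a \<noteq> 0" "b \<noteq> 0" by auto
    with ab have "0 < degree a" "0 < degree b" by (auto simp: is_unit_iff_degree)
    with ab \<open>a \<noteq> 0\<close> \<open>b \<noteq> 0\<close> less(1)[of a] obtain q g where "irreducible q" "a = q * g"
      by (auto simp: degree_mult_eq)
    then show ?thesis using ab by (intro exI[of _ q] exI[of _ "g * b"]) (simp add: mult.assoc)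
  qed
qed

lemma irreducible_degree_pos: "irreducible (q :: bit poly) \<Longrightarrow> 0 < degree q"
  by (metis bot_nat_0.not_eq_extremum irreducible_def is_unit_iff_degree)

text \<open>The degree of \<open>f\<close> is the total degree of its irreducible factors with
  multiplicity; splitting off one factor \<open>q\<close> lowers both sides by
  \<open>degree q\<close>. Grouping by the degree \<open>m\<close> up to a fixed \<open>n\<close>
  makes the index set finite and the same for all \<open>f\<close> of degree at most
  \<open>n\<close>.\<close>

lemma sum_multiplicity_irreducibles:
  fixes f :: "bit poly"
  assumes "f \<noteq> 0" "degree f \<le> n"
  shows "(\<Sum>m=1..n. \<Sum>q\<in>irreducibles m. m * multiplicity q f) = degree f"
  using assms
proof (induction "degree f" arbitrary: f rule: less_induct)
  case less
  show ?case
  proof (cases "degree f = 0")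
    case True
    then have "is_unit f" using less by (simp add: is_unit_iff_degree)
    then show ?thesis using True by (simp add: multiplicity_unit_right)
  next
    case False
    then obtain q g where q: "irreducible q" and f: "f = q * g"
      using ex_irreducible_factor by blast
    have "g \<noteq> 0" "q \<noteq> 0" using less f by auto
    have deg: "degree f = degree q + degree g"
      unfolding f by (rule degree_mult_eq) fact+
    have "0 < degree q" using irreducible_degree_pos[OF q] .
    have mult: "multiplicity r f = of_bool (r = q) + multiplicity r g" if "irreducible r" for r
    proof -
      have r: "prime_elem r" using that by (rule field_poly_irreducible_imp_prime)
      \<comment> \<open>The only unit is 1, so an irreducible polynomial dividing the irreducible
        \<open>q\<close> equals \<open>q\<close>.\<close>
      have "multiplicity r q = of_bool (r = q)"
      proof (cases "r = q")
        case True
        then show ?thesis using r by simp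
      next
        case False
        have "\<not> r dvd q"
        proof
          assume "r dvd q"
          then obtain s where s: "q = r * s" by (elim dvdE)
          then have "is_unit s" using q that by (auto simp: irreducible_def)
          then show False using s False by (simp add: bit_poly_is_unit_iff)
        qed
        then show ?thesis using False by (simp add: not_dvd_imp_multiplicity_0)
      qed
      then show ?thesis
        unfolding f using r \<open>g \<noteq> 0\<close> \<open>q \<noteq> 0\<close> by (simp add: prime_elem_multiplicity_mult_distrib)
    qed
    have "(\<Sum>m=1..n. \<Sum>r\<in>irreducibles m. m * multiplicity r f) =
        (\<Sum>m=1..n. \<Sum>r\<in>irreducibles m. m * of_bool (r = q)) +
        (\<Sum>m=1..n. \<Sum>r\<in>irreducibles m. m * multiplicity r g)"
      by (simp add: mult irreducibles_def add_mult_distrib2 sum.distrib)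
    also have "(\<Sum>m=1..n. \<Sum>r\<in>irreducibles m. m * multiplicity r g) = degree g"
      using less(3) deg \<open>0 < degree q\<close> \<open>g \<noteq> 0\<close> by (intro less(1)) auto
    also have "(\<Sum>m=1..n. \<Sum>r\<in>irreducibles m. m * of_bool (r = q)) =
        (\<Sum>m=1..n. if m = degree q then degree q else 0)"
    proof (rule sum.cong)
      fix m
      have "(\<Sum>r\<in>irreducibles m. m * of_bool (r = q)) = (\<Sum>r\<in>irreducibles m. if r = q then m else 0)"
        by (intro sum.cong) auto
      also have "\<dots> = (if q \<in> irreducibles m then m else 0)"
        by simp
      also have "\<dots> = (if m = degree q then degree q else 0)"
        using q by (simp add: irreducibles_def)
      finally show "(\<Sum>r\<in>irreducibles m. m * of_bool (r = q)) = (if m = degree q then degree q else 0)" .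
    qed simp
    also have "\<dots> = degree q" using deg less(3) \<open>0 < degree q\<close> by simp
    finally show ?thesis by (simp add: deg)
  qed
qed

text \<open>Multiplication by \<open>q\<close> is a bijection from the polynomials of degree
  \<open>n - m\<close> onto the multiples of \<open>q\<close> of degree \<open>n\<close>.\<close>

lemma card_multiples_of_degree:
  assumes "q \<in> polys_of_degree m"
  shows "card {f \<in> polys_of_degree n. q dvd f} = (if m \<le> n then 2 ^ (n - m) else 0)"
proof (cases "m \<le> n")
  case True
  have q: "q \<noteq> 0" "degree q = m" using assms by (auto simp: polys_of_degree_def)
  have "bij_betw ((*) q) (polys_of_degree (n - m)) {f \<in> polys_of_degree n. q dvd f}"
    unfolding bij_betw_def
  proof
    show "inj_on ((*) q) (polys_of_degree (n - m))" using q by (auto simp: inj_on_def)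
    show "(*) q ` polys_of_degree (n - m) = {f \<in> polys_of_degree n. q dvd f}"
    proof (intro equalityI subsetI)
      fix f assume "f \<in> {f \<in> polys_of_degree n. q dvd f}"
      then obtain g where "f = q * g" "f \<noteq> 0" "degree f = n"
        by (auto simp: polys_of_degree_def elim!: dvdE)
      moreover from this have "g \<in> polys_of_degree (n - m)"
        using q by (auto simp: polys_of_degree_def degree_mult_eq)
      ultimately show "f \<in> (*) q ` polys_of_degree (n - m)" by blast
    qed (use q True in \<open>auto simp: polys_of_degree_def degree_mult_eq\<close>)
  qed
  from bij_betw_same_card[OF this] show ?thesis using True by (simp add: card_polys_of_degree)
next
  case False
  then have "\<not> q dvd f" if "f \<in> polys_of_degree n" for f
    using assms that dvd_imp_degree_le[of q f] by (auto simp: polys_of_degree_def)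
  then have "{f \<in> polys_of_degree n. q dvd f} = {}"
    by blast
  then show ?thesis using False by simp
qed

text \<open>Counts the powers of \<open>q\<close> that divide \<open>f\<close>. Writing the
  multiplicity as a sum of indicators allows the order of summation to be exchanged in the count
  that follows.\<close>

lemma multiplicity_eq_sum:
  fixes f :: "bit poly"
  assumes "irreducible q" "f \<noteq> 0" "degree f \<le> n"
  shows "multiplicity q f = (\<Sum>j=1..n. of_bool (q ^ j dvd f))"
proof -
  have q: "\<not> is_unit q" "q \<noteq> 0" using assms by (auto simp: irreducible_def)
  have "q ^ multiplicity q f dvd f" by (rule multiplicity_dvd)
  then have "degree (q ^ multiplicity q f) \<le> n"
    using dvd_imp_degree_le[OF _ assms(2)] assms(3) le_trans by blast
  then have "multiplicity q f * degree q \<le> n" using q by (simp add: degree_power_eq)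
  then have le: "multiplicity q f \<le> n"
    using mult_le_mono2[of 1 "degree q" "multiplicity q f"] irreducible_degree_pos[OF assms(1)] by linarith
  have "(\<Sum>j=1..n. of_bool (q ^ j dvd f)) = card {j \<in> {1..n}. q ^ j dvd f}"
    by (simp add: sum.If_cases of_bool_def Int_def)
  also have "{j \<in> {1..n}. q ^ j dvd f} = {1..multiplicity q f}"
    using q assms(2) le by (auto simp: power_dvd_iff_le_multiplicity)
  finally show ?thesis by simp
qed

text \<open>Gauss's count: adding up the degrees of the irreducible factors of all polynomials of
  degree \<open>n\<close> gives a recursion for the number of irreducible polynomials.\<close>

lemma sum_degrees_irreducible_factors:
  "(\<Sum>m=1..n. \<Sum>j=1..n. if m * j \<le> n then m * card (irreducibles m) * 2 ^ (n - m * j) else 0) = n * 2 ^ n"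
proof -
  have "n * 2 ^ n = (\<Sum>f\<in>polys_of_degree n. degree f)"
    by (simp add: polys_of_degree_def[symmetric] card_polys_of_degree[symmetric])
      (simp add: polys_of_degree_def)
  also have "\<dots> = (\<Sum>f\<in>polys_of_degree n. \<Sum>m=1..n. \<Sum>q\<in>irreducibles m. \<Sum>j=1..n. m * of_bool (q ^ j dvd f))"
  proof (rule sum.cong[OF refl])
    fix f assume f: "f \<in> polys_of_degree n"
    then have "degree f = (\<Sum>m=1..n. \<Sum>q\<in>irreducibles m. m * multiplicity q f)"
      by (subst sum_multiplicity_irreducibles) (auto simp: polys_of_degree_def)
    also have "\<dots> = (\<Sum>m=1..n. \<Sum>q\<in>irreducibles m. \<Sum>j=1..n. m * of_bool (q ^ j dvd f))"
      using f by (intro sum.cong refl, subst multiplicity_eq_sum[of _ _ n])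
        (auto simp: polys_of_degree_def irreducibles_def sum_distrib_left)
    finally show "degree f = \<dots>" .
  qed
  \<comment> \<open>Double counting: instead of the powers dividing a given \<open>f\<close>, count
    the \<open>f\<close> divisible by a given power \<open>q ^ j\<close>, which has degree
    \<open>m * j\<close>.\<close>
  also have "\<dots> = (\<Sum>m=1..n. \<Sum>q\<in>irreducibles m. \<Sum>j=1..n. \<Sum>f\<in>polys_of_degree n. m * of_bool (q ^ j dvd f))"
    by (simp only: sum.swap[where B = "polys_of_degree n"])
  also have "\<dots> = (\<Sum>m=1..n. \<Sum>q\<in>irreducibles m. \<Sum>j=1..n. if m * j \<le> n then m * 2 ^ (n - m * j) else 0)"
  proof (intro sum.cong refl)
    fix m q j assume q: "q \<in> irreducibles m"
    have "q ^ j \<in> polys_of_degree (m * j)"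
      using q by (auto simp: irreducibles_def polys_of_degree_def degree_power_eq irreducible_def)
    from card_multiples_of_degree[OF this, of n]
    show "(\<Sum>f\<in>polys_of_degree n. m * of_bool (q ^ j dvd f)) = (if m * j \<le> n then m * 2 ^ (n - m * j) else 0)"
      by (simp add: sum_distrib_left[symmetric] of_bool_def sum.If_cases Int_def)
  qed
  also have "\<dots> = (\<Sum>m=1..n. \<Sum>j=1..n. if m * j \<le> n then m * card (irreducibles m) * 2 ^ (n - m * j) else 0)"
    by (simp add: sum_distrib_left if_distrib mult_ac cong: if_cong)
  finally show ?thesis ..
qed

text \<open>The difference of the previous identity at \<open>n\<close> and twice the identity at
  \<open>n - 1\<close>. A term with \<open>m * j < n\<close> doubles when \<open>n - 1\<close>
  becomes \<open>n\<close>, so it cancels, and only the terms with \<open>m * j = n\<close> survive;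
  the right side is \<open>n * 2 ^ n - (n - 1) * 2 ^ n = 2 ^ n\<close>.\<close>

lemma sum_card_irreducibles:
  assumes "0 < n"
  shows "(\<Sum>m=1..n. \<Sum>j=1..n. if m * j = n then m * card (irreducibles m) else 0) = 2 ^ n"
proof -
  obtain n' where n: "n = Suc n'" using assms by (cases n) auto
  define a where "a m = m * card (irreducibles m)" for m
  \<comment> \<open>The cut-off \<open>n\<close> on \<open>m * j\<close> is separated from the range
    \<open>l\<close> of the indices, so that the sum for \<open>n'\<close> can be taken over the
    range of the sum for \<open>n\<close>. By \<open>large\<close> the extra indices contribute
    nothing.\<close>
  define S where "S n l = (\<Sum>m=1..l. \<Sum>j=1..l. if m * j \<le> n then a m * 2 ^ (n - m * j) else 0)" for n l
  have S: "S n n = n * 2 ^ n" for n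
    using sum_degrees_irreducible_factors[of n] unfolding S_def a_def .
  have large: "n' < m * j" if "1 \<le> m" "1 \<le> j" "m = n \<or> j = n" for m j
  proof -
    have "n \<le> m * j" using that by auto
    then show ?thesis by (simp add: n)
  qed
  define T where "T l m = (\<Sum>j=1..l. if m * j \<le> n' then a m * 2 ^ (n' - m * j) else 0)" for l m
  have "S n' n = S n' n'"
  proof -
    have "T n n = 0"
      unfolding T_def
    proof (intro sum.neutral ballI)
      fix j assume "j \<in> {1..n}"
      then have "\<not> n * j \<le> n'" using large[of n j] assms by auto
      then show "(if n * j \<le> n' then a n * 2 ^ (n' - n * j) else 0) = 0" by simp
    qed
    moreover have "T n m = T n' m" if "1 \<le> m" for m
      unfolding T_def using large[of m n] that by (simp add: n not_le)
    then have "(\<Sum>m=1..n'. T n m) = (\<Sum>m=1..n'. T n' m)" by (intro sum.cong) auto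
    moreover have "S n' n = (\<Sum>m=1..n. T n m)" "S n' n' = (\<Sum>m=1..n'. T n' m)"
      by (simp_all add: S_def T_def)
    ultimately show ?thesis by (simp add: n)
  qed
  moreover have "S n n = 2 * S n' n + (\<Sum>m=1..n. \<Sum>j=1..n. if m * j = n then a m else 0)"
    unfolding S_def sum_distrib_left sum.distrib[symmetric]
    by (intro sum.cong refl) (auto simp: n le_Suc_eq Suc_diff_le)
  ultimately have "n * 2 ^ n = 2 * (n' * 2 ^ n') + (\<Sum>m=1..n. \<Sum>j=1..n. if m * j = n then a m else 0)"
    using S by metis
  then have "(\<Sum>m=1..n. \<Sum>j=1..n. if m * j = n then a m else 0) = 2 ^ n"
    by (simp add: n del: sum.cl_ivl_Suc)
  then show ?thesis unfolding a_def .
qed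

lemma ex_irreducible_bit_poly:
  assumes "0 < n"
  shows "\<exists>q :: bit poly. irreducible q \<and> degree q = n"
proof -
  define a where "a m = m * card (irreducibles m)" for m
  define b where "b n m = (\<Sum>j=1..n. if m * j = n then a m else 0)" for n m
  have b: "(\<Sum>m=1..n. b n m) = 2 ^ n" if "0 < n" for n
    using sum_card_irreducibles[OF that] unfolding b_def a_def .
  have bn: "b n n = a n" if "0 < n" for n
  proof -
    have "b n n = (\<Sum>j=1..n. if j = 1 then a n else 0)"
      unfolding b_def using that by (intro sum.cong) auto
    also have "\<dots> = a n" using that by simp
    finally show ?thesis .
  qed
  \<comment> \<open>The identity at \<open>m\<close> itself: \<open>a m\<close> is one of the
    nonnegative terms that add up to \<open>2 ^ m\<close>.\<close>
  have a_le: "a m \<le> 2 ^ m" if "0 < m" for m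
    using member_le_sum[of m "{1..m}" "b m"] b[of m] bn[of m] that by simp
  have b_le: "b n m \<le> a m" for m
  proof (cases "\<exists>j\<in>{1..n}. m * j = n")
    case True
    then obtain i where i: "i \<in> {1..n}" "m * i = n" by blast
    have "b n m = (\<Sum>j=1..n. if j = i then a m else 0)"
      unfolding b_def using i assms by (intro sum.cong) auto
    then show ?thesis using i by simp
  qed (auto simp: b_def)
  \<comment> \<open>Even if every \<open>m < n\<close> contributed its maximum \<open>2 ^ m\<close>,
    at least 2 of the total \<open>2 ^ n\<close> would remain for \<open>m = n\<close>.\<close>
  have geometric: "(\<Sum>m=1..<n. 2 ^ m) + 2 \<le> (2::nat) ^ n" if "0 < n" for n
    using that by (induction n rule: nat_induct_non_zero) auto
  have "2 ^ n = (\<Sum>m=1..n. b n m)" using b assms by simp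
  also have "\<dots> = (\<Sum>m=1..<n. b n m) + a n"
    using assms bn by (simp add: sum.last_plus atLeastLessThanSuc_atLeastAtMost[symmetric] add.commute)
  also have "\<dots> \<le> (\<Sum>m=1..<n. 2 ^ m) + a n"
    using b_le a_le by (intro add_right_mono sum_mono) (auto intro: le_trans[OF b_le])
  finally have "0 < a n" using geometric[OF assms] by linarith
  then have "irreducibles n \<noteq> {}" by (auto simp: a_def)
  then show ?thesis by (auto simp: irreducibles_def)
qed

section \<open>Reasoning about programs\<close>

text \<open>Total correctness with a time bound: the outcome is a point mass, and the exact time is
  hidden behind the upper bound \<open>T\<close>, so bounds of different branches can be
  joined.\<close>

definition run ::
  "nat \<Rightarrow> nat \<Rightarrow> nat list \<Rightarrow> 'r com \<Rightarrow> 'r state \<Rightarrow> nat \<Rightarrow> ('r state \<Rightarrow> bool) \<Rightarrow> bool" where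
  "run w S inp c s T Q \<longleftrightarrow> (\<exists>s' t. exec w S inp c s (return_pmf (s', t)) \<and> t \<le> T \<and> Q s')"

lemma runI:
  "exec w S inp c s (return_pmf (s', t)) \<Longrightarrow> t \<le> T \<Longrightarrow> Q s' \<Longrightarrow> run w S inp c s T Q"
  unfolding run_def by blast

lemma runE:
  assumes "run w S inp c s T Q"
  obtains s' t where "exec w S inp c s (return_pmf (s', t))" "t \<le> T" "Q s'"
  using assms unfolding run_def by blast

lemma run_mono:
  "run w S inp c s T Q \<Longrightarrow> T \<le> T' \<Longrightarrow> (\<And>s'. Q s' \<Longrightarrow> Q' s') \<Longrightarrow> run w S inp c s T' Q'"
  unfolding run_def using order.trans by blast

lemma run_Assign:
  "eval w S inp (r, m) e = Some v \<Longrightarrow> Q (r(x := v), m) \<Longrightarrow>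
    run w S inp (x ::= e) (r, m) (cost e + 1) Q"
  by (rule runI[OF exec_Assign]) auto

lemma run_Store:
  "eval w S inp (r, m) ea = Some a \<Longrightarrow> a < S \<Longrightarrow> eval w S inp (r, m) e = Some v \<Longrightarrow>
    Q (r, m(a := v)) \<Longrightarrow> run w S inp (Store ea e) (r, m) (cost ea + cost e + 1) Q"
  by (rule runI[OF exec_Store]) auto

text \<open>The intermediate assertion is the judgement for the remaining program. Applied
  repeatedly, the rule executes a straight-line program symbolically while unification accumulates
  the time.\<close>

lemma run_Seq:
  assumes "run w S inp c1 s T1 (\<lambda>s'. run w S inp c2 s' T2 Q)"
  shows "run w S inp (c1;; c2) s (T1 + T2) Q"
proof -
  obtain s1 t1 s2 t2 where *: "exec w S inp c1 s (return_pmf (s1, t1))" "t1 \<le> T1"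
    "exec w S inp c2 s1 (return_pmf (s2, t2))" "t2 \<le> T2" "Q s2"
    using assms unfolding run_def by blast
  have "exec w S inp (c1;; c2) s
      (bind_pmf (return_pmf (s1, t1)) (\<lambda>(s1, t1). delay t1 (return_pmf (s2, t2))))"
    by (rule exec_Seq[OF *(1)]) (use * in auto)
  then have "exec w S inp (c1;; c2) s (return_pmf (s2, t1 + t2))"
    by (simp add: bind_return_pmf)
  then show ?thesis by (rule runI) (use * in auto)
qed

lemma run_If:
  assumes "eval w S inp s b = Some v"
    and "v \<noteq> 0 \<Longrightarrow> run w S inp c1 s T1 Q" and "v = 0 \<Longrightarrow> run w S inp c2 s T2 Q"
  shows "run w S inp (If b c1 c2) s (max T1 T2 + cost b + 1) Q"
proof -
  have "run w S inp (if v \<noteq> 0 then c1 else c2) s (max T1 T2) Q"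
    using assms(2,3) by (cases "v = 0") (auto elim!: run_mono)
  then obtain s' t where *: "exec w S inp (if v \<noteq> 0 then c1 else c2) s (return_pmf (s', t))"
      "t \<le> max T1 T2" "Q s'"
    by (rule runE)
  have "exec w S inp (If b c1 c2) s (return_pmf (s', cost b + 1 + t))"
    using exec_If[OF assms(1) *(1)] by simp
  then show ?thesis by (rule runI) (use * in auto)
qed

lemma run_When:
  assumes "eval w S inp s b = Some v"
    and "v \<noteq> 0 \<Longrightarrow> run w S inp c s T Q" and "v = 0 \<Longrightarrow> Q s"
  shows "run w S inp (When b c) s (T + cost b + 1) Q"
proof (cases "v = 0")
  case True
  then show ?thesis using assms by (intro runI[OF exec_When_False]) auto
next
  case False
  then obtain s' t where *: "exec w S inp c s (return_pmf (s', t))" "t \<le> T" "Q s'"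
    using assms(2) by (auto elim: runE)
  have "exec w S inp (When b c) s (return_pmf (s', cost b + 1 + t))"
    using exec_When_True[OF assms(1) False *(1)] by simp
  then show ?thesis by (rule runI) (use * in auto)
qed

text \<open>The loop rule for the searches, whose number of rounds is not known in advance: the
  variant \<open>f\<close> decreases in every round and starts at no more than
  \<open>K\<close>.\<close>

lemma run_While:
  fixes f :: "'r state \<Rightarrow> nat"
  assumes init: "I s" "f s \<le> K"
    and eval: "\<And>s. I s \<Longrightarrow> \<exists>v. eval w S inp s b = Some v"
    and step: "\<And>s v. I s \<Longrightarrow> eval w S inp s b = Some v \<Longrightarrow> v \<noteq> 0 \<Longrightarrow>
      run w S inp c s T (\<lambda>s'. I s' \<and> f s' < f s)"
    and exit: "\<And>s. I s \<Longrightarrow> eval w S inp s b = Some 0 \<Longrightarrow> Q s"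
  shows "run w S inp (While b c) s (K * (T + cost b + 1) + cost b + 1) Q"
  using init
proof (induction K arbitrary: s)
  case (0 s)
  obtain v where v: "eval w S inp s b = Some v" using eval 0 by blast
  have "v = 0"
  proof (rule ccontr)
    assume "v \<noteq> 0"
    from step[OF 0(1) v this] show False by (rule runE) (use 0(2) in auto)
  qed
  then show ?case using exit[OF 0(1)] v by (intro runI[OF exec_While_False]) auto
next
  case (Suc K s)
  obtain v where v: "eval w S inp s b = Some v" using eval Suc by blast
  show ?case
  proof (cases "v = 0")
    case True
    then show ?thesis using exit[OF Suc.prems(1)] v by (intro runI[OF exec_While_False]) auto
  next
    case False
    have "run w S inp c s T (\<lambda>s'. run w S inp (While b c) s' (K * (T + cost b + 1) + cost b + 1) Q)"
      by (rule run_mono[OF step[OF Suc.prems(1) v False] order.refl], rule Suc.IH)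
        (use Suc.prems(2) in auto)
    from run_Seq[OF this] obtain s' t where
      *: "exec w S inp (c;; While b c) s (return_pmf (s', t))"
        "t \<le> T + (K * (T + cost b + 1) + cost b + 1)" "Q s'"
      by (rule runE)
    have "exec w S inp (While b c) s (return_pmf (s', cost b + 1 + t))"
      using exec_While_True[OF v False *(1)] by simp
    then show ?thesis by (rule runI) (use * in auto)
  qed
qed

lemma run_le: "run w S inp c s T Q \<Longrightarrow> T \<le> T' \<Longrightarrow> run w S inp c s T' Q"
  by (rule run_mono)

text \<open>The loop rule for exactly \<open>K\<close> rounds. The invariant is indexed by the
  number of completed rounds, and its last instance is the postcondition.\<close>

lemma run_for_loop:
  assumes "I 0 s"
    and guard: "\<And>j s. I j s \<Longrightarrow> j < K \<Longrightarrow> \<exists>v. eval w S inp s b = Some v \<and> v \<noteq> 0"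
    and body: "\<And>j s. I j s \<Longrightarrow> j < K \<Longrightarrow> run w S inp c s T (I (Suc j))"
    and exit: "\<And>s. I K s \<Longrightarrow> eval w S inp s b = Some 0"
  shows "run w S inp (While b c) s (K * (T + cost b + 1) + cost b + 1) (I K)"
proof -
  have "run w S inp (While b c) s ((K - j) * (T + cost b + 1) + cost b + 1) (I K)"
    if "I j s" "j \<le> K" for j s
    using that
  proof (induction "K - j" arbitrary: j s)
    case 0
    then show ?case using exit[of s] by (intro runI[OF exec_While_False]) auto
  next
    case (Suc l)
    then have j: "j < K" "l = K - Suc j" by auto
    obtain v where v: "eval w S inp s b = Some v" "v \<noteq> 0" using guard Suc.prems j by blast
    have "run w S inp c s T (\<lambda>s'. run w S inp (While b c) s' (l * (T + cost b + 1) + cost b + 1) (I K))"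
      by (rule run_mono[OF body[OF Suc.prems(1) j(1)] order.refl]) (use Suc.hyps(1)[OF j(2)] j in simp)
    from run_Seq[OF this] obtain s' t where
      *: "exec w S inp (c;; While b c) s (return_pmf (s', t))"
        "t \<le> T + (l * (T + cost b + 1) + cost b + 1)" "I K s'"
      by (rule runE)
    have "exec w S inp (While b c) s (return_pmf (s', cost b + 1 + t))"
      using exec_While_True[OF v *(1)] by simp
    then show ?case unfolding Suc.hyps(2)[symmetric] by (rule runI) (use * in auto)
  qed
  from this[OF assms(1)] show ?thesis by simp
qed

text \<open>For the randomised program only the distribution of the written list is tracked; the rest of
  the final state is merely constrained by \<open>Q\<close>.\<close>

definition written :: "var state \<Rightarrow> nat list" where
  "written s = map (snd s) [0..<fst s vLen]"

definition samples ::
  "nat \<Rightarrow> nat \<Rightarrow> nat list \<Rightarrow> var com \<Rightarrow> var state \<Rightarrow> nat list pmf \<Rightarrow> (var state \<Rightarrow> bool) \<Rightarrow> bool"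
  where
  "samples w S inp c s M Q \<longleftrightarrow> (\<exists>D. exec w S inp c s D \<and> map_pmf (\<lambda>x. written (fst x)) D = M \<and>
     (\<forall>(s', t)\<in>set_pmf D. Q s'))"

lemma samples_run:
  assumes "run w S inp c s T (\<lambda>s'. written s' = ys \<and> Q s')"
  shows "samples w S inp c s (return_pmf ys) Q"
proof -
  obtain s' t where "exec w S inp c s (return_pmf (s', t))" "written s' = ys" "Q s'"
    using assms by (auto elim!: runE)
  then show ?thesis unfolding samples_def by (intro exI[of _ "return_pmf (s', t)"]) auto
qed

text \<open>The distribution produced by the second command may depend on the intermediate state
  only through the list written so far; whatever else the second command relies on has to be
  recorded in \<open>Q1\<close>.\<close>

lemma samples_Seq:
  assumes "samples w S inp c1 s M1 Q1"
    and "\<And>s1. Q1 s1 \<Longrightarrow> samples w S inp c2 s1 (M2 (written s1)) Q2"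
  shows "samples w S inp (c1;; c2) s (bind_pmf M1 M2) Q2"
proof -
  obtain D1 where D1: "exec w S inp c1 s D1" "map_pmf (\<lambda>x. written (fst x)) D1 = M1"
    "\<And>s' t. (s', t) \<in> set_pmf D1 \<Longrightarrow> Q1 s'"
    using assms(1) unfolding samples_def by auto
  have "\<exists>D2. \<forall>s1. Q1 s1 \<longrightarrow> exec w S inp c2 s1 (D2 s1) \<and>
      map_pmf (\<lambda>x. written (fst x)) (D2 s1) = M2 (written s1) \<and> (\<forall>(s', t)\<in>set_pmf (D2 s1). Q2 s')"
    using assms(2) unfolding samples_def by (intro choice) blast
  then obtain D2 where D2: "\<And>s1. Q1 s1 \<Longrightarrow> exec w S inp c2 s1 (D2 s1)"
    "\<And>s1. Q1 s1 \<Longrightarrow> map_pmf (\<lambda>x. written (fst x)) (D2 s1) = M2 (written s1)"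
    "\<And>s1. Q1 s1 \<Longrightarrow> \<forall>(s', t)\<in>set_pmf (D2 s1). Q2 s'"
    by blast
  define D where "D = bind_pmf D1 (\<lambda>(s1, t1). delay t1 (D2 s1))"
  have "exec w S inp (c1;; c2) s D"
    unfolding D_def using D1 D2 by (blast intro: exec_Seq)
  moreover have "map_pmf (\<lambda>x. written (fst x)) D = bind_pmf M1 M2"
  proof -
    have "map_pmf (\<lambda>x. written (fst x)) D =
        bind_pmf D1 (\<lambda>x. map_pmf (\<lambda>x. written (fst x)) (D2 (fst x)))"
      unfolding D_def map_bind_pmf
      by (intro bind_pmf_cong refl) (auto simp: pmf.map_comp o_def case_prod_beta)
    also have "\<dots> = bind_pmf D1 (\<lambda>x. M2 (written (fst x)))"
      using D1(3) D2(2) by (intro bind_pmf_cong refl) auto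
    also have "\<dots> = bind_pmf M1 M2"
      unfolding D1(2)[symmetric] bind_map_pmf by (simp add: case_prod_beta)
    finally show ?thesis .
  qed
  moreover have "\<forall>(s', t)\<in>set_pmf D. Q2 s'"
    unfolding D_def using D1(3) D2(3) by fastforce
  ultimately show ?thesis unfolding samples_def by blast
qed

text \<open>For a deterministic prefix whose written list is irrelevant, such as the computation of
  the parameters.\<close>

lemma samples_run_Seq:
  assumes "run w S inp c1 s T Q1" and "\<And>s1. Q1 s1 \<Longrightarrow> samples w S inp c2 s1 M Q"
  shows "samples w S inp (c1;; c2) s M Q"
proof -
  obtain s' t where s': "exec w S inp c1 s (return_pmf (s', t))" "t \<le> T" "Q1 s'"
    using assms(1) by (rule runE)
  have "samples w S inp c1 s (return_pmf (written s')) (\<lambda>s1. s1 = s')"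
    by (rule samples_run, rule runI[OF s'(1,2)]) simp
  from samples_Seq[OF this, of c2 "\<lambda>_. M" Q] show ?thesis
    using assms(2) s'(3) by (simp add: bind_return_pmf)
qed

text \<open>A fresh random value lives in a register and is not yet part of the written list, so
  \<open>samples_Seq\<close> would lose its distribution. The draw is therefore treated together
  with the command that emits it.\<close>

lemma samples_Rand:
  assumes e: "eval w S inp (r, m) e = Some v" "0 < v"
    and c: "\<And>z. z < v \<Longrightarrow> samples w S inp c (r(x := z), m) (M z) Q"
  shows "samples w S inp (Rand x e;; c) (r, m) (bind_pmf (pmf_of_set {0..<v}) M) Q"
proof -
  have fin: "finite {0..<v}" "{0..<v} \<noteq> {}" using e(2) by auto
  have "\<exists>D. \<forall>z. z < v \<longrightarrow> exec w S inp c (r(x := z), m) (D z) \<and>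
      map_pmf (\<lambda>x. written (fst x)) (D z) = M z \<and> (\<forall>(s', t)\<in>set_pmf (D z). Q s')"
    using c unfolding samples_def by (intro choice) blast
  then obtain D where D: "\<And>z. z < v \<Longrightarrow> exec w S inp c (r(x := z), m) (D z)"
    "\<And>z. z < v \<Longrightarrow> map_pmf (\<lambda>x. written (fst x)) (D z) = M z"
    "\<And>z. z < v \<Longrightarrow> \<forall>(s', t)\<in>set_pmf (D z). Q s'"
    by blast
  define D1 where "D1 = map_pmf (\<lambda>z. ((r(x := z), m), cost e + 1)) (pmf_of_set {0..<v})"
  \<comment> \<open>The continuation has to be a function of the state; it recovers the drawn value
    by reading register \<open>x\<close>.\<close>
  define D' where "D' = bind_pmf D1 (\<lambda>(s1, t1). delay t1 (D (fst s1 x)))"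
  have "exec w S inp (Rand x e;; c) (r, m) D'"
    unfolding D'_def
  proof (rule exec_Seq)
    show "exec w S inp (Rand x e) (r, m) D1" unfolding D1_def using e by (rule exec_Rand)
  next
    fix s1 t1 assume "(s1, t1) \<in> set_pmf D1"
    then show "exec w S inp c s1 (D (fst s1 x))" using D(1) fin by (auto simp: D1_def)
  qed
  moreover have "map_pmf (\<lambda>x. written (fst x)) D' = bind_pmf (pmf_of_set {0..<v}) M"
    unfolding D'_def D1_def map_bind_pmf bind_map_pmf using fin D(2)
    by (intro bind_pmf_cong refl) (auto simp: pmf.map_comp o_def case_prod_beta)
  moreover have "\<forall>(s', t)\<in>set_pmf D'. Q s'"
    using D(3) fin by (fastforce simp: D'_def D1_def)
  ultimately show ?thesis unfolding samples_def by blast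
qed

lemma samples_While_exit:
  "eval w S inp s b = Some 0 \<Longrightarrow> Q s \<Longrightarrow> samples w S inp (While b c) s (return_pmf (written s)) Q"
  unfolding samples_def by (intro exI[of _ "return_pmf (s, cost b + 1)"] conjI exec_While_False) auto

lemma samples_While_step:
  assumes "eval w S inp s b = Some v" "v \<noteq> 0" "samples w S inp (c;; While b c) s M Q"
  shows "samples w S inp (While b c) s M Q"
proof -
  obtain D where D: "exec w S inp (c;; While b c) s D" "map_pmf (\<lambda>x. written (fst x)) D = M"
    "\<forall>(s', t)\<in>set_pmf D. Q s'"
    using assms(3) unfolding samples_def by blast
  then show ?thesis
    unfolding samples_def
    by (intro exI[of _ "delay (cost b + 1) D"] conjI exec_While_True[OF assms(1,2)])
      (auto simp: pmf.map_comp o_def case_prod_beta)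
qed

text \<open>Each round appends an independent sample of the same \<open>M\<close>, so the loop
  realises \<open>replicate_pmf\<close> with the results concatenated. The starting index
  \<open>j\<close> is general for the sake of the induction.\<close>

lemma samples_for_loop:
  assumes "I j s" "j \<le> K"
    and guard: "\<And>j s. I j s \<Longrightarrow> j < K \<Longrightarrow> \<exists>v. eval w S inp s b = Some v \<and> v \<noteq> 0"
    and body: "\<And>j s. I j s \<Longrightarrow> j < K \<Longrightarrow>
      samples w S inp c s (map_pmf (\<lambda>ys. written s @ ys) M) (I (Suc j))"
    and exit: "\<And>s. I K s \<Longrightarrow> eval w S inp s b = Some 0"
  shows "samples w S inp (While b c) s
    (map_pmf (\<lambda>yss. written s @ concat yss) (replicate_pmf (K - j) M)) (I K)"
  using assms(1,2)
proof (induction "K - j" arbitrary: j s)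
  case 0
  then show ?case using samples_While_exit[OF exit] by simp
next
  case (Suc n)
  then have j: "j < K" "n = K - Suc j" by auto
  obtain v where v: "eval w S inp s b = Some v" "v \<noteq> 0" using guard Suc.prems j by blast
  have "samples w S inp (c;; While b c) s
      (bind_pmf (map_pmf (\<lambda>ys. written s @ ys) M)
        (\<lambda>ys. map_pmf (\<lambda>yss. ys @ concat yss) (replicate_pmf n M))) (I K)"
    by (rule samples_Seq[OF body[OF Suc.prems(1) j(1)]]) (use Suc.hyps(1)[OF j(2)] j in simp)
  also have "bind_pmf (map_pmf (\<lambda>ys. written s @ ys) M)
        (\<lambda>ys. map_pmf (\<lambda>yss. ys @ concat yss) (replicate_pmf n M)) =
      map_pmf (\<lambda>yss. written s @ concat yss) (replicate_pmf (K - j) M)"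
    by (simp add: map_pmf_def bind_assoc_pmf bind_return_pmf flip: Suc.hyps(2))
  finally show ?case by (rule samples_While_step[OF v])
qed

section \<open>Parameters and word size\<close>

text \<open>Justifies the definite descriptions in \<open>u_par\<close> and \<open>d_par\<close>. It
  is stated over the reals because the second bracket encloses \<open>k / ln k\<close>.\<close>

lemma ex1_power_2_bracket:
  fixes x :: real
  assumes "1 < x"
  shows "\<exists>!d. 0 < d \<and> 2 ^ (d - 1) < x \<and> x \<le> 2 ^ d"
proof (rule ex_ex1I)
  obtain d0 :: nat where "x < 2 ^ d0" using real_arch_pow[of 2 x] by auto
  then have ex: "\<exists>d. x \<le> 2 ^ d" by (auto intro: less_imp_le)
  define d where "d = (LEAST d. x \<le> 2 ^ d)"
  have d: "x \<le> 2 ^ d" unfolding d_def using ex by (rule LeastI_ex)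
  have "0 < d" using d assms by (cases d) auto
  moreover have "2 ^ (d - 1) < x"
    using not_less_Least[of "d - 1" "\<lambda>d. x \<le> 2 ^ d"] \<open>0 < d\<close> unfolding d_def[symmetric] by auto
  ultimately show "\<exists>d. 0 < d \<and> 2 ^ (d - 1) < x \<and> x \<le> 2 ^ d" using d by blast
next
  fix d e :: nat
  assume d: "0 < d \<and> 2 ^ (d - 1) < x \<and> x \<le> 2 ^ d" and e: "0 < e \<and> 2 ^ (e - 1) < x \<and> x \<le> 2 ^ e"
  have "2 ^ (d - 1) < (2::real) ^ e" "2 ^ (e - 1) < (2::real) ^ d"
    using d e by linarith+
  then have "d - 1 < e" "e - 1 < d" by simp_all
  then show "d = e" by linarith
qed

lemma u_par_props:
  assumes "1 < N"
  shows "0 < u_par N" "2 ^ (u_par N - 1) < N" "N \<le> 2 ^ u_par N"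
proof -
  have "\<exists>!u. 0 < u \<and> 2 ^ (u - 1) < real N \<and> real N \<le> 2 ^ u"
    using assms by (intro ex1_power_2_bracket) simp
  also have "(\<lambda>u. 0 < u \<and> 2 ^ (u - 1) < real N \<and> real N \<le> 2 ^ u) =
      (\<lambda>u. 0 < u \<and> 2 ^ (u - 1) < N \<and> N \<le> 2 ^ u)"
    by (simp add: fun_eq_iff)
  finally have "0 < u_par N \<and> 2 ^ (u_par N - 1) < N \<and> N \<le> 2 ^ u_par N"
    unfolding u_par_def by (rule theI')
  then show "0 < u_par N" "2 ^ (u_par N - 1) < N" "N \<le> 2 ^ u_par N" by auto
qed

lemma d_par_props:
  assumes "2 \<le> k"
  shows "0 < d_par k" "2 ^ (d_par k - 1) < real k / ln (real k)" "real k / ln (real k) \<le> 2 ^ d_par k"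
proof -
  have "0 < ln (real k)" "ln (real k) < real k" using assms by (auto intro: ln_less_self)
  then have "1 < real k / ln (real k)" by simp
  from ex1_power_2_bracket[OF this]
  have "0 < d_par k \<and> 2 ^ (d_par k - 1) < real k / ln (real k) \<and> real k / ln (real k) \<le> 2 ^ d_par k"
    unfolding d_par_def by (rule theI')
  then show "0 < d_par k" "2 ^ (d_par k - 1) < real k / ln (real k)"
    "real k / ln (real k) \<le> 2 ^ d_par k" by auto
qed

lemma ln_ge_half:
  assumes "2 \<le> k"
  shows "1 / 2 \<le> ln (real k)"
proof -
  have "ln (1 / 2 :: real) \<le> 1 / 2 - 1" by (rule ln_le_minus_one) simp
  then have "1 / 2 \<le> ln (2 :: real)" by (simp add: ln_div)
  also have "\<dots> \<le> ln (real k)" using assms by simp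
  finally show ?thesis .
qed

lemma two_power_d_par:
  assumes "2 \<le> k"
  shows "2 ^ d_par k \<le> 2 * (real k / ln (real k))"
proof -
  have "(2::real) ^ d_par k = 2 * 2 ^ (d_par k - 1)"
    using d_par_props(1)[OF assms] by (cases "d_par k") auto
  then show ?thesis using d_par_props(2)[OF assms] by linarith
qed

lemma nat_ceiling_ln_le:
  assumes "2 \<le> k"
  shows "nat \<lceil>real c * ln (real k)\<rceil> \<le> c * k"
proof -
  have "ln (real k) \<le> real k" using assms ln_less_self[of "real k"] by linarith
  then have "real c * ln (real k) \<le> real c * real k" by (intro mult_left_mono) auto
  then show ?thesis by (simp add: ceiling_le_iff nat_le_iff)
qed

text \<open>The loop guard for \<open>d\<close> is exact: as \<open>k\<close> is an integer,
  rounding \<open>2 ^ D * ln k\<close> down does not change whether it is below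
  \<open>k\<close>.\<close>

lemma two_power_d_less_iff:
  assumes "2 \<le> k" "1 \<le> D" "D \<le> d_par k"
  shows "nat \<lfloor>real (2 ^ D) * ln (real k)\<rfloor> < k \<longleftrightarrow> D < d_par k"
proof -
  have ln: "0 < ln (real k)" using assms by simp
  have "nat \<lfloor>real (2 ^ D) * ln (real k)\<rfloor> < k \<longleftrightarrow> real (2 ^ D) * ln (real k) < real k"
    using assms ln by (subst nat_less_iff) (auto simp: floor_less_iff)
  also have "\<dots> \<longleftrightarrow> 2 ^ D < real k / ln (real k)" using ln by (simp add: pos_less_divide_eq)
  also have "\<dots> \<longleftrightarrow> D < d_par k"
  proof
    assume "2 ^ D < real k / ln (real k)"
    then have "2 ^ D < (2::real) ^ d_par k" using d_par_props(3)[OF assms(1)] by linarith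
    then show "D < d_par k" by simp
  next
    assume "D < d_par k"
    then have "(2::real) ^ D \<le> 2 ^ (d_par k - 1)" by (intro power_increasing) auto
    then show "2 ^ D < real k / ln (real k)" using d_par_props(2)[OF assms(1)] by linarith
  qed
  finally show ?thesis .
qed

lemma two_power_u_less_iff:
  assumes "1 < N" "U \<le> u_par N"
  shows "2 ^ U < N \<longleftrightarrow> U < u_par N"
proof
  assume "2 ^ U < N"
  then have "2 ^ U < (2::nat) ^ u_par N" using u_par_props(3)[OF assms(1)] by linarith
  then show "U < u_par N" by simp
next
  assume "U < u_par N"
  then have "(2::nat) ^ U \<le> 2 ^ (u_par N - 1)" by (intro power_increasing) auto
  then show "2 ^ U < N" using u_par_props(2)[OF assms(1)] by linarith
qed

section \<open>The prime and the polynomial that the searches find\<close>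

definition least_prime :: "nat \<Rightarrow> nat" where
  "least_prime N = (LEAST p. prime p \<and> N \<le> p)"

lemma least_prime:
  assumes "2 \<le> N"
  shows "prime (least_prime N)" "N \<le> least_prime N" "least_prime N \<le> N ^ 6"
proof -
  obtain p where p: "prime p" "N \<le> p" "p \<le> N ^ 6" using ex_prime_le_power[OF assms] by blast
  then have "prime (least_prime N) \<and> N \<le> least_prime N"
    unfolding least_prime_def by (intro LeastI) auto
  then show "prime (least_prime N)" "N \<le> least_prime N" by auto
  have "least_prime N \<le> p" unfolding least_prime_def using p by (intro Least_le) auto
  then show "least_prime N \<le> N ^ 6" using p by simp
qed

definition irreducible_word :: "nat \<Rightarrow> nat" where
  "irreducible_word n = (LEAST v. 2 ^ n \<le> v \<and> irreducible (word_poly v))"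

lemma irreducible_word:
  assumes "0 < n"
  shows "irreducible (word_poly (irreducible_word n))" "2 ^ n \<le> irreducible_word n"
    "irreducible_word n < 2 ^ Suc n" "degree (word_poly (irreducible_word n)) = n"
proof -
  obtain q :: "bit poly" where q: "irreducible q" "degree q = n"
    using ex_irreducible_bit_poly[OF assms] by blast
  then have "q \<noteq> 0" by auto
  let ?P = "\<lambda>v. 2 ^ n \<le> v \<and> irreducible (word_poly v)"
  have P: "?P (poly_word q)" "poly_word q < 2 ^ Suc n"
    using q poly_word_ge[OF \<open>q \<noteq> 0\<close>] poly_word_less[OF \<open>q \<noteq> 0\<close>] by simp_all
  have "?P (irreducible_word n)" "irreducible_word n \<le> poly_word q"
    unfolding irreducible_word_def by (rule LeastI, rule P, rule Least_le, rule P)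
  then show "irreducible (word_poly (irreducible_word n))" "2 ^ n \<le> irreducible_word n"
    "irreducible_word n < 2 ^ Suc n"
    using P(2) by linarith+
  then show "degree (word_poly (irreducible_word n)) = n" by (intro degree_word_poly)
qed

lemma irreducible_word_le:
  "2 ^ n \<le> v \<Longrightarrow> irreducible (word_poly v) \<Longrightarrow> irreducible_word n \<le> v"
  unfolding irreducible_word_def by (rule Least_le) simp

text \<open>Xor is addition without carries. The bound is used in the overflow checks.\<close>

lemma xor_le_add: "xor a b \<le> a + (b::nat)"
proof (induction a arbitrary: b rule: less_induct)
  case (less a)
  show ?case
  proof (cases "a = 0")
    case False
    then have "xor (a div 2) (b div 2) \<le> a div 2 + b div 2" by (intro less) auto
    moreover have "xor a b = of_bool (odd a \<noteq> odd b) + 2 * xor (a div 2) (b div 2)"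
      by (rule xor_rec)
    moreover have "of_bool (odd a \<noteq> odd b) + 2 * (a div 2) + 2 * (b div 2) \<le> a + b"
      by (cases "odd a"; cases "odd b") auto
    ultimately show ?thesis by linarith
  qed simp
qed

section \<open>Word size and overflow checks\<close>

text \<open>The condition on \<open>w\<close> is \<open>400 * log 2 N \<le> w\<close> in exponential
  form. All parameters are at most \<open>B = N ^ 10\<close>, and no expression exceeds
  \<open>B ^ 32 = N ^ 320\<close>.\<close>

locale word_ram =
  fixes N k w :: nat
  assumes N: "1 < N" and k: "2 \<le> k" "k \<le> N" and w: "N ^ 400 \<le> 2 ^ w"
begin

definition "u = u_par N"
definition "d = d_par k"
definition "n = max (u_par N) (d_par k)"
definition "\<kappa> = kappa k"
definition "d2 = d2_par k"
definition "d3 = d3_par k"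
definition "R = nat \<lceil>13 * ln (real k)\<rceil>"
text \<open>The exponent comes from \<open>d3\<close>, the square of
  \<open>R \<le> 13 * k \<le> 16 * N \<le> N ^ 5\<close>. It also covers the prime, which is at most
  \<open>N ^ 6\<close>.\<close>

definition "B = N ^ 10"

lemma pow_le_B: "i \<le> 10 \<Longrightarrow> N ^ i \<le> B"
  unfolding B_def using N by (intro power_increasing) auto

lemma small_le_B: "a \<le> 16 * N \<Longrightarrow> a \<le> B"
proof -
  assume "a \<le> 16 * N"
  also have "16 * N \<le> N ^ 4 * N" using N power_mono[of 2 N 4] by simp
  also have "N ^ 4 * N \<le> B" using pow_le_B[of 5] by (simp add: eval_nat_numeral mult_ac)
  finally show ?thesis by simp
qed

lemma B_ge: "1024 \<le> B"
proof -
  have "(2::nat) ^ 10 \<le> N ^ 10" using N by (intro power_mono) auto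
  then show ?thesis by (simp add: B_def)
qed

lemma u_bounds: "0 < u" "2 ^ u \<le> 2 * N"
  using u_par_props[OF N] unfolding u_def by (cases "u_par N"; simp)+

lemma d_bounds: "0 < d" "2 ^ d \<le> 4 * N"
proof -
  show "0 < d" using d_par_props[OF k(1)] by (simp add: d_def)
  have "0 < ln (real k)" using k by simp
  then have "real k / ln (real k) \<le> real k / (1 / 2)"
    using ln_ge_half[OF k(1)] by (intro divide_left_mono) auto
  then have "(2::real) ^ d \<le> 4 * real k" using two_power_d_par[OF k(1)] unfolding d_def by simp
  then have "real (2 ^ d) \<le> real (4 * k)" by simp
  then show "2 ^ d \<le> 4 * N" using k(2) unfolding of_nat_le_iff by linarith
qed

lemma n_bounds: "0 < n" "2 ^ n \<le> 4 * N" "u \<le> n" "d \<le> n"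
  using u_bounds d_bounds by (auto simp: n_def u_def d_def max_def)

lemma k_mult_le_B: "c \<le> 16 \<Longrightarrow> nat \<lceil>real c * ln (real k)\<rceil> \<le> B"
  by (rule small_le_B, rule order.trans[OF nat_ceiling_ln_le[OF k(1)]]) (use k in \<open>auto intro: mult_le_mono\<close>)

lemma le_B [simp]:
  "N \<le> B" "k \<le> B" "2 ^ u \<le> B" "2 ^ d \<le> B" "2 ^ n \<le> B" "u \<le> B" "d \<le> B" "n \<le> B"
  "\<kappa> \<le> B" "d2 \<le> B" "R \<le> B" "d3 \<le> B" "least_prime N \<le> B"
proof -
  show N': "N \<le> B" "k \<le> B" "2 ^ u \<le> B" "2 ^ d \<le> B" "2 ^ n \<le> B"
    using u_bounds d_bounds n_bounds k by (auto intro!: small_le_B)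
  then show "u \<le> B" "d \<le> B" "n \<le> B"
    using less_exp[of u] less_exp[of d] less_exp[of n] by linarith+
  show "\<kappa> \<le> B" "d2 \<le> B" "R \<le> B"
    using k_mult_le_B[of 12] k_mult_le_B[of 8] k_mult_le_B[of 13]
    by (simp_all add: \<kappa>_def kappa_def d2_def d2_par_def R_def)
  have "R \<le> 13 * k"
    unfolding R_def using nat_ceiling_ln_le[OF k(1), of 13] by simp
  also have "\<dots> \<le> 16 * N" using k by simp
  also have "\<dots> \<le> N ^ 4 * N" using N power_mono[of 2 N 4] by simp
  finally have "R \<le> N ^ 5" by (simp add: eval_nat_numeral mult_ac)
  then have "R\<^sup>2 \<le> (N ^ 5)\<^sup>2" by (rule power_mono) simp
  then show "d3 \<le> B" by (simp add: d3_def d3_par_def R_def B_def flip: power_mult)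
  show "least_prime N \<le> B" using least_prime(3)[of N] N pow_le_B[of 6] by simp
qed

text \<open>Overflow checks are discharged by the simplifier: a value computed by an expression of depth
  \<open>i\<close> from values at most \<open>B\<close> is at most \<open>B ^ 2 ^ i\<close>.\<close>

definition fits :: "nat \<Rightarrow> nat \<Rightarrow> bool" where
  "fits i a \<longleftrightarrow> a \<le> B ^ (2 ^ i)"

text \<open>Five levels of operators suffice: \<open>B ^ (2 ^ 5) = N ^ 320\<close> is below
  \<open>2 ^ w\<close>. The index is spelled with \<open>Suc\<close> because the rules for sums,
  products and xor strip one \<open>Suc\<close> per operator.\<close>

lemma word_eq_Some [simp]:
  assumes "fits (Suc (Suc (Suc (Suc (Suc 0))))) a"
  shows "word w a = Some a"
proof -
  have "a \<le> B ^ 32" using assms by (simp add: fits_def)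
  also have "\<dots> = N ^ 320" by (simp add: B_def flip: power_mult)
  also have "\<dots> < N ^ 400" using N by (intro power_strict_increasing) auto
  finally show ?thesis using w by (simp add: word_def)
qed

lemma fits_base [simp]: "a \<le> B \<Longrightarrow> fits i a"
  unfolding fits_def using B_ge by (metis one_le_numeral order.trans power_increasing
      power_one_right one_le_power)

lemma fits_le: "a \<le> b \<Longrightarrow> fits i b \<Longrightarrow> fits i a"
  unfolding fits_def by (rule order.trans)

lemma fits_Suc: "fits i a \<Longrightarrow> fits (Suc i) a"
proof -
  have "B ^ (2 ^ i) \<le> B ^ (2 ^ Suc i)" using B_ge by (intro power_increasing) auto
  then show "fits i a \<Longrightarrow> fits (Suc i) a" by (simp add: fits_def)
qed

lemma fits_mult [simp]: "fits i a \<Longrightarrow> fits i b \<Longrightarrow> fits (Suc i) (a * b)"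
  by (simp add: fits_def mult_2 power_add mult_mono)

lemma fits_add [simp]:
  assumes "fits i a" "fits i b"
  shows "fits (Suc i) (a + b)"
proof -
  define X where "X = B ^ (2 ^ i)"
  have "B \<le> X" unfolding X_def using B_ge power_increasing[of 1 "2 ^ i" B] by simp
  then have "2 * X \<le> X * X" using B_ge by (intro mult_right_mono) auto
  moreover have "a + b \<le> 2 * X" using assms by (simp add: fits_def X_def)
  ultimately have "a + b \<le> X * X" by linarith
  then show ?thesis by (simp add: fits_def X_def mult_2 power_add)
qed

lemma fits_Suc_value [simp]: "fits i a \<Longrightarrow> fits (Suc i) (Suc a)"
  using fits_add[of i a 1] B_ge by simp

lemma fits_xor [simp]: "fits i a \<Longrightarrow> fits i b \<Longrightarrow> fits (Suc i) (xor a b)"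
  by (rule fits_le[OF xor_le_add fits_add])

lemma fits_diff [simp]: "fits i a \<Longrightarrow> fits i (a - b)"
  by (erule fits_le[rotated]) simp

lemma fits_mod [simp]: "fits i a \<Longrightarrow> fits i (a mod b)"
  by (erule fits_le[rotated]) simp

lemma fits_div [simp]: "fits i a \<Longrightarrow> fits i (a div b)"
  by (erule fits_le[rotated]) simp

lemma fits_of_bool [simp]: "fits i (of_bool b)"
  using B_ge by (simp add: fits_def)

lemma numeral_le_B [simp]: "numeral a \<le> (1024::nat) \<Longrightarrow> numeral a \<le> B" "0 \<le> B" "1 \<le> B" "Suc 0 \<le> B"
  using B_ge order.trans[OF _ B_ge] by auto

end

section \<open>The parameter program\<close>

context word_ram
begin

definition pars :: "(var \<Rightarrow> nat) \<Rightarrow> bool" where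
  "pars r \<longleftrightarrow> r vN = N \<and> r vK = k \<and> r vU = u \<and> r vD = d \<and> r vn = n \<and> r vKappa = \<kappa> \<and>
     r vD2 = d2 \<and> r vR = R \<and> r vD3 = d3"

lemma pars_lookup:
  assumes "pars r"
  shows "r vN = N" "r vK = k" "r vU = u" "r vD = d" "r vn = n" "r vKappa = \<kappa>"
    "r vD2 = d2" "r vR = R" "r vD3 = d3"
  using assms by (auto simp: pars_def)

text \<open>A frame rule: assignments to the working registers preserve the computed
  parameters.\<close>

lemma pars_upd [simp]:
  "x \<notin> {vN, vK, vU, vD, vn, vKappa, vD2, vR, vD3} \<Longrightarrow> pars (r(x := v)) = pars r"
  by (cases x) (simp_all add: pars_def)

lemma run_u_loop:
  assumes "r vU = 1" "r vN = N"
  shows "run w S inp (While (Num 1 [<<] \<acute>vU [<] \<acute>vN) (vU ::= \<acute>vU [+] Num 1)) (r, m)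
    (u * 10 + 10) (\<lambda>s. s = (r(vU := u), m))"
\<comment> \<open>The register starts at 1, so it holds \<open>Suc j\<close> after \<open>j\<close>
  rounds and the loop makes \<open>u - 1\<close> rounds.\<close>
proof (rule run_mono, rule run_for_loop[where I = "\<lambda>j s. s = (r(vU := Suc j), m)" and K = "u - 1"])
  have le: "Suc j \<le> B" "2 ^ Suc j \<le> B" if "Suc j \<le> u" for j
    using that le_B(3,6) power_increasing[of "Suc j" u "2::nat"] by linarith+
  have guard: "eval w S inp (r(vU := Suc j), m) (Num 1 [<<] \<acute>vU [<] \<acute>vN) = Some (of_bool (Suc j < u))"
    if "Suc j \<le> u" for j
    using two_power_u_less_iff[OF N, of "Suc j"] assms(2) that le[OF that] by (simp add: u_def)
  show "(r, m) = (r(vU := Suc 0), m)" using assms by auto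
  show "\<exists>v. eval w S inp s (Num 1 [<<] \<acute>vU [<] \<acute>vN) = Some v \<and> v \<noteq> 0"
    if "s = (r(vU := Suc j), m)" "j < u - 1" for j s
    unfolding that(1) using that(2) by (subst guard) auto
  show "run w S inp (vU ::= \<acute>vU [+] Num 1) s (cost (\<acute>vU [+] Num 1 :: var exp) + 1)
      (\<lambda>s'. s' = (r(vU := Suc (Suc j)), m))" if "s = (r(vU := Suc j), m)" "j < u - 1" for j s
    unfolding that(1) using that(2) le[of j] by (intro run_Assign[where v = "Suc (Suc j)"]) auto
  show "eval w S inp s (Num 1 [<<] \<acute>vU [<] \<acute>vN) = Some 0" if "s = (r(vU := Suc (u - 1)), m)" for s
    unfolding that using u_bounds(1) by (subst guard) auto
qed (use u_bounds in auto)

lemma run_d_loop: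
  assumes "r vD = 1" "r vK = k"
  shows "run w S inp (While (Op FloorLn (Num 1 [<<] \<acute>vD) \<acute>vK [<] \<acute>vK) (vD ::= \<acute>vD [+] Num 1)) (r, m)
    (d * 15 + 15) (\<lambda>s. s = (r(vD := d), m))"
proof (rule run_mono, rule run_for_loop[where I = "\<lambda>j s. s = (r(vD := Suc j), m)" and K = "d - 1"])
  let ?b = "Op FloorLn (Num 1 [<<] \<acute>vD) \<acute>vK [<] \<acute>vK :: var exp"
  have le: "Suc j \<le> B" "2 ^ Suc j \<le> B" if "Suc j \<le> d" for j
    using that le_B(4,7) power_increasing[of "Suc j" d "2::nat"] by linarith+
  have guard: "eval w S inp (r(vD := Suc j), m) ?b = Some (of_bool (Suc j < d))" if "Suc j \<le> d" for j
  proof -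
    \<comment> \<open>The guard multiplies a power of two by \<open>ln k\<close>; up to exponent
      \<open>d\<close> the product is at most \<open>2 * k\<close>, since
      \<open>2 ^ d \<le> 2 * k / ln k\<close>.\<close>
    have "nat \<lfloor>2 ^ Suc j * ln (real k)\<rfloor> \<le> B"
    proof (rule small_le_B)
      have "(2::real) ^ Suc j \<le> 2 * (real k / ln (real k))"
        by (rule order.trans[OF power_increasing[of "Suc j" d] two_power_d_par[OF k(1), folded d_def]])
          (use that in auto)
      moreover have "0 < ln (real k)" using k by simp
      ultimately have "2 ^ Suc j * ln (real k) \<le> 2 * real k" by (simp add: pos_le_divide_eq)
      then have "\<lfloor>2 ^ Suc j * ln (real k)\<rfloor> \<le> 2 * int k" by linarith
      then show "nat \<lfloor>2 ^ Suc j * ln (real k)\<rfloor> \<le> 16 * N" using k by linarith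
    qed
    moreover have "k \<noteq> 0" using k by simp
    ultimately show ?thesis
      using two_power_d_less_iff[OF k(1), of "Suc j"] assms(2) that le[OF that]
      by (simp add: d_def)
  qed
  show "(r, m) = (r(vD := Suc 0), m)" using assms by auto
  show "\<exists>v. eval w S inp s ?b = Some v \<and> v \<noteq> 0"
    if "s = (r(vD := Suc j), m)" "j < d - 1" for j s
    unfolding that(1) using that(2) by (subst guard) auto
  show "run w S inp (vD ::= \<acute>vD [+] Num 1) s (cost (\<acute>vD [+] Num 1 :: var exp) + 1)
      (\<lambda>s'. s' = (r(vD := Suc (Suc j)), m))" if "s = (r(vD := Suc j), m)" "j < d - 1" for j s
    unfolding that(1) using that(2) le[of j] by (intro run_Assign[where v = "Suc (Suc j)"]) auto
  show "eval w S inp s ?b = Some 0" if "s = (r(vD := Suc (d - 1)), m)" for s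
    unfolding that using d_bounds(1) by (subst guard) auto
qed (use d_bounds in auto)

lemma run_max:
  assumes "r vU = u" "r vD = d"
  shows "run w S inp (If (\<acute>vU [<] \<acute>vD) (vn ::= \<acute>vD) (vn ::= \<acute>vU)) (r, m)
    6 (\<lambda>s. s = (r(vn := n), m))"
  apply (rule run_le)
   apply (rule run_If)
     apply (simp add: assms)
    apply (rule run_Assign, simp add: assms)
    apply (simp add: n_def u_def d_def split: if_splits)
   apply (rule run_Assign, simp add: assms)
   apply (simp add: n_def u_def d_def split: if_splits)
  apply simp
  done

lemma ceil_simps [simp]:
  "nat \<lceil>12 * ln (real k)\<rceil> = \<kappa>" "nat \<lceil>8 * ln (real k)\<rceil> = d2" "nat \<lceil>13 * ln (real k)\<rceil> = R" "R * R = d3"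
  by (simp_all add: \<kappa>_def kappa_def d2_def d2_par_def R_def d3_def d3_par_def power2_eq_square)

lemma run_params:
  "run w S (N # k # inp) params_prog (r, m) (u * 10 + d * 15 + 70) (\<lambda>(r', m'). pars r' \<and> m' = m)"
proof -
  have [simp]: "k \<noteq> 0" using k by simp
  show ?thesis
    unfolding params_prog_def
    \<comment> \<open>This leaves the time bound schematic. The following rules build it up, and the
      last line compares the sum with the claimed bound.\<close>
    apply (rule run_le)
    apply (rule run_Seq, rule run_Assign, simp)
    apply (rule run_Seq, rule run_Assign, simp)
    apply (rule run_Seq, rule run_Assign, simp)
    apply (rule run_Seq, rule run_mono, rule run_u_loop, simp, simp, rule order.refl, simp only:)
    apply (rule run_Seq, rule run_Assign, simp)
    apply (rule run_Seq, rule run_mono, rule run_d_loop, simp, simp, rule order.refl, simp only:)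
    apply (rule run_Seq, rule run_mono, rule run_max, simp, simp, rule order.refl, simp only:)
    apply (rule run_Seq, rule run_Assign, simp)
    apply (rule run_Seq, rule run_Assign, simp)
    apply (rule run_Seq, rule run_Assign, simp)
    apply (rule run_Assign, simp)
    by (auto simp: pars_def)
qed

end

section \<open>The prime and the irreducible polynomial\<close>

lemma bit_leading:
  assumes "2 ^ e \<le> a" "a < 2 ^ Suc e"
  shows "bit (a :: nat) e"
proof (rule ccontr)
  assume "\<not> bit a e"
  with assms(2) have "\<forall>i\<ge>e. \<not> bit a i" unfolding less_power_2_iff_bits by (metis le_eq_less_or_eq Suc_leI)
  then show False using assms(1) less_power_2_iff_bits[of a e] by simp
qed

text \<open>No bit above position \<open>e\<close> is set and \<open>x\<close> has bit
  \<open>e\<close> set, so xor flips the leading position of \<open>a\<close>; this bit alone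
  decides the comparison with \<open>a\<close>. Hence the comparison detects whether bit
  \<open>e\<close> of \<open>a\<close> is set, and in that case the xor clears it.\<close>

lemma xor_leading:
  fixes a x :: nat
  assumes a: "a < 2 ^ Suc e" and x: "2 ^ e \<le> x" "x < 2 ^ Suc e"
  shows "2 ^ e \<le> a \<Longrightarrow> xor a x < 2 ^ e" "xor a x < a \<longleftrightarrow> 2 ^ e \<le> a"
proof -
  have bx: "bit x e" "\<forall>i\<ge>Suc e. \<not> bit x i" "\<forall>i\<ge>Suc e. \<not> bit a i"
    using bit_leading[OF x] x(2) a unfolding less_power_2_iff_bits by auto
  show less: "xor a x < 2 ^ e" if "2 ^ e \<le> a"
  proof -
    have "\<not> bit (xor a x) i" if "e \<le> i" for i
      using bx bit_leading[OF \<open>2 ^ e \<le> a\<close> a] that by (cases "i = e") (auto simp: bit_xor_iff)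
    then show ?thesis unfolding less_power_2_iff_bits by blast
  qed
  show "xor a x < a \<longleftrightarrow> 2 ^ e \<le> a"
  proof (cases "2 ^ e \<le> a")
    case False
    then have "\<not> bit a e" using less_power_2_iff_bits[of a e] by auto
    then have "bit (xor a x) e" using bx(1) by (simp add: bit_xor_iff)
    then have "\<not> xor a x < 2 ^ e" unfolding less_power_2_iff_bits by blast
    then show ?thesis using False by linarith
  qed (use less in force)
qed

lemma word_poly_bracket:
  assumes "0 < v"
  shows "2 ^ degree (word_poly v) \<le> v" "v < 2 ^ Suc (degree (word_poly v))"
  using poly_word_ge[of "word_poly v"] poly_word_less[of "word_poly v"] assms by simp_all

text \<open>Trial division by the words from 2 to \<open>2 ^ n - 1\<close> covers the polynomials of
  degrees 1 to \<open>n - 1\<close>. In a factorization into non-units the degrees are positive and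
  add up to \<open>n\<close>, so a factor would have been found.\<close>

lemma irreducible_word_polyI:
  assumes "0 < n" "2 ^ n \<le> v" "v < 2 ^ Suc n"
    and nd: "\<And>q. 2 \<le> q \<Longrightarrow> q < 2 ^ n \<Longrightarrow> \<not> word_poly q dvd word_poly v"
  shows "irreducible (word_poly v)"
proof (rule irreducibleI)
  have deg: "degree (word_poly v) = n" using assms by (intro degree_word_poly)
  have "0 < v" using assms(2) by (rule less_le_trans[rotated]) simp
  then show nz: "word_poly v \<noteq> 0" by simp
  show "\<not> is_unit (word_poly v)"
    using assms(1) deg by (auto simp: bit_poly_is_unit_iff)
  fix a b assume ab: "word_poly v = a * b"
  then have "a \<noteq> 0" "b \<noteq> 0" using nz by auto
  then have sum: "degree a + degree b = n" using ab deg by (simp add: degree_mult_eq)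
  show "is_unit a \<or> is_unit b"
  proof (rule ccontr)
    assume "\<not> (is_unit a \<or> is_unit b)"
    then have pos: "0 < degree a" "0 < degree b"
      using \<open>a \<noteq> 0\<close> \<open>b \<noteq> 0\<close> by (auto simp: is_unit_iff_degree)
    have "(2::nat) \<le> 2 ^ degree a"
      using pos power_increasing[of 1 "degree a" "2::nat"] by simp
    moreover have "(2::nat) ^ Suc (degree a) \<le> 2 ^ n"
      using pos sum by (intro power_increasing) auto
    ultimately have "2 \<le> poly_word a" "poly_word a < 2 ^ n"
      using poly_word_ge[OF \<open>a \<noteq> 0\<close>] poly_word_less[OF \<open>a \<noteq> 0\<close>] by linarith+
    from nd[OF this] show False using ab by simp
  qed
qed

lemma not_irreducible_word_poly:
  assumes "2 \<le> q" "q < 2 ^ degree (word_poly v)" "word_poly q dvd word_poly v"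
  shows "\<not> irreducible (word_poly v)"
proof
  assume irr: "irreducible (word_poly v)"
  obtain g where g: "word_poly v = word_poly q * g" using assms(3) by (elim dvdE)
  have "word_poly q \<noteq> 0" using assms by simp
  have "word_poly v \<noteq> 0" using irr unfolding irreducible_def by blast
  then have "g \<noteq> 0" using g by auto
  have "degree (word_poly q) \<noteq> 0"
  proof
    assume "degree (word_poly q) = 0"
    then show False using word_poly_bracket(2)[of q] assms(1) by simp
  qed
  moreover have "degree (word_poly q) < degree (word_poly v)"
    using assms(2) unfolding word_poly_degree_less using \<open>word_poly q \<noteq> 0\<close> by simp
  then have "degree g \<noteq> 0" using g \<open>word_poly q \<noteq> 0\<close> \<open>g \<noteq> 0\<close> by (simp add: degree_mult_eq)
  moreover have "is_unit (word_poly q) \<or> is_unit g"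
    using irr g unfolding irreducible_def by blast
  ultimately show False
    using \<open>word_poly q \<noteq> 0\<close> \<open>g \<noteq> 0\<close> by (auto simp: is_unit_iff_degree)
qed

context word_ram
begin

text \<open>The invariant keeps the candidate at or below the least prime, since only a composite
  candidate is increased. The time is left existential because termination is all that is
  needed.\<close>

lemma run_prime:
  assumes "r vN = N"
  shows "\<exists>T. run w S inp prime_prog (r, m) T (\<lambda>s. \<exists>q. s = (r(vp := least_prime N, vQ := q), m))"
proof -
  define L where "L = least_prime N"
  have L: "prime L" "N \<le> L" "L \<le> B" using least_prime(1,2)[of N] N le_B by (auto simp: L_def)
  define I where "I s \<longleftrightarrow> (\<exists>p q. s = (r(vp := p, vQ := q), m) \<and> N \<le> p \<and> p \<le> L \<and> 2 \<le> q \<and> q \<le> p \<and>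
    (\<forall>q'. 2 \<le> q' \<longrightarrow> q' < q \<longrightarrow> \<not> q' dvd p))" for s
  \<comment> \<open>A lexicographic variant: the weight \<open>L + 1\<close> of the candidate
    outweighs the reset of the trial divisor to 2.\<close>
  define f where "f s = (L - fst s vp) * (L + 1) + (L - fst s vQ)" for s :: "var state"
  let ?b = "\<acute>vQ [<] \<acute>vp :: var exp"
  let ?c = "If (\<acute>vp [mod] \<acute>vQ [=] Num 0) (vp ::= \<acute>vp [+] Num 1;; vQ ::= Num 2) (vQ ::= \<acute>vQ [+] Num 1) :: var com"
  have loop: "\<exists>T. run w S inp (While ?b ?c) s T (\<lambda>s. \<exists>q. s = (r(vp := least_prime N, vQ := q), m))"
    if "I s" for s
  proof (rule exI, rule run_While[where I = I and f = f, OF that order.refl])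
    fix s assume "I s"
    then obtain p q where s: "s = (r(vp := p, vQ := q), m)" and I: "N \<le> p" "p \<le> L" "2 \<le> q" "q \<le> p"
      "\<And>q'. 2 \<le> q' \<Longrightarrow> q' < q \<Longrightarrow> \<not> q' dvd p" unfolding I_def by blast
    have le: "p \<le> B" "q \<le> B" "q \<noteq> 0" using I L by linarith+
    then have b: "eval w S inp s ?b = Some (of_bool (q < p))" by (simp add: s)
    then show "\<exists>v. eval w S inp s ?b = Some v" by blast
    {
      assume "eval w S inp s ?b = Some 0"
      then have "q = p" using b I by simp
      have "prime p"
        unfolding prime_nat_iff
      proof (intro conjI allI impI)
        show "1 < p" using I by linarith
        fix m assume "m dvd p"
        moreover have "0 < p" using I by linarith
        ultimately have "m \<le> p" "0 < m" by (auto dest: dvd_imp_le dvd_pos_nat)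
        moreover have "\<not> (2 \<le> m \<and> m < p)" using I(5)[of m] \<open>m dvd p\<close> \<open>q = p\<close> by blast
        ultimately show "m = 1 \<or> m = p" by linarith
      qed
      then have "L \<le> p" unfolding L_def least_prime_def using I by (intro Least_le) simp
      then show "\<exists>q. s = (r(vp := least_prime N, vQ := q), m)" using I(2) s by (auto simp: L_def)
    }
    fix v assume "eval w S inp s ?b = Some v" "v \<noteq> 0"
    then have "q < p" using b by (auto split: if_splits)
    show "run w S inp ?c s (max (4 + 2) 4 + 5 + 1) (\<lambda>s'. I s' \<and> f s' < f s)"
    proof (rule run_le, rule run_If)
      show "eval w S inp s (\<acute>vp [mod] \<acute>vQ [=] Num 0) = Some (of_bool (p mod q = 0))"
        using le by (simp add: s)
    next
      assume "of_bool (p mod q = 0) \<noteq> (0::nat)"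
      then have "q dvd p" by auto
      then have "\<not> prime p" using I \<open>q < p\<close> by (auto simp: prime_nat_iff)
      then have "p < L" using L I by (metis le_neq_implies_less)
      have "I (r(vp := Suc p, vQ := 2), m)" unfolding I_def using I \<open>p < L\<close>
        by (intro exI[of _ "Suc p"] exI[of _ 2]) auto
      moreover have "f (r(vp := Suc p, vQ := 2), m) < f s"
      proof -
        have "L - p = Suc (L - Suc p)" using \<open>p < L\<close> by simp
        then show ?thesis by (simp add: f_def s)
      qed
      moreover have "(r(vp := p, vQ := q))(vp := Suc p, vQ := 2) = r(vp := Suc p, vQ := 2)" by auto
      ultimately show "run w S inp (vp ::= \<acute>vp [+] Num 1;; vQ ::= Num 2) s
          (cost (\<acute>vp [+] Num 1 :: var exp) + 1 + (cost (Num 2 :: var exp) + 1)) (\<lambda>s'. I s' \<and> f s' < f s)"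
        unfolding s using le by (intro run_Seq run_Assign[where v = "Suc p"] run_Assign[where v = 2]) simp_all
    next
      assume "of_bool (p mod q = 0) = (0::nat)"
      then have "\<not> q dvd p" by (auto simp: dvd_eq_mod_eq_0)
      then have "I (r(vp := p, vQ := Suc q), m)" unfolding I_def using I \<open>q < p\<close>
        by (intro exI[of _ p] exI[of _ "Suc q"]) (auto simp: less_Suc_eq)
      moreover have "f (r(vp := p, vQ := Suc q), m) < f s"
        using \<open>q < p\<close> I by (simp add: f_def s)
      ultimately show "run w S inp (vQ ::= \<acute>vQ [+] Num 1) s (cost (\<acute>vQ [+] Num 1 :: var exp) + 1) (\<lambda>s'. I s' \<and> f s' < f s)"
        unfolding s using le by (intro run_Assign[where v = "Suc q"]) simp_all
    qed simp
  qed
  have "I (r(vp := N, vQ := 2), m)" unfolding I_def using L N by (intro exI[of _ N] exI[of _ 2]) auto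
  from loop[OF this] obtain T where T: "run w S inp (While ?b ?c) (r(vp := N, vQ := 2), m) T
      (\<lambda>s. \<exists>q. s = (r(vp := least_prime N, vQ := q), m))" by blast
  show ?thesis
    unfolding prime_prog_def
    by (rule exI, rule run_Seq, rule run_Assign, simp add: assms, rule run_Seq, rule run_Assign, simp, rule T)
qed

text \<open>Long division over GF(2). With \<open>e\<close> the degree of the divisor, the round
  with shift \<open>i\<close> clears bit \<open>e + i\<close> of the remainder if it is set, so in
  the end the remainder lies below \<open>2 ^ e\<close>. Each round subtracts a multiple of the
  divisor and so keeps the residue class.\<close>

lemma run_reduce:
  assumes Q: "2 \<le> Q" "Q < 2 ^ n" and P: "P < 2 ^ Suc n"
    and r: "r vT = P" "r vi = Suc n" "r vQ = Q"
  shows "run w S inp (While (Num 0 [<] \<acute>vi)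
          (vi ::= \<acute>vi [-] Num 1;;
           When ((\<acute>vT [xor] \<acute>vQ [<<] \<acute>vi) [<] \<acute>vT)
             (vT ::= \<acute>vT [xor] \<acute>vQ [<<] \<acute>vi))) (r, m) (Suc n * 25 + 5)
     (\<lambda>s. \<exists>t. s = (r(vT := t, vi := 0), m) \<and> word_poly t = word_poly P mod word_poly Q)"
proof -
  define e where "e = degree (word_poly Q)"
  have e: "2 ^ e \<le> Q" "Q < 2 ^ Suc e" using word_poly_bracket[of Q] Q by (simp_all add: e_def)
  have "e < n" using Q unfolding word_poly_degree_less by (auto simp: e_def)
  define I where "I j s \<longleftrightarrow> (\<exists>t. s = (r(vT := t, vi := Suc n - j), m) \<and> t < 2 ^ (e + (Suc n - j)) \<and>
    word_poly t mod word_poly Q = word_poly P mod word_poly Q)" for j s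
  show ?thesis
  proof (rule run_mono, rule run_for_loop[where I = I and K = "Suc n"])
    show "I 0 (r, m)"
      unfolding I_def
    proof (intro exI[of _ P] conjI)
      have "(2::nat) ^ Suc n \<le> 2 ^ (e + (Suc n - 0))" by (intro power_increasing) auto
      then show "P < 2 ^ (e + (Suc n - 0))" using P by linarith
    qed (use r in auto)
  next
    fix j s assume "I j s" "j < Suc n"
    then show "\<exists>v. eval w S inp s (Num 0 [<] \<acute>vi) = Some v \<and> v \<noteq> 0"
      by (auto simp: I_def)
  next
    fix s assume "I (Suc n) s"
    then show "eval w S inp s (Num 0 [<] \<acute>vi) = Some 0"
      by (auto simp: I_def)
  next
    fix j s assume "I j s" and j: "j < Suc n"
    define i where "i = n - j"
    have i: "Suc n - j = Suc i" "Suc n - Suc j = i" "i \<le> n" using j by (auto simp: i_def)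
    obtain t where s: "s = (r(vT := t, vi := Suc i), m)" and t: "t < 2 ^ (e + Suc i)"
      "word_poly t mod word_poly Q = word_poly P mod word_poly Q"
      using \<open>I j s\<close> unfolding I_def i by blast
    define X where "X = Q * 2 ^ i"
    have "2 ^ e * 2 ^ i \<le> X" "X < 2 ^ Suc e * 2 ^ i" using e by (simp_all add: X_def)
    then have X: "2 ^ (e + i) \<le> X" "X < 2 ^ Suc (e + i)" by (simp_all add: power_add)
    have t': "t < 2 ^ Suc (e + i)" using t by simp
    note lead = xor_leading[OF t' X]
    have le: "Q \<le> B" "2 ^ i \<le> B" "Suc i \<le> B" "i \<le> B"
      using Q i le_B(5) power_increasing[of i n "2::nat"] less_exp[of n] \<open>e < n\<close> by linarith+
    \<comment> \<open>The invariant bounds the remainder by a power with exponent up to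
      \<open>2 * n + 1\<close>, which may exceed \<open>B\<close>; the overflow rules need it as a
      product.\<close>
    have "t < 2 ^ n * 2 ^ n * 2"
    proof -
      have "(2::nat) ^ (e + Suc i) \<le> 2 ^ (n + n + 1)" using i \<open>e < n\<close> by (intro power_increasing) auto
      then show ?thesis using t(1) by (simp add: power_add)
    qed
    then have "fits (Suc (Suc i)) t" for i
      by (rule fits_le[OF less_imp_le]) (auto intro!: fits_mult)
    note [simp] = this le
    have fitsX: "fits (Suc i) X" for i unfolding X_def by simp
    have guard: "eval w S inp (r(vT := t, vi := i), m) ((\<acute>vT [xor] \<acute>vQ [<<] \<acute>vi) [<] \<acute>vT) =
        Some (of_bool (xor t X < t))"
      using r(3) fitsX by (simp add: X_def)
    have mod: "word_poly (xor t X) mod word_poly Q = word_poly t mod word_poly Q"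
      by (simp add: X_def word_poly_xor word_poly_shift mult.commute[of "word_poly Q"])
    show "run w S inp (vi ::= \<acute>vi [-] Num 1;;
           When ((\<acute>vT [xor] \<acute>vQ [<<] \<acute>vi) [<] \<acute>vT)
             (vT ::= \<acute>vT [xor] \<acute>vQ [<<] \<acute>vi)) s
          (cost (\<acute>vi [-] Num 1 :: var exp) + 1 + (cost (\<acute>vT [xor] \<acute>vQ [<<] \<acute>vi :: var exp) + 1 +
            cost ((\<acute>vT [xor] \<acute>vQ [<<] \<acute>vi) [<] \<acute>vT :: var exp) + 1)) (I (Suc j))"
      unfolding s
    proof (rule run_Seq, rule run_Assign[where v = i])
      have upd: "(r(vT := t, vi := Suc i))(vi := i) = r(vT := t, vi := i)" by simp
      show "run w S inp (When ((\<acute>vT [xor] \<acute>vQ [<<] \<acute>vi) [<] \<acute>vT)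
             (vT ::= \<acute>vT [xor] \<acute>vQ [<<] \<acute>vi)) ((r(vT := t, vi := Suc i))(vi := i), m)
          (cost (\<acute>vT [xor] \<acute>vQ [<<] \<acute>vi :: var exp) + 1 +
            cost ((\<acute>vT [xor] \<acute>vQ [<<] \<acute>vi) [<] \<acute>vT :: var exp) + 1) (I (Suc j))"
        unfolding upd
      proof (rule run_When[OF guard])
        assume "of_bool (xor t X < t) \<noteq> (0::nat)"
        then have "2 ^ (e + i) \<le> t" using lead(2) by (auto split: if_splits)
        have "I (Suc j) ((r(vT := t, vi := i))(vT := xor t X), m)"
          unfolding I_def i using lead(1)[OF \<open>2 ^ (e + i) \<le> t\<close>] mod t(2)
          by (intro exI[of _ "xor t X"]) auto
        then show "run w S inp (vT ::= \<acute>vT [xor] \<acute>vQ [<<] \<acute>vi) (r(vT := t, vi := i), m)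
            (cost (\<acute>vT [xor] \<acute>vQ [<<] \<acute>vi :: var exp) + 1) (I (Suc j))"
          using r(3) fitsX by (intro run_Assign[where v = "xor t X"]) (simp_all add: X_def)
      next
        assume "of_bool (xor t X < t) = (0::nat)"
        then have "t < 2 ^ (e + i)" using lead(2) by (auto split: if_splits)
        then show "I (Suc j) (r(vT := t, vi := i), m)" unfolding I_def i using t by blast
      qed
    qed simp
  next
    fix s assume "I (Suc n) s"
    then obtain t where s: "s = (r(vT := t, vi := 0), m)" and t: "t < 2 ^ e"
      "word_poly t mod word_poly Q = word_poly P mod word_poly Q"
      by (auto simp: I_def)
    have "word_poly t mod word_poly Q = word_poly t"
      using t(1) unfolding word_poly_degree_less e_def by (auto simp: mod_poly_less)
    then show "\<exists>t. s = (r(vT := t, vi := 0), m) \<and> word_poly t = word_poly P mod word_poly Q"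
      using s t by auto
  qed simp
qed

lemma run_irreducible:
  assumes "r vn = n"
  shows "\<exists>T. run w S inp irreducible_prog (r, m) T
    (\<lambda>s. \<exists>q t i. s = (r(vP := irreducible_word n, vQ := q, vT := t, vi := i), m))"
proof -
  define L where "L = irreducible_word n"
  have L: "2 ^ n \<le> L" "L < 2 ^ Suc n" "irreducible (word_poly L)"
    using irreducible_word[OF n_bounds(1)] by (simp_all add: L_def)
  have "(2::nat) \<le> 2 ^ n" using n_bounds(1) power_increasing[of 1 n "2::nat"] by simp
  define st where "st P q t i = (r(vP := P, vQ := q, vT := t, vi := i), m)" for P q t i
  \<comment> \<open>As in the prime search, \<open>P \<le> L\<close> is preserved because only a
    reducible candidate is increased and \<open>L\<close> is irreducible. The registers
    \<open>vT\<close> and \<open>vi\<close> are left arbitrary, since every round overwrites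
    them.\<close>
  define I where "I s \<longleftrightarrow> (\<exists>P q t i. s = st P q t i \<and> 2 ^ n \<le> P \<and> P \<le> L \<and> 2 \<le> q \<and> q \<le> 2 ^ n \<and>
    (\<forall>q'. 2 \<le> q' \<longrightarrow> q' < q \<longrightarrow> \<not> word_poly q' dvd word_poly P))" for s
  define f where "f s = (L - fst s vP) * 2 ^ n + (2 ^ n - fst s vQ)" for s :: "var state"
  let ?b = "\<acute>vQ [<] Num 1 [<<] \<acute>vn :: var exp"
  let ?c3 = "If (\<acute>vT [=] Num 0) (vP ::= \<acute>vP [+] Num 1;; vQ ::= Num 2) (vQ ::= \<acute>vQ [+] Num 1) :: var com"
  let ?c2 = "While (Num 0 [<] \<acute>vi)
          (vi ::= \<acute>vi [-] Num 1;;
           When ((\<acute>vT [xor] \<acute>vQ [<<] \<acute>vi) [<] \<acute>vT)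
             (vT ::= \<acute>vT [xor] \<acute>vQ [<<] \<acute>vi)) :: var com"
  let ?c = "vT ::= \<acute>vP;; vi ::= \<acute>vn [+] Num 1;; ?c2;; ?c3"
  have Lfits: "P \<le> L \<Longrightarrow> fits (Suc l) P" for P l
  proof -
    assume "P \<le> L"
    then have "P \<le> 2 ^ n * 2" using L by simp
    then show "fits (Suc l) P" by (rule fits_le) auto
  qed
  have loop: "\<exists>T. run w S inp (While ?b ?c) s T (\<lambda>s. \<exists>q t i. s = st L q t i)"
    if "I s" for s
  proof (rule exI, rule run_While[where I = I and f = f, OF that order.refl])
    fix s assume "I s"
    then obtain P q t i where s: "s = st P q t i" and I: "2 ^ n \<le> P" "P \<le> L" "2 \<le> q" "q \<le> 2 ^ n"
      "\<And>q'. 2 \<le> q' \<Longrightarrow> q' < q \<Longrightarrow> \<not> word_poly q' dvd word_poly P" unfolding I_def by blast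
    have le: "q \<le> B" using I le_B(5) by linarith
    then have b: "eval w S inp s ?b = Some (of_bool (q < 2 ^ n))" using assms by (simp add: s st_def)
    then show "\<exists>v. eval w S inp s ?b = Some v" by blast
    {
      assume "eval w S inp s ?b = Some 0"
      then have "q = 2 ^ n" using b I by simp
      have "irreducible (word_poly P)"
        by (rule irreducible_word_polyI[OF n_bounds(1)]) (use I L \<open>q = 2 ^ n\<close> in auto)
      then have "L \<le> P" unfolding L_def using I by (intro irreducible_word_le)
      then show "\<exists>q t i. s = st L q t i" using I(2) s by auto
    }
    fix v assume "eval w S inp s ?b = Some v" "v \<noteq> 0"
    then have "q < 2 ^ n" using b by (auto split: if_splits)
    have P: "P < 2 ^ Suc n" using I L by linarith
    have deg: "degree (word_poly P) = n" using I(1) P by (rule degree_word_poly)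
    note [simp] = Lfits[OF I(2)] le
    have c3: "run w S inp ?c3 (st P q t' 0) (6 + 3 + 1) (\<lambda>s'. I s' \<and> f s' < f s)"
      if t': "word_poly t' = word_poly P mod word_poly q" for t'
    proof (rule run_le, rule run_If)
      have "word_poly t' = 0 \<or> degree (word_poly t') < degree (word_poly q)"
        unfolding t' using degree_mod_less[of "word_poly q"] I(3) by auto
      then have "t' < 2 ^ degree (word_poly q)" unfolding word_poly_degree_less .
      also have "\<dots> \<le> q" using word_poly_bracket(1)[of q] I(3) by linarith
      finally have "t' \<le> B" using le by linarith
      then show "eval w S inp (st P q t' 0) (\<acute>vT [=] Num 0) = Some (of_bool (t' = 0))"
        by (simp add: st_def)
    next
      assume "of_bool (t' = 0) \<noteq> (0::nat)"
      then have "t' = 0" by (auto split: if_splits)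
      then have "word_poly q dvd word_poly P" using t' by (simp add: dvd_eq_mod_eq_0)
      then have "\<not> irreducible (word_poly P)"
        using not_irreducible_word_poly[of q P] I(3) \<open>q < 2 ^ n\<close> deg by simp
      then have "P < L" using L I by (metis le_neq_implies_less)
      have "I (st (Suc P) 2 t' 0)" unfolding I_def using I(1) \<open>P < L\<close> \<open>2 \<le> 2 ^ n\<close>
        by (intro exI[of _ "Suc P"] exI[of _ 2] exI[of _ t'] exI[of _ 0]) auto
      moreover have "f (st (Suc P) 2 t' 0) < f s"
      proof -
        have "L - P = Suc (L - Suc P)" using \<open>P < L\<close> by simp
        then show ?thesis using \<open>q < 2 ^ n\<close> \<open>2 \<le> 2 ^ n\<close> by (simp add: f_def s st_def)
      qed
      moreover have "(r(vP := P, vQ := q, vT := t', vi := 0))(vP := Suc P, vQ := 2) =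
          r(vP := Suc P, vQ := 2, vT := t', vi := 0)" by auto
      ultimately show "run w S inp (vP ::= \<acute>vP [+] Num 1;; vQ ::= Num 2) (st P q t' 0)
          (cost (\<acute>vP [+] Num 1 :: var exp) + 1 + (cost (Num 2 :: var exp) + 1)) (\<lambda>s'. I s' \<and> f s' < f s)"
        unfolding st_def by (intro run_Seq run_Assign[where v = "Suc P"] run_Assign[where v = 2]) simp_all
    next
      assume "of_bool (t' = 0) = (0::nat)"
      then have "t' \<noteq> 0" by (auto split: if_splits)
      then have "\<not> word_poly q dvd word_poly P"
        using t' by (metis dvd_imp_mod_0 word_poly_eq_0_iff)
      then have "I (st P (Suc q) t' 0)" unfolding I_def using I \<open>q < 2 ^ n\<close>
        by (intro exI[of _ P] exI[of _ "Suc q"] exI[of _ t'] exI[of _ 0]) (auto simp: less_Suc_eq)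
      moreover have "f (st P (Suc q) t' 0) < f s"
        using \<open>q < 2 ^ n\<close> by (simp add: f_def s st_def)
      moreover have "(r(vP := P, vQ := q, vT := t', vi := 0))(vQ := Suc q) =
          r(vP := P, vQ := Suc q, vT := t', vi := 0)" by auto
      ultimately show "run w S inp (vQ ::= \<acute>vQ [+] Num 1) (st P q t' 0)
          (cost (\<acute>vQ [+] Num 1 :: var exp) + 1) (\<lambda>s'. I s' \<and> f s' < f s)"
        unfolding st_def by (intro run_Assign[where v = "Suc q"]) simp_all
    qed simp
    have c2: "run w S inp ?c2 (st P q P (Suc n)) (Suc n * 25 + 5)
        (\<lambda>s'. run w S inp ?c3 s' (6 + 3 + 1) (\<lambda>s'. I s' \<and> f s' < f s))"
      unfolding st_def
      by (rule run_mono[OF run_reduce[OF I(3) \<open>q < 2 ^ n\<close> P] order.refl])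
        (use c3 in \<open>auto simp: st_def\<close>)
    have st: "(r(vP := P, vQ := q, vT := t, vi := i))(vT := P, vi := Suc n) =
        r(vP := P, vQ := q, vT := P, vi := Suc n)" by auto
    show "run w S inp ?c s (cost (\<acute>vP :: var exp) + 1 + (cost (\<acute>vn [+] Num 1 :: var exp) + 1 +
        (Suc n * 25 + 5 + (6 + 3 + 1)))) (\<lambda>s'. I s' \<and> f s' < f s)"
      unfolding s st_def
    proof (rule run_Seq, rule run_Assign[where v = P], simp,
        rule run_Seq, rule run_Assign[where v = "Suc n"])
      show "run w S inp (?c2;; ?c3) ((r(vP := P, vQ := q, vT := t, vi := i))(vT := P, vi := Suc n), m)
          (Suc n * 25 + 5 + (6 + 3 + 1)) (\<lambda>s'. I s' \<and> f s' < f (r(vP := P, vQ := q, vT := t, vi := i), m))"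
        unfolding st using run_Seq[OF c2] unfolding s st_def .
    qed (use assms in simp)
  qed
  have "I (st (2 ^ n) 2 (r vT) (r vi))"
    unfolding I_def using L \<open>2 \<le> 2 ^ n\<close>
    by (intro exI[of _ "2 ^ n"] exI[of _ 2] exI[of _ "r vT"] exI[of _ "r vi"]) auto
  from loop[OF this] obtain T where
    "run w S inp (While ?b ?c) (st (2 ^ n) 2 (r vT) (r vi)) T (\<lambda>s. \<exists>q t i. s = st L q t i)" by blast
  moreover have "st (2 ^ n) 2 (r vT) (r vi) = (r(vP := 2 ^ n, vQ := 2), m)" by (auto simp: st_def)
  ultimately have T: "run w S inp (While ?b ?c) (r(vP := 2 ^ n, vQ := 2), m) T
      (\<lambda>s. \<exists>q t i. s = st L q t i)" by simp
  show ?thesis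
    unfolding irreducible_prog_def
    by (rule exI, rule run_Seq, rule run_Assign, simp add: assms, rule run_Seq, rule run_Assign, simp,
        rule T[unfolded st_def L_def])
qed

end

section \<open>Algorithm 1\<close>

lemma map_replicate_pmf: "replicate_pmf K (map_pmf f M) = map_pmf (map f) (replicate_pmf K M)"
  by (induction K) (simp_all add: map_pmf_def bind_assoc_pmf bind_return_pmf)

lemma pmf_replicate_pmf:
  "pmf (replicate_pmf K M) xs = (if length xs = K then prod_list (map (pmf M) xs) else 0)"
proof (induction K arbitrary: xs)
  case 0
  then show ?case by (auto simp: indicator_def)
next
  case (Suc K)
  have *: "replicate_pmf (Suc K) M = map_pmf (\<lambda>(x, xs). x # xs) (pair_pmf M (replicate_pmf K M))"
    by (simp add: pair_pmf_def map_pmf_def bind_assoc_pmf bind_return_pmf)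
  show ?case
  proof (cases xs)
    case Nil
    then have "xs \<notin> set_pmf (replicate_pmf (Suc K) M)" unfolding * by auto
    then show ?thesis using Nil by (simp add: set_pmf_iff del: replicate_pmf.simps)
  next
    case (Cons y ys)
    have "pmf (replicate_pmf (Suc K) M) xs = pmf (map_pmf (\<lambda>(x, xs). x # xs) (pair_pmf M (replicate_pmf K M)))
        ((\<lambda>(x, xs). x # xs) (y, ys))"
      by (simp add: * Cons del: replicate_pmf.simps)
    also have "\<dots> = pmf (pair_pmf M (replicate_pmf K M)) (y, ys)"
      by (rule pmf_map_inj') (auto simp: inj_on_def)
    finally show ?thesis by (simp add: Cons Suc pmf_pair del: replicate_pmf.simps)
  qed
qed

text \<open>Both sides give each admissible list the probability \<open>1 / card A ^ K\<close>. The
  lemma matches the single draw of the coefficient list in \<open>algorithm1\<close> with the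
  coefficientwise draws of the program.\<close>

lemma replicate_pmf_of_set:
  assumes "finite A" "A \<noteq> {}"
  shows "replicate_pmf K (pmf_of_set A) = pmf_of_set {xs. length xs = K \<and> (\<forall>x\<in>set xs. x \<in> A)}"
    (is "_ = pmf_of_set ?X")
proof (rule pmf_eqI)
  fix xs
  have X: "?X = {xs. set xs \<subseteq> A \<and> length xs = K}" by auto
  have fin: "finite ?X" "card ?X = card A ^ K"
    unfolding X using finite_lists_length_eq[OF assms(1)] card_lists_length_eq[OF assms(1)] by auto
  obtain a where "a \<in> A" using assms by blast
  then have ne: "?X \<noteq> {}" by (auto intro!: exI[of _ "replicate K a"])
  have "prod_list (map (pmf (pmf_of_set A)) xs) = (if set xs \<subseteq> A then 1 / real (card A) ^ length xs else 0)"
    using assms by (induction xs) auto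
  then show "pmf (replicate_pmf K (pmf_of_set A)) xs = pmf (pmf_of_set ?X) xs"
    using fin ne by (auto simp: pmf_replicate_pmf indicator_def)
qed

lemma pair_pmf_of_set:
  assumes "finite A" "A \<noteq> {}" "finite B" "B \<noteq> {}"
  shows "pair_pmf (pmf_of_set A) (pmf_of_set B) = pmf_of_set (A \<times> B)"
proof (rule pmf_eqI)
  fix x :: "'a \<times> 'b"
  show "pmf (pair_pmf (pmf_of_set A) (pmf_of_set B)) x = pmf (pmf_of_set (A \<times> B)) x"
    using assms by (cases x) (simp add: pmf_pair indicator_times card_cartesian_product)
qed

lemma written_simps [simp]:
  "x \<noteq> vLen \<Longrightarrow> written (r(x := v), m) = written (r, m)"
  "r vLen = l \<Longrightarrow> written (r(vLen := Suc l), m(l := v)) = written (r, m) @ [v]"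
  by (simp_all add: written_def)

context word_ram
begin

text \<open>The size of the encoded output: the modulus, the prime, \<open>\<kappa>\<close>
  coefficients, and two words for each of the \<open>2 ^ d * d2\<close> hash functions. The program
  needs no working memory beyond its output.\<close>

definition cells where "cells = 2 + \<kappa> + 2 * (2 ^ d * d2)"

lemma fits_le_cells:
  assumes "l \<le> cells"
  shows "fits (Suc (Suc (Suc (Suc i)))) l"
  using assms unfolding cells_def by (rule fits_le) (intro fits_add fits_mult; simp)

lemma run_emit:
  assumes "eval w s inp (r, m) e = Some v" "r vLen = l" "l < s" "fits (Suc (Suc (Suc (Suc 0)))) l"
    and Q: "Q (r(vLen := Suc l), m(l := v))"
  shows "run w s inp (emit e) (r, m) (cost e + 6) Q"
proof -
  have "fits (Suc (Suc (Suc (Suc (Suc 0))))) l" "fits (Suc (Suc (Suc (Suc (Suc 0))))) (Suc l)"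
    using assms(4) by (auto intro: fits_Suc)
  note [simp] = this assms(2)
  show ?thesis
    unfolding emit_def
    by (rule run_le, rule run_Seq, rule run_Store, simp, rule assms(3), rule assms(1),
        rule run_Assign, use assms(4) in simp) (use Q in simp_all)
qed

lemma samples_emit_Assign:
  assumes "eval w s inp (r, m) e = Some v" "r vLen = l" "l < s" "fits (Suc (Suc (Suc (Suc 0)))) l"
    and "eval w s inp (r(vLen := Suc l), m(l := v)) e' = Some v'"
    and "written (r(vLen := Suc l, x := v'), m(l := v)) = ys" "Q (r(vLen := Suc l, x := v'), m(l := v))"
  shows "samples w s inp (emit e;; x ::= e') (r, m) (return_pmf ys) Q"
  by (rule samples_run, rule run_Seq, rule run_emit[OF assms(1-4)], rule run_Assign[OF assms(5)])
    (use assms(6,7) in simp)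

definition ready :: "(var \<Rightarrow> nat) \<Rightarrow> bool" where
  "ready r \<longleftrightarrow> pars r \<and> r vp = least_prime N"

lemma ready_upd [simp]:
  "x \<notin> {vN, vK, vU, vD, vn, vKappa, vD2, vR, vD3, vp} \<Longrightarrow> ready (r(x := v)) = ready r"
  by (cases x) (simp_all add: ready_def)

lemma ready_lookup:
  assumes "ready r"
  shows "r vn = n" "r vD = d" "r vKappa = \<kappa>" "r vD2 = d2" "r vp = least_prime N"
  using assms by (auto simp: ready_def pars_def)

definition coeff_pmf :: "nat list pmf" where
  "coeff_pmf = bind_pmf (pmf_of_set {0..<2 ^ n}) (\<lambda>z. return_pmf [z])"

text \<open>\<open>Rand\<close> draws from intervals starting at 0, so the nonzero multiplier is a
  draw below \<open>p - 1\<close>, shifted by 1.\<close>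

definition pair_list_pmf :: "nat list pmf" where
  "pair_list_pmf = bind_pmf (pmf_of_set {0..<least_prime N - 1}) (\<lambda>a.
     bind_pmf (pmf_of_set {0..<least_prime N}) (\<lambda>b. return_pmf [a + 1, b]))"

lemma samples_coefficients:
  assumes "ready r" "r vi = 0" "r vLen = 2"
  shows "samples w cells inp (While (\<acute>vi [<] \<acute>vKappa)
       (Rand vT (Num 1 [<<] \<acute>vn);;
        emit \<acute>vT;;
        vi ::= \<acute>vi [+] Num 1)) (r, m)
     (map_pmf (\<lambda>yss. written (r, m) @ concat yss) (replicate_pmf \<kappa> coeff_pmf))
     (\<lambda>s. ready (fst s) \<and> fst s vLen = 2 + \<kappa>)"
proof -
  define I where "I j s \<longleftrightarrow> ready (fst s) \<and> fst s vi = j \<and> fst s vLen = 2 + j" for j and s :: "var state"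
  have "samples w cells inp (While (\<acute>vi [<] \<acute>vKappa)
       (Rand vT (Num 1 [<<] \<acute>vn);;
        emit \<acute>vT;;
        vi ::= \<acute>vi [+] Num 1)) (r, m)
     (map_pmf (\<lambda>yss. written (r, m) @ concat yss) (replicate_pmf (\<kappa> - 0) coeff_pmf)) (I \<kappa>)"
  proof (rule samples_for_loop[where I = I])
    show "I 0 (r, m)" using assms by (simp add: I_def)
    show "\<exists>v. eval w cells inp s (\<acute>vi [<] \<acute>vKappa) = Some v \<and> v \<noteq> 0" if "I j s" "j < \<kappa>" for j s
    proof -
      have "j \<le> B" using that(2) le_B(9) by linarith
      then show ?thesis using that by (cases s) (auto simp: I_def ready_lookup)
    qed
    show "eval w cells inp s (\<acute>vi [<] \<acute>vKappa) = Some 0" if "I \<kappa> s" for s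
      using that by (cases s) (auto simp: I_def ready_lookup)
  next
    fix j s assume "I j s" "j < \<kappa>"
    then obtain r m where s: "s = (r, m)" and r: "ready r" "r vi = j" "r vLen = 2 + j"
      by (cases s) (auto simp: I_def)
    have cells: "2 + \<kappa> \<le> cells" by (simp add: cells_def)
    have j: "j \<le> B" "Suc (Suc j) \<le> cells" "Suc (Suc j) < cells"
      using \<open>j < \<kappa>\<close> le_B(9) cells by linarith+
    have fj: "fits (Suc (Suc (Suc (Suc 0)))) (Suc (Suc j))" using j by (intro fits_le_cells)
    show "samples w cells inp (Rand vT (Num 1 [<<] \<acute>vn);; emit \<acute>vT;; vi ::= \<acute>vi [+] Num 1) s
       (map_pmf (\<lambda>ys. written s @ ys) coeff_pmf) (I (Suc j))"
      unfolding coeff_pmf_def map_bind_pmf map_return_pmf s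
    proof (rule samples_Rand)
      show "eval w cells inp (r, m) (Num 1 [<<] \<acute>vn) = Some (2 ^ n)" using r by (simp add: ready_lookup)
      fix z :: nat assume "z < 2 ^ n"
      then have "z \<le> B" using le_B(5) by linarith
      then show "samples w cells inp (emit \<acute>vT;; vi ::= \<acute>vi [+] Num 1) (r(vT := z), m)
          (return_pmf (written (r, m) @ [z])) (I (Suc j))"
        by (intro samples_emit_Assign[where l = "2 + j" and v = z and v' = "Suc j"])
          (use r j fj in \<open>simp_all add: I_def\<close>)
    qed simp
  qed simp
  then show ?thesis unfolding samples_def I_def by auto
qed

lemma least_prime_pos: "1 < least_prime N"
  using least_prime(1)[of N] N prime_gt_1_nat by simp

lemma samples_pairs:
  assumes "ready r" "r vl = 0" "r vi = i" "i < 2 ^ d" "r vLen = 2 + \<kappa> + 2 * (i * d2)"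
  shows "samples w cells inp (While (\<acute>vl [<] \<acute>vD2)
          (Rand vT (\<acute>vp [-] Num 1);;
           emit (\<acute>vT [+] Num 1);;
           Rand vT \<acute>vp;;
           emit \<acute>vT;;
           vl ::= \<acute>vl [+] Num 1)) (r, m)
     (map_pmf (\<lambda>yss. written (r, m) @ concat yss) (replicate_pmf d2 pair_list_pmf))
     (\<lambda>s. ready (fst s) \<and> fst s vi = i \<and> fst s vLen = 2 + \<kappa> + 2 * (Suc i * d2))"
proof -
  define I where "I j s \<longleftrightarrow> ready (fst s) \<and> fst s vl = j \<and> fst s vi = i \<and>
    fst s vLen = 2 + \<kappa> + 2 * (i * d2 + j)" for j and s :: "var state"
  have "samples w cells inp (While (\<acute>vl [<] \<acute>vD2)
          (Rand vT (\<acute>vp [-] Num 1);;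
           emit (\<acute>vT [+] Num 1);;
           Rand vT \<acute>vp;;
           emit \<acute>vT;;
           vl ::= \<acute>vl [+] Num 1)) (r, m)
     (map_pmf (\<lambda>yss. written (r, m) @ concat yss) (replicate_pmf (d2 - 0) pair_list_pmf)) (I d2)"
  proof (rule samples_for_loop[where I = I])
    show "I 0 (r, m)" using assms by (simp add: I_def)
    show "\<exists>v. eval w cells inp s (\<acute>vl [<] \<acute>vD2) = Some v \<and> v \<noteq> 0" if "I j s" "j < d2" for j s
    proof -
      have "j \<le> B" using that(2) le_B(10) by linarith
      then show ?thesis using that by (cases s) (auto simp: I_def ready_lookup)
    qed
    show "eval w cells inp s (\<acute>vl [<] \<acute>vD2) = Some 0" if "I d2 s" for s
      using that by (cases s) (auto simp: I_def ready_lookup)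
  next
    fix j s assume "I j s" "j < d2"
    define l where "l = 2 + \<kappa> + 2 * (i * d2 + j)"
    obtain r m where s: "s = (r, m)" and r: "ready r" "r vl = j" "r vi = i" "r vLen = l"
      using \<open>I j s\<close> by (cases s) (auto simp: I_def l_def)
    have "i * d2 + j < Suc i * d2" using \<open>j < d2\<close> by simp
    also have "Suc i * d2 \<le> 2 ^ d * d2" using assms(4) by (intro mult_right_mono) auto
    finally have "i * d2 + j < 2 ^ d * d2" .
    then have l: "l < cells" "Suc l < cells" by (auto simp: l_def cells_def)
    have j: "j \<le> B" using \<open>j < d2\<close> le_B(10) by linarith
    have fl: "fits (Suc (Suc (Suc (Suc 0)))) l" "fits (Suc (Suc (Suc (Suc 0)))) (Suc l)"
      using l by (auto intro!: fits_le_cells)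
    show "samples w cells inp (Rand vT (\<acute>vp [-] Num 1);; emit (\<acute>vT [+] Num 1);;
         Rand vT \<acute>vp;; emit \<acute>vT;; vl ::= \<acute>vl [+] Num 1) s
       (map_pmf (\<lambda>ys. written s @ ys) pair_list_pmf) (I (Suc j))"
      unfolding pair_list_pmf_def map_bind_pmf map_return_pmf s
    proof (rule samples_Rand)
      show "eval w cells inp (r, m) (\<acute>vp [-] Num 1) = Some (least_prime N - 1)"
        using r by (simp add: ready_lookup)
      show "0 < least_prime N - 1" using least_prime_pos by simp
      fix a assume "a < least_prime N - 1"
      then have a: "a \<le> B" using le_B(13) by linarith
      \<comment> \<open>Once the first component is emitted it belongs to the written list, so the
        second draw can reuse \<open>vT\<close>. The point mass in the distribution has the form
        that the sequencing rule expects.\<close>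
      have "samples w cells inp (emit (\<acute>vT [+] Num 1);;
         Rand vT \<acute>vp;; emit \<acute>vT;; vl ::= \<acute>vl [+] Num 1) (r(vT := a), m)
         (bind_pmf (return_pmf (written (r, m) @ [a + 1]))
           (\<lambda>ys. bind_pmf (pmf_of_set {0..<least_prime N}) (\<lambda>b. return_pmf (ys @ [b])))) (I (Suc j))"
      proof (rule samples_Seq[where ?Q1.0 = "\<lambda>s. ready (fst s) \<and> fst s vl = j \<and> fst s vi = i \<and>
            fst s vLen = Suc l"])
        show "samples w cells inp (emit (\<acute>vT [+] Num 1)) (r(vT := a), m) (return_pmf (written (r, m) @ [a + 1]))
            (\<lambda>s. ready (fst s) \<and> fst s vl = j \<and> fst s vi = i \<and> fst s vLen = Suc l)"
          by (rule samples_run, rule run_emit[where l = l]) (use r l fl a in simp_all)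
      next
        fix s1 :: "var state"
        assume "ready (fst s1) \<and> fst s1 vl = j \<and> fst s1 vi = i \<and> fst s1 vLen = Suc l"
        then obtain r m where s: "s1 = (r, m)" and r: "ready r" "r vl = j" "r vi = i" "r vLen = Suc l"
          by (cases s1) auto
        show "samples w cells inp (Rand vT \<acute>vp;; emit \<acute>vT;; vl ::= \<acute>vl [+] Num 1) s1
            (bind_pmf (pmf_of_set {0..<least_prime N}) (\<lambda>b. return_pmf (written s1 @ [b]))) (I (Suc j))"
          unfolding s
        proof (rule samples_Rand)
          show "eval w cells inp (r, m) \<acute>vp = Some (least_prime N)"
            using r by (simp add: ready_lookup)
          show "0 < least_prime N" using least_prime_pos by simp
          fix z assume "z < least_prime N"
          then have "z \<le> B" using le_B(13) by linarith
          then show "samples w cells inp (emit \<acute>vT;; vl ::= \<acute>vl [+] Num 1) (r(vT := z), m)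
              (return_pmf (written (r, m) @ [z])) (I (Suc j))"
            by (intro samples_emit_Assign[where l = "Suc l" and v = z and v' = "Suc j"])
              (use r j l fl in \<open>simp_all add: I_def l_def\<close>)
        qed
      qed
      then show "samples w cells inp (emit (\<acute>vT [+] Num 1);;
         Rand vT \<acute>vp;; emit \<acute>vT;; vl ::= \<acute>vl [+] Num 1) (r(vT := a), m)
         (bind_pmf (pmf_of_set {0..<least_prime N}) (\<lambda>b. return_pmf (written (r, m) @ [a + 1, b]))) (I (Suc j))"
        by (simp add: bind_return_pmf)
    qed
  qed simp
  then show ?thesis unfolding samples_def I_def by (auto simp: algebra_simps)
qed

lemma samples_functions:
  assumes "ready r" "r vi = 0" "r vLen = 2 + \<kappa>"
  shows "samples w cells inp (While (\<acute>vi [<] Num 1 [<<] \<acute>vD)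
       (vl ::= Num 0;;
        While (\<acute>vl [<] \<acute>vD2)
          (Rand vT (\<acute>vp [-] Num 1);;
           emit (\<acute>vT [+] Num 1);;
           Rand vT \<acute>vp;;
           emit \<acute>vT;;
           vl ::= \<acute>vl [+] Num 1);;
        vi ::= \<acute>vi [+] Num 1)) (r, m)
     (map_pmf (\<lambda>yss. written (r, m) @ concat yss)
       (replicate_pmf (2 ^ d) (map_pmf concat (replicate_pmf d2 pair_list_pmf))))
     (\<lambda>_. True)"
proof -
  define I where "I j s \<longleftrightarrow> ready (fst s) \<and> fst s vi = j \<and> fst s vLen = 2 + \<kappa> + 2 * (j * d2)" for j and s :: "var state"
  let ?w = "While (\<acute>vl [<] \<acute>vD2)
          (Rand vT (\<acute>vp [-] Num 1);;
           emit (\<acute>vT [+] Num 1);;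
           Rand vT \<acute>vp;;
           emit \<acute>vT;;
           vl ::= \<acute>vl [+] Num 1)"
  have "samples w cells inp (While (\<acute>vi [<] Num 1 [<<] \<acute>vD)
       (vl ::= Num 0;; ?w;; vi ::= \<acute>vi [+] Num 1)) (r, m)
     (map_pmf (\<lambda>yss. written (r, m) @ concat yss)
       (replicate_pmf (2 ^ d - 0) (map_pmf concat (replicate_pmf d2 pair_list_pmf)))) (I (2 ^ d))"
  proof (rule samples_for_loop[where I = I])
    show "I 0 (r, m)" using assms by (simp add: I_def)
    show "\<exists>v. eval w cells inp s (\<acute>vi [<] Num 1 [<<] \<acute>vD) = Some v \<and> v \<noteq> 0" if "I j s" "j < 2 ^ d" for j s
    proof -
      have "j \<le> B" using that(2) le_B(4) by linarith
      then show ?thesis using that by (cases s) (auto simp: I_def ready_lookup)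
    qed
    show "eval w cells inp s (\<acute>vi [<] Num 1 [<<] \<acute>vD) = Some 0" if "I (2 ^ d) s" for s
      using that by (cases s) (auto simp: I_def ready_lookup)
  next
    fix j s assume "I j s" "j < 2 ^ d"
    then obtain r m where s: "s = (r, m)" and r: "ready r" "r vi = j" "r vLen = 2 + \<kappa> + 2 * (j * d2)"
      by (cases s) (auto simp: I_def)
    have j: "j \<le> B" using \<open>j < 2 ^ d\<close> le_B(4) by linarith
    \<comment> \<open>The deterministic assignments enter as trivial binds with point masses, to
      match the sequencing rule; they are simplified away at the end.\<close>
    have "samples w cells inp (vl ::= Num 0;; ?w;; vi ::= \<acute>vi [+] Num 1) s
        (bind_pmf (return_pmf (written s)) (\<lambda>ys0.
          bind_pmf (map_pmf (\<lambda>yss. written s @ concat yss) (replicate_pmf d2 pair_list_pmf)) return_pmf))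
        (I (Suc j))"
    proof (rule samples_Seq[where ?Q1.0 = "\<lambda>s'. s' = (r(vl := 0), m)"])
      show "samples w cells inp (vl ::= Num 0) s (return_pmf (written s)) (\<lambda>s'. s' = (r(vl := 0), m))"
        unfolding s by (rule samples_run, rule run_Assign[where v = 0]) simp_all
    next
      fix s1 :: "var state" assume s1: "s1 = (r(vl := 0), m)"
      show "samples w cells inp (?w;; vi ::= \<acute>vi [+] Num 1) s1
          (bind_pmf (map_pmf (\<lambda>yss. written s @ concat yss) (replicate_pmf d2 pair_list_pmf)) return_pmf)
          (I (Suc j))"
      proof (rule samples_Seq)
        have "samples w cells inp ?w (r(vl := 0), m)
          (map_pmf (\<lambda>yss. written (r(vl := 0), m) @ concat yss) (replicate_pmf d2 pair_list_pmf))
          (\<lambda>s. ready (fst s) \<and> fst s vi = j \<and> fst s vLen = 2 + \<kappa> + 2 * (Suc j * d2))"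
          using r \<open>j < 2 ^ d\<close> by (intro samples_pairs) simp_all
        then show "samples w cells inp ?w s1
          (map_pmf (\<lambda>yss. written s @ concat yss) (replicate_pmf d2 pair_list_pmf))
          (\<lambda>s. ready (fst s) \<and> fst s vi = j \<and> fst s vLen = 2 + \<kappa> + 2 * (Suc j * d2))"
          by (simp add: s s1)
      next
        fix s2 :: "var state"
        assume "ready (fst s2) \<and> fst s2 vi = j \<and> fst s2 vLen = 2 + \<kappa> + 2 * (Suc j * d2)"
        then obtain r m where s: "s2 = (r, m)" and r: "ready r" "r vi = j" "r vLen = 2 + \<kappa> + 2 * (Suc j * d2)"
          by (cases s2) auto
        show "samples w cells inp (vi ::= \<acute>vi [+] Num 1) s2 (return_pmf (written s2)) (I (Suc j))"
          unfolding s by (rule samples_run, rule run_Assign[where v = "Suc j"]) (use r j in \<open>simp_all add: I_def\<close>)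
      qed
    qed
    then show "samples w cells inp (vl ::= Num 0;; ?w;; vi ::= \<acute>vi [+] Num 1) s
       (map_pmf (\<lambda>ys. written s @ ys) (map_pmf concat (replicate_pmf d2 pair_list_pmf))) (I (Suc j))"
      by (simp add: bind_return_pmf bind_return_pmf' pmf.map_comp o_def)
  qed simp
  then show ?thesis unfolding samples_def by auto
qed

section \<open>Agreement of the sampled list with the specification\<close>

definition P where "P = word_poly (irreducible_word n)"

lemma P_props: "irreducible P" "degree P = n" "poly_word P = irreducible_word n"
  using irreducible_word[OF n_bounds(1)] by (simp_all add: P_def)

text \<open>The zero polynomial belongs to the left side because \<open>n\<close> is positive. This
  lets uniform words below \<open>2 ^ n\<close> represent uniform field elements.\<close>

lemma small_polys_eq: "{c :: bit poly. degree c < n} = word_poly ` {0..<2 ^ n}"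
proof (intro equalityI subsetI)
  fix c :: "bit poly" assume "c \<in> {c. degree c < n}"
  then have "poly_word c < 2 ^ n" unfolding word_poly_degree_less by simp
  then show "c \<in> word_poly ` {0..<2 ^ n}" by (intro image_eqI[of _ _ "poly_word c"]) auto
next
  fix c assume "c \<in> word_poly ` {0..<2 ^ n}"
  then obtain v where v: "v < 2 ^ n" "c = word_poly v" by auto
  then show "c \<in> {c. degree c < n}"
    using n_bounds(1) unfolding word_poly_degree_less by auto
qed

lemma small_polys: "finite {c :: bit poly. degree c < n}" "{c :: bit poly. degree c < n} \<noteq> {}"
  unfolding small_polys_eq by auto

lemma coeff_pmf_eq: "coeff_pmf = map_pmf (\<lambda>c. [poly_word c]) (pmf_of_set {c. degree c < n})"
proof -
  have "pmf_of_set {c. degree c < n} = map_pmf word_poly (pmf_of_set {0..<2 ^ n})"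
    unfolding small_polys_eq by (simp add: map_pmf_of_set_inj inj_on_def word_poly_eq_iff)
  then show ?thesis by (simp add: coeff_pmf_def pmf.map_comp o_def flip: map_pmf_def)
qed

lemma pair_list_pmf_eq:
  "pair_list_pmf = map_pmf (\<lambda>(a, b). [a, b]) (pmf_of_set ({1..<least_prime N} \<times> {0..<least_prime N}))"
proof -
  let ?p = "least_prime N"
  have "{1..<?p} = Suc ` {0..<?p - 1}"
    using least_prime_pos by (auto simp: image_iff intro!: bexI[of _ "_ - 1"])
  then have "pmf_of_set {1..<?p} = map_pmf Suc (pmf_of_set {0..<?p - 1})"
    using least_prime_pos by (simp add: map_pmf_of_set_inj)
  moreover have "pmf_of_set ({1..<?p} \<times> {0..<?p}) = pair_pmf (pmf_of_set {1..<?p}) (pmf_of_set {0..<?p})"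
    using least_prime_pos by (intro pair_pmf_of_set[symmetric]) auto
  ultimately show ?thesis
    by (simp add: pair_list_pmf_def pair_pmf_def map_pmf_def bind_assoc_pmf bind_return_pmf)
qed

lemma concat_map_map: "concat (map concat (map (map f) xss)) = concat (map f (concat xss))"
  by (induction xss) auto

lemma coefficient_lists:
  "pmf_of_set {cs. length cs = kappa k \<and> (\<forall>c\<in>set cs. degree c < degree P)} =
    replicate_pmf \<kappa> (pmf_of_set {c :: bit poly. degree c < n})"
  unfolding replicate_pmf_of_set[OF small_polys] by (simp add: \<kappa>_def P_props)

text \<open>Rewrites the specification into the form that the two sampling loops produce. Encoding
  is pushed inside the independent draws, where it acts on single coefficients and single
  pairs.\<close>

lemma encode_algorithm1:
  "map_pmf encode (algorithm1 N k P (least_prime N)) =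
    bind_pmf (map_pmf (\<lambda>yss. [irreducible_word n, least_prime N] @ concat yss) (replicate_pmf \<kappa> coeff_pmf))
      (\<lambda>ys. map_pmf (\<lambda>yss. ys @ concat yss)
        (replicate_pmf (2 ^ d) (map_pmf concat (replicate_pmf d2 pair_list_pmf))))"
  unfolding algorithm1_def coefficient_lists coeff_pmf_eq pair_list_pmf_eq map_replicate_pmf
  by (simp add: map_pmf_def bind_assoc_pmf bind_return_pmf encode_def P_props concat_map_map
      concat_map_singleton d_def d2_def del: map_map)

lemma samples_algorithm1:
  "samples w cells [N, k] algorithm1_prog (\<lambda>_. 0, \<lambda>_. 0)
    (map_pmf encode (algorithm1 N k P (least_prime N))) (\<lambda>_. True)"
proof -
  let ?c1 = "While (\<acute>vi [<] \<acute>vKappa) (Rand vT (Num 1 [<<] \<acute>vn);; emit \<acute>vT;; vi ::= \<acute>vi [+] Num 1)"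
  let ?c2 = "While (\<acute>vi [<] Num 1 [<<] \<acute>vD)
       (vl ::= Num 0;;
        While (\<acute>vl [<] \<acute>vD2)
          (Rand vT (\<acute>vp [-] Num 1);;
           emit (\<acute>vT [+] Num 1);;
           Rand vT \<acute>vp;;
           emit \<acute>vT;;
           vl ::= \<acute>vl [+] Num 1);;
        vi ::= \<acute>vi [+] Num 1)"
  let ?F = "replicate_pmf (2 ^ d) (map_pmf concat (replicate_pmf d2 pair_list_pmf))"
  \<comment> \<open>The program is verified from the end: \<open>tail\<close> covers the two
    sampling loops, \<open>ready_tail\<close> puts the two deterministic output words in front, and
    the parameters and searches come last.\<close>
  have tail: "samples w cells [N, k] (vi ::= Num 0;; ?c1;; vi ::= Num 0;; ?c2) s
     (bind_pmf (map_pmf (\<lambda>yss. written s @ concat yss) (replicate_pmf \<kappa> coeff_pmf))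
       (\<lambda>ys. map_pmf (\<lambda>yss. ys @ concat yss) ?F)) (\<lambda>_. True)"
    if "ready (fst s)" "fst s vLen = 2" for s
  proof -
    obtain r m where s: "s = (r, m)" by (cases s)
    have "samples w cells [N, k] (vi ::= Num 0;; ?c1;; vi ::= Num 0;; ?c2) s
      (bind_pmf (return_pmf (written s)) (\<lambda>ys.
        bind_pmf (map_pmf (\<lambda>yss. ys @ concat yss) (replicate_pmf \<kappa> coeff_pmf))
          (\<lambda>ys. bind_pmf (return_pmf ys) (\<lambda>ys. map_pmf (\<lambda>yss. ys @ concat yss) ?F)))) (\<lambda>_. True)"
    proof (rule samples_Seq[where ?Q1.0 = "\<lambda>s. ready (fst s) \<and> fst s vLen = 2 \<and> fst s vi = 0"])
      show "samples w cells [N, k] (vi ::= Num 0) s (return_pmf (written s))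
          (\<lambda>s. ready (fst s) \<and> fst s vLen = 2 \<and> fst s vi = 0)"
        unfolding s by (rule samples_run, rule run_Assign[where v = 0]) (use that s in simp_all)
    next
      fix s1 :: "var state" assume s1: "ready (fst s1) \<and> fst s1 vLen = 2 \<and> fst s1 vi = 0"
      show "samples w cells [N, k] (?c1;; vi ::= Num 0;; ?c2) s1
        (bind_pmf (map_pmf (\<lambda>yss. written s1 @ concat yss) (replicate_pmf \<kappa> coeff_pmf))
          (\<lambda>ys. bind_pmf (return_pmf ys) (\<lambda>ys. map_pmf (\<lambda>yss. ys @ concat yss) ?F))) (\<lambda>_. True)"
      proof (rule samples_Seq)
        show "samples w cells [N, k] ?c1 s1 (map_pmf (\<lambda>yss. written s1 @ concat yss) (replicate_pmf \<kappa> coeff_pmf))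
            (\<lambda>s. ready (fst s) \<and> fst s vLen = 2 + \<kappa>)"
          using samples_coefficients[of "fst s1" "[N, k]" "snd s1"] s1 by simp
        fix s2 :: "var state" assume s2: "ready (fst s2) \<and> fst s2 vLen = 2 + \<kappa>"
        show "samples w cells [N, k] (vi ::= Num 0;; ?c2) s2
          (bind_pmf (return_pmf (written s2)) (\<lambda>ys. map_pmf (\<lambda>yss. ys @ concat yss) ?F)) (\<lambda>_. True)"
        proof (rule samples_Seq[where ?Q1.0 = "\<lambda>s. ready (fst s) \<and> fst s vLen = 2 + \<kappa> \<and> fst s vi = 0"])
          show "samples w cells [N, k] (vi ::= Num 0) s2 (return_pmf (written s2))
              (\<lambda>s. ready (fst s) \<and> fst s vLen = 2 + \<kappa> \<and> fst s vi = 0)"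
            using s2 by (cases s2, simp only:, intro samples_run[OF run_Assign[where v = 0]]) simp_all
          fix s3 :: "var state" assume s3: "ready (fst s3) \<and> fst s3 vLen = 2 + \<kappa> \<and> fst s3 vi = 0"
          show "samples w cells [N, k] ?c2 s3 (map_pmf (\<lambda>yss. written s3 @ concat yss) ?F) (\<lambda>_. True)"
            using samples_functions[of "fst s3" "[N, k]" "snd s3"] s3 by simp
        qed
      qed
    qed
    then show ?thesis by (simp add: bind_return_pmf)
  qed
  have ready_tail: "samples w cells [N, k] (vLen ::= Num 0;; emit \<acute>vP;; emit \<acute>vp;; vi ::= Num 0;; ?c1;; vi ::= Num 0;; ?c2) (r, m)
     (map_pmf encode (algorithm1 N k P (least_prime N))) (\<lambda>_. True)"
    if r: "ready r" "r vP = irreducible_word n" for r m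
  proof (rule samples_run_Seq)
    show "run w cells [N, k] (vLen ::= Num 0) (r, m) (cost (Num 0 :: var exp) + 1) (\<lambda>s. s = (r(vLen := 0), m))"
      by (rule run_Assign) simp_all
    fix s1 :: "var state" assume s1: "s1 = (r(vLen := 0), m)"
    have "irreducible_word n \<le> 2 ^ n * 2"
      using irreducible_word(3)[OF n_bounds(1)] by simp
    then have [simp]: "fits (Suc l) (irreducible_word n)" for l by (rule fits_le) auto
    have le: "0 < cells" "1 < cells" by (simp_all add: cells_def)
    show "samples w cells [N, k] (emit \<acute>vP;; emit \<acute>vp;; vi ::= Num 0;; ?c1;; vi ::= Num 0;; ?c2) s1
        (map_pmf encode (algorithm1 N k P (least_prime N))) (\<lambda>_. True)"
      unfolding s1
    proof (rule samples_run_Seq)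
      show "run w cells [N, k] (emit \<acute>vP) (r(vLen := 0), m) (cost (\<acute>vP :: var exp) + 6)
          (\<lambda>s. s = (r(vLen := 1), m(0 := irreducible_word n)))"
        by (rule run_emit[where l = 0]) (use r le in simp_all)
      fix s2 :: "var state" assume s2: "s2 = (r(vLen := 1), m(0 := irreducible_word n))"
      show "samples w cells [N, k] (emit \<acute>vp;; vi ::= Num 0;; ?c1;; vi ::= Num 0;; ?c2) s2
          (map_pmf encode (algorithm1 N k P (least_prime N))) (\<lambda>_. True)"
        unfolding s2
      proof (rule samples_run_Seq)
        show "run w cells [N, k] (emit \<acute>vp) (r(vLen := 1), m(0 := irreducible_word n)) (cost (\<acute>vp :: var exp) + 6)
            (\<lambda>s. s = (r(vLen := Suc 1), m(0 := irreducible_word n, 1 := least_prime N)))"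
          by (rule run_emit[where l = 1]) (use r le in \<open>simp_all add: ready_lookup\<close>)
        fix s3 :: "var state" assume s3: "s3 = (r(vLen := Suc 1), m(0 := irreducible_word n, 1 := least_prime N))"
        have "written s3 = [irreducible_word n, least_prime N]"
          by (simp add: s3 written_def upt_rec)
        with tail[of s3] show "samples w cells [N, k] (vi ::= Num 0;; ?c1;; vi ::= Num 0;; ?c2) s3
            (map_pmf encode (algorithm1 N k P (least_prime N))) (\<lambda>_. True)"
          using r unfolding encode_algorithm1 by (simp add: s3)
      qed
    qed
  qed
  show ?thesis
    unfolding algorithm1_prog_def
  proof (rule samples_run_Seq[OF run_params], clarify)
    fix r :: "var \<Rightarrow> nat" and m :: "nat \<Rightarrow> nat" assume r: "pars r"
    obtain T where T: "run w cells [N, k] irreducible_prog (r, m) T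
        (\<lambda>s. \<exists>q t i. s = (r(vP := irreducible_word n, vQ := q, vT := t, vi := i), m))"
      using run_irreducible[of r cells "[N, k]" m] r by (auto simp: pars_lookup)
    show "samples w cells [N, k] (irreducible_prog;; prime_prog;; vLen ::= Num 0;; emit \<acute>vP;; emit \<acute>vp;;
        vi ::= Num 0;; ?c1;; vi ::= Num 0;; ?c2) (r, m)
      (map_pmf encode (algorithm1 N k P (least_prime N))) (\<lambda>_. True)"
    proof (rule samples_run_Seq[OF T], clarify)
      fix q t i
      let ?r = "r(vP := irreducible_word n, vQ := q, vT := t, vi := i)"
      have "?r vN = N" using r by (simp add: pars_lookup)
      from run_prime[of ?r, OF this] obtain T' where T': "run w cells [N, k] prime_prog (?r, m) T'
          (\<lambda>s. \<exists>q. s = (?r(vp := least_prime N, vQ := q), m))"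
        by blast
      show "samples w cells [N, k] (prime_prog;; vLen ::= Num 0;; emit \<acute>vP;; emit \<acute>vp;;
          vi ::= Num 0;; ?c1;; vi ::= Num 0;; ?c2) (?r, m)
        (map_pmf encode (algorithm1 N k P (least_prime N))) (\<lambda>_. True)"
        by (rule samples_run_Seq[OF T'], clarify, rule ready_tail) (use r in \<open>simp_all add: ready_def\<close>)
    qed
  qed
qed

end

section \<open>Algorithm 2\<close>

lemma xor_less_power: "a < 2 ^ e \<Longrightarrow> b < 2 ^ e \<Longrightarrow> xor a b < (2::nat) ^ e"
  unfolding less_power_2_iff_bits by (simp add: bit_xor_iff)

lemma word_poly_1 [simp]: "word_poly 1 = 1"
  by (rule poly_eqI) (auto simp: bit_1_iff simp del: One_nat_def)

text \<open>Appending a bit to a word multiplies its polynomial by the indeterminate and adds the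
  bit; this is one step of shift-and-add multiplication.\<close>

lemma word_poly_double:
  "word_poly (2 * v + of_bool b) = word_poly v * monom 1 1 + of_bool b"
proof (rule poly_eqI)
  fix i
  show "coeff (word_poly (2 * v + of_bool b)) i = coeff (word_poly v * monom 1 1 + of_bool b) i"
    by (cases b; cases i) (simp_all add: bit_Suc bit_0 coeff_monom_mult mult.commute[of "word_poly v"])
qed

lemma length_concat_pairs [simp]: "length (concat (map (\<lambda>(a, b). [a, b]) ps)) = 2 * length ps"
  by (induction ps) auto

lemma nth_concat_pairs:
  "l < length ps \<Longrightarrow> concat (map (\<lambda>(a, b). [a, b]) ps) ! (2 * l) = fst (ps ! l)"
  "l < length ps \<Longrightarrow> concat (map (\<lambda>(a, b). [a, b]) ps) ! Suc (2 * l) = snd (ps ! l)"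
  by (induction ps arbitrary: l) (auto simp: nth_Cons split: nat.splits)

text \<open>Index arithmetic for a table with rows of equal length that is stored row by row; it
  locates \<open>Fs ! j ! i\<close> in the flattened input.\<close>

lemma concat_uniform:
  assumes "\<And>xs. xs \<in> set xss \<Longrightarrow> length xs = K"
  shows "length (concat xss) = length xss * K"
    and "j < length xss \<Longrightarrow> i < K \<Longrightarrow> concat xss ! (j * K + i) = xss ! j ! i"
  using assms
proof (induction xss arbitrary: j)
  case (Cons xs xss)
  {
    case 1
    then show ?case using Cons.IH(1) by simp
  next
    case 2
    then show ?case using Cons.IH(2)[of "j - 1"] by (cases j) (auto simp: nth_append)
  }
qed simp_all

text \<open>Connects the bit strings of the specification with the words of the program.\<close>

lemma Poly_bin:
  assumes "x < 2 ^ l"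
  shows "Poly (map of_bool (bin l x)) = word_poly x"
proof (rule poly_eqI)
  fix i
  have "\<not> bit x i" if "l \<le> i" using assms that unfolding less_power_2_iff_bits by blast
  then show "coeff (Poly (map of_bool (bin l x))) i = coeff (word_poly x) i"
    by (cases "i < l") (auto simp: coeff_Poly_eq nth_default_def bin_def)
qed

lemma bin_val_bits: "bin_val (map (bit y) [0..<l]) = y mod 2 ^ l"
proof -
  have "bit (bin_val (map (bit y) [0..<l])) i = bit (take_bit l y) i" for i
    by (auto simp: bin_val_def bit_horner_sum_bit_iff bit_take_bit_iff)
  then show ?thesis by (intro bit_eqI) (simp flip: take_bit_eq_mod)
qed

context word_ram
begin

definition PW where "PW = irreducible_word n"

lemma PW: "2 ^ n \<le> PW" "PW < 2 ^ Suc n" "word_poly PW = P" "PW = poly_word P"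
  using irreducible_word[OF n_bounds(1)] P_props(3) by (simp_all add: PW_def P_def)

lemma fits_PW [simp]: "fits (Suc i) PW"
proof -
  have "PW \<le> 2 ^ n * 2" using PW(2) by simp
  then show ?thesis by (rule fits_le) auto
qed

lemma word_poly_mod_P: "y < 2 ^ n \<Longrightarrow> word_poly y mod P = word_poly y"
  unfolding word_poly_degree_less using P_props by (auto simp: mod_poly_less)

definition loaded :: "nat \<Rightarrow> (var \<Rightarrow> nat) \<Rightarrow> bool" where
  "loaded x r \<longleftrightarrow> pars r \<and> r vX = x \<and> r vP = PW \<and> r vp = least_prime N"

lemma loaded_upd [simp]:
  "y \<notin> {vN, vK, vU, vD, vn, vKappa, vD2, vR, vD3, vX, vP, vp} \<Longrightarrow> loaded x (r(y := v)) = loaded x r"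
  by (cases y) (simp_all add: loaded_def)

lemma loaded_lookup:
  assumes "loaded x r"
  shows "r vn = n" "r vD = d" "r vKappa = \<kappa>" "r vD2 = d2" "r vD3 = d3" "r vX = x" "r vP = PW"
    "r vp = least_prime N"
  using assms by (auto simp: loaded_def pars_def)

lemma run_multiply:
  assumes r: "loaded x r" "r vY = Y" "r vZ = 0" "r vl = n" and "x < N" "Y < 2 ^ n"
  shows "run w S inp (While (Num 0 [<] \<acute>vl)
          (vl ::= \<acute>vl [-] Num 1;;
           vZ ::= \<acute>vZ [<<] Num 1;;
           When (Num 1 [<<] \<acute>vn [<=] \<acute>vZ) (vZ ::= \<acute>vZ [xor] \<acute>vP);;
           When (\<acute>vX [>>] \<acute>vl [mod] Num 2) (vZ ::= \<acute>vZ [xor] \<acute>vY))) (r, m) (n * 50 + 10)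
     (\<lambda>s. \<exists>z. s = (r(vZ := z, vl := 0), m) \<and> z < 2 ^ n \<and>
        word_poly z mod P = word_poly x * word_poly Y mod P)"
proof -
  have x: "x < 2 ^ n"
  proof -
    have "(2::nat) ^ u \<le> 2 ^ n" using n_bounds(3) by (intro power_increasing) auto
    then show ?thesis using u_par_props(3)[OF N, folded u_def] assms(5) by linarith
  qed
  have YB: "Y \<le> B" and xB: "x \<le> B" using assms(5,6) le_B(1,5) by linarith+
  \<comment> \<open>The bits of \<open>x\<close> are consumed from the top, and
    \<open>x div 2 ^ (n - j)\<close> is the part read so far. It is 0 at the start because
    \<open>x < N \<le> 2 ^ u \<le> 2 ^ n\<close>.\<close>
  define I where "I j s \<longleftrightarrow> (\<exists>z. s = (r(vZ := z, vl := n - j), m) \<and> z < 2 ^ n \<and>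
    word_poly z mod P = word_poly (x div 2 ^ (n - j)) * word_poly Y mod P)" for j and s :: "var state"
  show ?thesis
  proof (rule run_mono, rule run_for_loop[where I = I and K = n])
    show "I 0 (r, m)"
      unfolding I_def using r x by (intro exI[of _ 0]) auto
  next
    fix j s assume "I j s" "j < n"
    moreover have "n - j \<le> B" using le_B(8) by linarith
    ultimately show "\<exists>v. eval w S inp s (Num 0 [<] \<acute>vl) = Some v \<and> v \<noteq> 0"
      by (auto simp: I_def)
  next
    fix s assume "I n s"
    then show "eval w S inp s (Num 0 [<] \<acute>vl) = Some 0"
      by (auto simp: I_def)
  next
    fix j s assume "I j s" and j: "j < n"
    define i where "i = n - Suc j"
    have i: "n - j = Suc i" "n - Suc j = i" "i \<le> B" "Suc i \<le> B"
      unfolding i_def using j le_B(8) by linarith+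
    obtain z where s: "s = (r(vZ := z, vl := Suc i), m)" and z: "z < 2 ^ n"
      "word_poly z mod P = word_poly (x div 2 ^ Suc i) * word_poly Y mod P"
      using \<open>I j s\<close> unfolding I_def i by blast
    have zB: "z \<le> B" using z(1) le_B(5) by linarith
    \<comment> \<open>Doubling yields degree at most \<open>n\<close>, so subtracting the modulus
      once reduces the result again.\<close>
    define z1 where "z1 = (if 2 ^ n \<le> z * 2 then xor (z * 2) PW else z * 2)"
    define z2 where "z2 = (if bit x i then xor z1 Y else z1)"
    have z1: "z1 < 2 ^ n"
      unfolding z1_def using z(1) xor_leading(1)[of "z * 2" n PW] PW by (auto simp: not_le)
    have z1B: "z1 \<le> B" using z1 le_B(5) by linarith
    have z2: "z2 < 2 ^ n"
      unfolding z2_def using z1 assms(6) by (auto intro: xor_less_power)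
    have "word_poly z2 mod P = word_poly (x div 2 ^ i) * word_poly Y mod P"
    proof -
      have "word_poly (z * 2) = word_poly z * monom 1 1" using word_poly_shift[of z 1] by simp
      then have "word_poly z1 mod P = word_poly z * monom 1 1 mod P"
        by (simp add: z1_def word_poly_xor PW)
      also have "\<dots> = word_poly (x div 2 ^ Suc i) * word_poly Y * monom 1 1 mod P"
        using z(2) by (rule mod_mult_cong) simp
      finally have "word_poly z2 mod P =
          (word_poly (x div 2 ^ Suc i) * word_poly Y * monom 1 1 + of_bool (bit x i) * word_poly Y) mod P"
        by (auto simp: z2_def word_poly_xor intro: mod_add_cong)
      also have "word_poly (x div 2 ^ Suc i) * word_poly Y * monom 1 1 + of_bool (bit x i) * word_poly Y =
          word_poly (2 * (x div 2 ^ Suc i) + of_bool (bit x i)) * word_poly Y"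
        unfolding word_poly_double by (simp add: algebra_simps)
      also have "2 * (x div 2 ^ Suc i) + of_bool (bit x i) = x div 2 ^ i"
        by (simp add: bit_iff_odd div_mult2_eq mult.commute[of 2 "_ ^ _"] flip: mod_2_eq_odd)
      finally show ?thesis .
    qed
    with z2 have final: "I (Suc j) (r(vZ := z2, vl := i), m)"
      unfolding I_def i by blast
    have w1: "run w S inp (When (Num 1 [<<] \<acute>vn [<=] \<acute>vZ) (vZ ::= \<acute>vZ [xor] \<acute>vP)) (r(vZ := z * 2, vl := i), m)
        (cost (\<acute>vZ [xor] \<acute>vP :: var exp) + 1 + cost (Num 1 [<<] \<acute>vn [<=] \<acute>vZ :: var exp) + 1)
        (\<lambda>s. s = (r(vZ := z1, vl := i), m))"
    proof (rule run_When)
      show "eval w S inp (r(vZ := z * 2, vl := i), m) (Num 1 [<<] \<acute>vn [<=] \<acute>vZ) = Some (of_bool (2 ^ n \<le> z * 2))"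
        using r(1) zB by (simp add: loaded_lookup)
      show "run w S inp (vZ ::= \<acute>vZ [xor] \<acute>vP) (r(vZ := z * 2, vl := i), m) (cost (\<acute>vZ [xor] \<acute>vP :: var exp) + 1)
          (\<lambda>s. s = (r(vZ := z1, vl := i), m))" if "of_bool (2 ^ n \<le> z * 2) \<noteq> (0::nat)"
        by (rule run_Assign[where v = z1])
          (use r(1) zB that in \<open>auto simp: loaded_lookup z1_def fun_eq_iff split: if_splits\<close>)
    qed (auto simp: z1_def)
    have w2: "run w S inp (When (\<acute>vX [>>] \<acute>vl [mod] Num 2) (vZ ::= \<acute>vZ [xor] \<acute>vY)) (r(vZ := z1, vl := i), m)
        (cost (\<acute>vZ [xor] \<acute>vY :: var exp) + 1 + cost (\<acute>vX [>>] \<acute>vl [mod] Num 2 :: var exp) + 1)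
        (\<lambda>s. s = (r(vZ := z2, vl := i), m))"
    proof (rule run_When)
      show "eval w S inp (r(vZ := z1, vl := i), m) (\<acute>vX [>>] \<acute>vl [mod] Num 2) = Some (of_bool (bit x i))"
        using r(1) z1B i xB by (simp add: loaded_lookup bit_iff_odd mod_2_eq_odd)
      show "run w S inp (vZ ::= \<acute>vZ [xor] \<acute>vY) (r(vZ := z1, vl := i), m) (cost (\<acute>vZ [xor] \<acute>vY :: var exp) + 1)
          (\<lambda>s. s = (r(vZ := z2, vl := i), m))" if "of_bool (bit x i) \<noteq> (0::nat)"
        by (rule run_Assign[where v = z2])
          (use r(1,2) z1B YB that in \<open>auto simp: loaded_lookup z2_def fun_eq_iff split: if_splits\<close>)
    qed (auto simp: z2_def)
    show "run w S inp (vl ::= \<acute>vl [-] Num 1;;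
           vZ ::= \<acute>vZ [<<] Num 1;;
           When (Num 1 [<<] \<acute>vn [<=] \<acute>vZ) (vZ ::= \<acute>vZ [xor] \<acute>vP);;
           When (\<acute>vX [>>] \<acute>vl [mod] Num 2) (vZ ::= \<acute>vZ [xor] \<acute>vY)) s (4 + (4 + (10 + 10))) (I (Suc j))"
      unfolding s
    proof (rule run_le, rule run_Seq, rule run_Assign[where v = i])
      show "eval w S inp (r(vZ := z, vl := Suc i), m) (\<acute>vl [-] Num 1) = Some i" using i by simp
      show "run w S inp (vZ ::= \<acute>vZ [<<] Num 1;;
           When (Num 1 [<<] \<acute>vn [<=] \<acute>vZ) (vZ ::= \<acute>vZ [xor] \<acute>vP);;
           When (\<acute>vX [>>] \<acute>vl [mod] Num 2) (vZ ::= \<acute>vZ [xor] \<acute>vY)) ((r(vZ := z, vl := Suc i))(vl := i), m)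
         (cost (\<acute>vZ [<<] Num 1 :: var exp) + 1 + (cost (\<acute>vZ [xor] \<acute>vP :: var exp) + 1 + cost (Num 1 [<<] \<acute>vn [<=] \<acute>vZ :: var exp) + 1 +
           (cost (\<acute>vZ [xor] \<acute>vY :: var exp) + 1 + cost (\<acute>vX [>>] \<acute>vl [mod] Num 2 :: var exp) + 1))) (I (Suc j))"
      proof (rule run_Seq, rule run_Assign[where v = "z * 2"])
        show "eval w S inp ((r(vZ := z, vl := Suc i))(vl := i), m) (\<acute>vZ [<<] Num 1) = Some (z * 2)"
          using zB by simp
        have "(r(vZ := z, vl := Suc i))(vl := i, vZ := z * 2) = r(vZ := z * 2, vl := i)" by auto
        then show "run w S inp (When (Num 1 [<<] \<acute>vn [<=] \<acute>vZ) (vZ ::= \<acute>vZ [xor] \<acute>vP);;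
           When (\<acute>vX [>>] \<acute>vl [mod] Num 2) (vZ ::= \<acute>vZ [xor] \<acute>vY)) ((r(vZ := z, vl := Suc i))(vl := i, vZ := z * 2), m)
         (cost (\<acute>vZ [xor] \<acute>vP :: var exp) + 1 + cost (Num 1 [<<] \<acute>vn [<=] \<acute>vZ :: var exp) + 1 +
           (cost (\<acute>vZ [xor] \<acute>vY :: var exp) + 1 + cost (\<acute>vX [>>] \<acute>vl [mod] Num 2 :: var exp) + 1)) (I (Suc j))"
          using run_mono[OF w1 order.refl, of "\<lambda>s. run w S inp (When (\<acute>vX [>>] \<acute>vl [mod] Num 2) (vZ ::= \<acute>vZ [xor] \<acute>vY)) s
            (cost (\<acute>vZ [xor] \<acute>vY :: var exp) + 1 + cost (\<acute>vX [>>] \<acute>vl [mod] Num 2 :: var exp) + 1) (I (Suc j))"]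
            run_mono[OF w2 order.refl, of "I (Suc j)"] final
          by (intro run_Seq) simp
      qed
    qed simp
  next
    fix s assume "I n s"
    then show "\<exists>z. s = (r(vZ := z, vl := 0), m) \<and> z < 2 ^ n \<and>
        word_poly z mod P = word_poly x * word_poly Y mod P"
      by (simp add: I_def)
  qed simp
qed

end

text \<open>Horner's rule, stated for the sums over the last \<open>j\<close> coefficients because
  the program runs through them from the highest index down.\<close>

lemma horner_step:
  fixes X :: "'a :: comm_semiring_1"
  assumes "j < K"
  shows "(\<Sum>l<Suc j. cs ! (K - Suc j + l) * X ^ l) = cs ! (K - Suc j) + X * (\<Sum>l<j. cs ! (K - j + l) * X ^ l)"
proof -
  have "K - Suc j + Suc l = K - j + l" for l using assms by simp
  then show ?thesis
    unfolding sum.lessThan_Suc_shift by (simp add: sum_distrib_left mult_ac del: add_Suc_right)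
qed

context word_ram
begin

lemma run_horner:
  assumes r: "loaded x r" "r vY = 0" "r vi = \<kappa>" and x: "x < N"
    and cs: "\<And>i. i < \<kappa> \<Longrightarrow> 5 + i < length inp \<and> inp ! (5 + i) = poly_word (cs ! i) \<and> degree (cs ! i) < n"
  shows "run w S inp (While (Num 0 [<] \<acute>vi)
       (vi ::= \<acute>vi [-] Num 1;;
        vZ ::= Num 0;;
        vl ::= \<acute>vn;;
        While (Num 0 [<] \<acute>vl)
          (vl ::= \<acute>vl [-] Num 1;;
           vZ ::= \<acute>vZ [<<] Num 1;;
           When (Num 1 [<<] \<acute>vn [<=] \<acute>vZ) (vZ ::= \<acute>vZ [xor] \<acute>vP);;
           When (\<acute>vX [>>] \<acute>vl [mod] Num 2) (vZ ::= \<acute>vZ [xor] \<acute>vY));;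
        vY ::= \<acute>vZ [xor] Inp (Num 5 [+] \<acute>vi))) (r, m) (\<kappa> * (n * 50 + 50) + 10)
     (\<lambda>s. \<exists>r. s = (r, m) \<and> loaded x r \<and> r vY < 2 ^ n \<and>
        word_poly (r vY) = (\<Sum>l<\<kappa>. cs ! l * word_poly x ^ l) mod P)"
proof -
  let ?X = "word_poly x"
  \<comment> \<open>The polynomial formed by the last \<open>j\<close> coefficients; for
    \<open>j = \<kappa>\<close> it is the whole polynomial.\<close>
  define hp where "hp j = (\<Sum>l<j. cs ! (\<kappa> - j + l) * ?X ^ l)" for j
  define I where "I j s \<longleftrightarrow> (\<exists>r. s = (r, m) \<and> loaded x r \<and> r vi = \<kappa> - j \<and> r vY < 2 ^ n \<and>
    word_poly (r vY) mod P = hp j mod P)" for j and s :: "var state"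
  let ?w = "While (Num 0 [<] \<acute>vl)
          (vl ::= \<acute>vl [-] Num 1;;
           vZ ::= \<acute>vZ [<<] Num 1;;
           When (Num 1 [<<] \<acute>vn [<=] \<acute>vZ) (vZ ::= \<acute>vZ [xor] \<acute>vP);;
           When (\<acute>vX [>>] \<acute>vl [mod] Num 2) (vZ ::= \<acute>vZ [xor] \<acute>vY))"
  show ?thesis
  proof (rule run_mono, rule run_for_loop[where I = I and K = \<kappa>])
    show "I 0 (r, m)"
      unfolding I_def using r by (intro exI[of _ r]) (auto simp: hp_def)
  next
    fix j s assume "I j s" "j < \<kappa>"
    moreover have "\<kappa> - j \<le> B" using le_B(9) by linarith
    ultimately show "\<exists>v. eval w S inp s (Num 0 [<] \<acute>vi) = Some v \<and> v \<noteq> 0"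
      by (auto simp: I_def)
  next
    fix s assume "I \<kappa> s"
    then show "eval w S inp s (Num 0 [<] \<acute>vi) = Some 0"
      by (auto simp: I_def)
  next
    fix j s assume "I j s" and j: "j < \<kappa>"
    define i where "i = \<kappa> - Suc j"
    have i: "\<kappa> - j = Suc i" "\<kappa> - Suc j = i" "i \<le> B" "Suc i \<le> B" "i < \<kappa>"
      unfolding i_def using j le_B(9) by linarith+
    obtain r where s: "s = (r, m)" and r: "loaded x r" "r vi = Suc i" and Y: "r vY < 2 ^ n"
      "word_poly (r vY) mod P = hp j mod P"
      using \<open>I j s\<close> unfolding I_def i by blast
    define c where "c = poly_word (cs ! i)"
    have c: "c < 2 ^ n" "word_poly c = cs ! i" "5 + i < length inp" "inp ! (5 + i) = c"
      using cs[OF i(5)] by (auto simp: c_def word_poly_degree_less)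
    then have "c \<le> B" using le_B(5) by linarith
    define r1 where "r1 = r(vi := i, vZ := 0, vl := n)"
    have "loaded x r1" "r1 vY = r vY" "r1 vZ = 0" "r1 vl = n"
      using r by (simp_all add: r1_def)
    note mult = run_multiply[OF this x Y(1), of S inp m]
    have last: "run w S inp (vY ::= \<acute>vZ [xor] Inp (Num 5 [+] \<acute>vi)) (r1(vZ := z, vl := 0), m)
        (cost (\<acute>vZ [xor] Inp (Num 5 [+] \<acute>vi) :: var exp) + 1) (I (Suc j))"
      if z: "z < 2 ^ n" "word_poly z mod P = ?X * word_poly (r vY) mod P" for z
    proof (rule run_Assign[where v = "xor z c"])
      have "z \<le> B" using z(1) le_B(5) by linarith
      then show "eval w S inp (r1(vZ := z, vl := 0), m) (\<acute>vZ [xor] Inp (Num 5 [+] \<acute>vi)) = Some (xor z c)"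
        using c \<open>c \<le> B\<close> i by (simp add: r1_def)
      have "word_poly (xor z c) mod P = (?X * hp j + cs ! i) mod P"
        unfolding word_poly_xor c(2)
      proof (rule mod_add_cong)
        have "word_poly z mod P = ?X * word_poly (r vY) mod P" by (rule z(2))
        also have "\<dots> = ?X * hp j mod P" using Y(2) by (intro mod_mult_cong) auto
        finally show "word_poly z mod P = ?X * hp j mod P" .
      qed simp
      also have "?X * hp j + cs ! i = hp (Suc j)"
        using horner_step[OF j, of cs ?X] by (simp add: hp_def i(2) add.commute)
      finally show "I (Suc j) ((r1(vZ := z, vl := 0))(vY := xor z c), m)"
        unfolding I_def i using r(1) xor_less_power[OF z(1) c(1)]
        by (intro exI[of _ "(r1(vZ := z, vl := 0))(vY := xor z c)"]) (simp add: r1_def)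
    qed
    show "run w S inp (vi ::= \<acute>vi [-] Num 1;;
        vZ ::= Num 0;;
        vl ::= \<acute>vn;;
        ?w;;
        vY ::= \<acute>vZ [xor] Inp (Num 5 [+] \<acute>vi)) s
      (cost (\<acute>vi [-] Num 1 :: var exp) + 1 + (cost (Num 0 :: var exp) + 1 + (cost (\<acute>vn :: var exp) + 1 +
        ((n * 50 + 10) + (cost (\<acute>vZ [xor] Inp (Num 5 [+] \<acute>vi) :: var exp) + 1))))) (I (Suc j))"
      unfolding s
    proof (rule run_Seq, rule run_Assign[where v = i], (use r i in simp; fail),
        rule run_Seq, rule run_Assign[where v = 0], simp,
        rule run_Seq, rule run_Assign[where v = n], (use r in \<open>simp add: loaded_lookup; fail\<close>))
      show "run w S inp (?w;; vY ::= \<acute>vZ [xor] Inp (Num 5 [+] \<acute>vi)) (r(vi := i, vZ := 0, vl := n), m)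
          (n * 50 + 10 + (cost (\<acute>vZ [xor] Inp (Num 5 [+] \<acute>vi) :: var exp) + 1)) (I (Suc j))"
        unfolding r1_def[symmetric]
        by (rule run_Seq, rule run_mono[OF mult order.refl]) (use last in blast)
    qed
  next
    fix s assume "I \<kappa> s"
    then obtain r where "s = (r, m)" "loaded x r" "r vY < 2 ^ n" "word_poly (r vY) mod P = hp \<kappa> mod P"
      by (auto simp: I_def)
    then show "\<exists>r. s = (r, m) \<and> loaded x r \<and> r vY < 2 ^ n \<and>
        word_poly (r vY) = (\<Sum>l<\<kappa>. cs ! l * ?X ^ l) mod P"
      by (auto simp: word_poly_mod_P hp_def)
  qed (simp add: algebra_simps)
qed

text \<open>The working memory is limited to \<open>d2\<close> cells, one for each output value. The
  offset \<open>5 + \<kappa>\<close> skips \<open>N, k, x\<close>, the modulus, the prime and the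
  coefficients; each function then takes two words. The stored pairs are abstracted to a function
  \<open>ab\<close>.\<close>

lemma run_select:
  assumes r: "loaded x r" "r vj = J" "r vi = 1" "r vLen = 0" and x: "x < N" and J: "J < 2 ^ d"
    and ab: "\<And>l. l < 2 ^ d * d2 \<Longrightarrow> Suc (5 + \<kappa> + 2 * l) < length inp \<and>
      inp ! (5 + \<kappa> + 2 * l) = fst (ab l) \<and> inp ! Suc (5 + \<kappa> + 2 * l) = snd (ab l) \<and>
      fst (ab l) < least_prime N \<and> snd (ab l) < least_prime N"
  shows "run w d2 inp (While (\<acute>vi [<=] \<acute>vD2)
       (vb ::= Num 5 [+] \<acute>vKappa [+] Num 2 [*] (\<acute>vj [*] \<acute>vD2 [+] (\<acute>vi [-] Num 1));;
        vT ::= (Inp \<acute>vb [*] \<acute>vX [+] Inp (\<acute>vb [+] Num 1)) [mod] \<acute>vp [mod] \<acute>vD3;;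
        emit (\<acute>vj [*] \<acute>vD2 [*] \<acute>vD3 [+] (\<acute>vi [-] Num 1) [*] \<acute>vD3 [+] \<acute>vT);;
        vi ::= \<acute>vi [+] Num 1)) (r, m) (d2 * 60 + 10)
     (\<lambda>s. written s = map (\<lambda>i. J * d2 * d3 + i * d3 + lin_hash (least_prime N) d3 (ab (J * d2 + i)) x) [0..<d2])"
proof -
  define out where "out i = J * d2 * d3 + i * d3 + lin_hash (least_prime N) d3 (ab (J * d2 + i)) x" for i
  define I where "I j s \<longleftrightarrow> loaded x (fst s) \<and> fst s vj = J \<and> fst s vi = Suc j \<and> fst s vLen = j \<and>
    written s = map out [0..<j]" for j and s :: "var state"
  have JB: "J \<le> B" and xB: "x \<le> B" using J x le_B(1,4) by linarith+
  have "0 < ln (real k)" using k by simp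
  then have "0 < nat \<lceil>13 * ln (real k)\<rceil>" unfolding zero_less_nat_eq zero_less_ceiling by simp
  then have d3: "d3 \<noteq> 0" unfolding d3_def d3_par_def by simp
  have p: "least_prime N \<noteq> 0" using least_prime_pos by simp
  show ?thesis
  proof (rule run_mono, rule run_for_loop[where I = I and K = d2])
    show "I 0 (r, m)" using r by (simp add: I_def written_def)
  next
    fix j s assume "I j s" "j < d2"
    moreover from this have "Suc j \<le> B" using le_B(10) by linarith
    ultimately show "\<exists>v. eval w d2 inp s (\<acute>vi [<=] \<acute>vD2) = Some v \<and> v \<noteq> 0"
      by (cases s) (auto simp: I_def loaded_lookup)
  next
    fix s assume "I d2 s"
    then show "eval w d2 inp s (\<acute>vi [<=] \<acute>vD2) = Some 0"
      by (cases s) (auto simp: I_def loaded_lookup)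
  next
    fix j s assume "I j s" and j: "j < d2"
    then obtain r m where s: "s = (r, m)" and r: "loaded x r" "r vj = J" "r vi = Suc j" "r vLen = j"
      "written (r, m) = map out [0..<j]"
      by (cases s) (auto simp: I_def)
    have jB: "j \<le> B" "Suc j \<le> B" using j le_B(10) by linarith+
    define l where "l = J * d2 + j"
    have "l < Suc J * d2" using j by (simp add: l_def)
    also have "\<dots> \<le> 2 ^ d * d2" using J by (intro mult_right_mono) auto
    finally have l: "l < 2 ^ d * d2" .
    define bv where "bv = 5 + \<kappa> + 2 * l"
    define a b where "a = fst (ab l)" and "b = snd (ab l)"
    have bv: "bv < length inp" "Suc bv < length inp" "inp ! bv = a" "inp ! Suc bv = b"
      using ab[OF l] by (auto simp: bv_def a_def b_def)
    have "a < least_prime N" "b < least_prime N"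
      using ab[OF l] unfolding a_def b_def by blast+
    then have abB: "a \<le> B" "b \<le> B" using le_B(13) by linarith+
    have fbv: "fits (Suc (Suc (Suc (Suc i)))) bv" for i
      unfolding bv_def l_def by (intro fits_add fits_mult; use JB jB in simp)
    have fbv': "fits (Suc (Suc (Suc (Suc (Suc i))))) bv" for i using fbv by (rule fits_Suc)
    define t where "t = (a * x + b) mod least_prime N mod d3"
    have "t < d3" unfolding t_def using d3 by (intro mod_less_divisor) simp
    then have tB: "t \<le> B" using le_B(12) by linarith
    have out_j: "out j = J * d2 * d3 + j * d3 + t"
      by (simp add: out_def lin_hash_def t_def a_def b_def l_def case_prod_beta)
    have fout: "fits (Suc (Suc (Suc (Suc (Suc 0))))) (out j)"
      unfolding out_j by (intro fits_add fits_mult; use JB jB tB in simp)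
    show "run w d2 inp (vb ::= Num 5 [+] \<acute>vKappa [+] Num 2 [*] (\<acute>vj [*] \<acute>vD2 [+] (\<acute>vi [-] Num 1));;
        vT ::= (Inp \<acute>vb [*] \<acute>vX [+] Inp (\<acute>vb [+] Num 1)) [mod] \<acute>vp [mod] \<acute>vD3;;
        emit (\<acute>vj [*] \<acute>vD2 [*] \<acute>vD3 [+] (\<acute>vi [-] Num 1) [*] \<acute>vD3 [+] \<acute>vT);;
        vi ::= \<acute>vi [+] Num 1) s 52 (I (Suc j))"
      unfolding s
    proof (rule run_le, rule run_Seq, rule run_Assign[where v = bv])
      show "eval w d2 inp (r, m) (Num 5 [+] \<acute>vKappa [+] Num 2 [*] (\<acute>vj [*] \<acute>vD2 [+] (\<acute>vi [-] Num 1))) = Some bv"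
        using r JB jB fbv'[of 0] by (simp add: loaded_lookup bv_def l_def)
      show "run w d2 inp (vT ::= (Inp \<acute>vb [*] \<acute>vX [+] Inp (\<acute>vb [+] Num 1)) [mod] \<acute>vp [mod] \<acute>vD3;;
          emit (\<acute>vj [*] \<acute>vD2 [*] \<acute>vD3 [+] (\<acute>vi [-] Num 1) [*] \<acute>vD3 [+] \<acute>vT);;
          vi ::= \<acute>vi [+] Num 1) (r(vb := bv), m)
        (cost ((Inp \<acute>vb [*] \<acute>vX [+] Inp (\<acute>vb [+] Num 1)) [mod] \<acute>vp [mod] \<acute>vD3 :: var exp) + 1 +
          ((cost (\<acute>vj [*] \<acute>vD2 [*] \<acute>vD3 [+] (\<acute>vi [-] Num 1) [*] \<acute>vD3 [+] \<acute>vT :: var exp) + 6) +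
            (cost (\<acute>vi [+] Num 1 :: var exp) + 1))) (I (Suc j))"
      proof (rule run_Seq, rule run_Assign[where v = t])
        show "eval w d2 inp (r(vb := bv), m) ((Inp \<acute>vb [*] \<acute>vX [+] Inp (\<acute>vb [+] Num 1)) [mod] \<acute>vp [mod] \<acute>vD3) = Some t"
          using r xB bv abB fbv fbv' d3 p by (simp add: loaded_lookup t_def)
        show "run w d2 inp (emit (\<acute>vj [*] \<acute>vD2 [*] \<acute>vD3 [+] (\<acute>vi [-] Num 1) [*] \<acute>vD3 [+] \<acute>vT);;
            vi ::= \<acute>vi [+] Num 1) ((r(vb := bv))(vT := t), m)
          ((cost (\<acute>vj [*] \<acute>vD2 [*] \<acute>vD3 [+] (\<acute>vi [-] Num 1) [*] \<acute>vD3 [+] \<acute>vT :: var exp) + 6) +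
            (cost (\<acute>vi [+] Num 1 :: var exp) + 1)) (I (Suc j))"
        proof (rule run_Seq, rule run_emit[where l = j and v = "out j"])
          show "eval w d2 inp ((r(vb := bv))(vT := t), m)
              (\<acute>vj [*] \<acute>vD2 [*] \<acute>vD3 [+] (\<acute>vi [-] Num 1) [*] \<acute>vD3 [+] \<acute>vT) = Some (out j)"
            using r JB jB tB fout by (simp add: loaded_lookup out_j)
          show "run w d2 inp (vi ::= \<acute>vi [+] Num 1) ((r(vb := bv))(vT := t, vLen := Suc j), m(j := out j))
              (cost (\<acute>vi [+] Num 1 :: var exp) + 1) (I (Suc j))"
            by (rule run_Assign[where v = "Suc (Suc j)"]) (use r jB in \<open>simp_all add: I_def\<close>)
        qed (use r j jB in simp_all)
      qed
    qed simp
  next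
    fix s assume "I d2 s"
    then show "written s =
        map (\<lambda>i. J * d2 * d3 + i * d3 + lin_hash (least_prime N) d3 (ab (J * d2 + i)) x) [0..<d2]"
      by (simp add: I_def out_def[abs_def])
  qed simp
qed

end

section \<open>Resource bounds\<close>

text \<open>The finitely many constructors of \<open>var\<close> bound the number of registers of
  every program, so registers contribute constant space.\<close>

lemma card_regs_le: "card (regs (c :: var com)) \<le> 22"
proof -
  let ?vs = "[vN, vK, vX, vU, vD, vn, vKappa, vD2, vR, vD3, vP, vp, vQ, vT, vY, vZ, vi, vl, vj, vb, vLen]"
  have "x \<in> set ?vs" for x by (cases x) simp_all
  then have "regs c \<subseteq> set ?vs" by blast
  then have "card (regs c) \<le> card (set ?vs)" by (intro card_mono) simp_all
  also have "\<dots> \<le> length ?vs" by (rule card_length)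
  finally show ?thesis by simp
qed

lemma result_of_eq: "result_of = (\<lambda>x. written (fst x))"
  by (auto simp: fun_eq_iff result_of_def written_def)

context word_ram
begin

text \<open>What Algorithm 2 may assume about its input: the lengths locate the entries, and the
  bounds on degrees and pairs keep the stored words small.\<close>

lemma set_algorithm1:
  assumes "F \<in> set_pmf (algorithm1 N k P (least_prime N))"
  obtains cs Fs where "F = (P, cs, least_prime N, Fs)" "length cs = \<kappa>" "\<And>c. c \<in> set cs \<Longrightarrow> degree c < n"
    "length Fs = 2 ^ d" "\<And>fs. fs \<in> set Fs \<Longrightarrow> length fs = d2"
    "\<And>fs f. fs \<in> set Fs \<Longrightarrow> f \<in> set fs \<Longrightarrow> fst f < least_prime N \<and> snd f < least_prime N"
proof -
  have ne: "{1..<least_prime N} \<times> {0..<least_prime N} \<noteq> {}" using least_prime_pos by auto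
  obtain cs Fs where F: "F = (P, cs, least_prime N, Fs)"
    and cs: "cs \<in> set_pmf (replicate_pmf \<kappa> (pmf_of_set {c. degree c < n}))"
    and Fs: "Fs \<in> set_pmf (replicate_pmf (2 ^ d) (replicate_pmf d2
      (pmf_of_set ({1..<least_prime N} \<times> {0..<least_prime N}))))"
    using assms unfolding algorithm1_def coefficient_lists d_def d2_def by auto
  show ?thesis
  proof (rule that[OF F])
    show "length cs = \<kappa>" "\<And>c. c \<in> set cs \<Longrightarrow> degree c < n"
      using cs small_polys by (auto simp: set_replicate_pmf)
    show "length Fs = 2 ^ d" "\<And>fs. fs \<in> set Fs \<Longrightarrow> length fs = d2"
      using Fs by (auto simp: set_replicate_pmf)
    show "fst f < least_prime N \<and> snd f < least_prime N" if "fs \<in> set Fs" "f \<in> set fs" for fs f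
    proof -
      have "f \<in> {1..<least_prime N} \<times> {0..<least_prime N}"
        using Fs that ne by (fastforce simp: set_replicate_pmf in_lists_conv_set)
      then show ?thesis by auto
    qed
  qed
qed

lemma run_algorithm2:
  assumes F: "F \<in> set_pmf (algorithm1 N k P (least_prime N))" and x: "x < N"
  shows "run w d2 ([N, k, x] @ encode F) algorithm2_prog (\<lambda>_. 0, \<lambda>_. 0)
    (u * 10 + d * 15 + \<kappa> * (n * 50 + 50) + d2 * 60 + 200) (\<lambda>s. set (written s) = algorithm2 N k F x)"
proof -
  let ?p = "least_prime N"
  obtain cs Fs where F: "F = (P, cs, ?p, Fs)" and cs: "length cs = \<kappa>" "\<And>c. c \<in> set cs \<Longrightarrow> degree c < n"
    and Fs: "length Fs = 2 ^ d" "\<And>fs. fs \<in> set Fs \<Longrightarrow> length fs = d2"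
    "\<And>fs f. fs \<in> set Fs \<Longrightarrow> f \<in> set fs \<Longrightarrow> fst f < ?p \<and> snd f < ?p"
    using set_algorithm1[OF F] by blast
  define ps where "ps = concat Fs"
  have len: "length ps = 2 ^ d * d2"
    unfolding ps_def Fs(1)[symmetric] using Fs(2) by (rule concat_uniform(1))
  define inp where "inp = [N, k, x] @ encode F"
  have inp: "inp = [N, k, x, PW, ?p] @ map poly_word cs @ concat (map (\<lambda>(a, b). [a, b]) ps)"
    by (simp add: inp_def encode_def F PW(4) ps_def)
  have inp_cs: "5 + i < length inp \<and> inp ! (5 + i) = poly_word (cs ! i) \<and> degree (cs ! i) < n" if "i < \<kappa>" for i
    using that cs by (auto simp: inp nth_append)
  have inp_ps: "Suc (5 + \<kappa> + 2 * l) < length inp \<and>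
      inp ! (5 + \<kappa> + 2 * l) = fst (ps ! l) \<and> inp ! Suc (5 + \<kappa> + 2 * l) = snd (ps ! l) \<and>
      fst (ps ! l) < ?p \<and> snd (ps ! l) < ?p" if "l < 2 ^ d * d2" for l
  proof -
    have l: "l < length ps" using that len by simp
    have "ps ! l \<in> set ps" using l by (rule nth_mem)
    then obtain fs where "fs \<in> set Fs" "ps ! l \<in> set fs" by (auto simp: ps_def)
    then have "fst (ps ! l) < ?p \<and> snd (ps ! l) < ?p" by (rule Fs(3))
    moreover have drop: "inp ! (5 + \<kappa> + i) = concat (map (\<lambda>(a, b). [a, b]) ps) ! i" for i
      using cs(1) by (simp add: inp nth_append)
    have "inp ! (5 + \<kappa> + 2 * l) = fst (ps ! l)" "inp ! (5 + \<kappa> + Suc (2 * l)) = snd (ps ! l)"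
      unfolding drop using nth_concat_pairs[OF l] by auto
    ultimately show ?thesis using l cs(1) by (simp add: inp)
  qed
  have inp_head: "inp = N # k # x # PW # ?p # map poly_word cs @ concat (map (\<lambda>(a, b). [a, b]) ps)"
    by (simp add: inp)
  have inp_nth: "inp ! 2 = x" "inp ! 3 = PW" "inp ! 4 = ?p" "2 < length inp" "3 < length inp" "4 < length inp"
    by (simp_all add: inp_head)
  have xB: "x \<le> B" using x le_B(1) by linarith
  define out where "out J = (\<lambda>i. J * d2 * d3 + i * d3 + lin_hash ?p d3 (ps ! (J * d2 + i)) x)" for J
  let ?h = "While (Num 0 [<] \<acute>vi)
       (vi ::= \<acute>vi [-] Num 1;;
        vZ ::= Num 0;;
        vl ::= \<acute>vn;;
        While (Num 0 [<] \<acute>vl)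
          (vl ::= \<acute>vl [-] Num 1;;
           vZ ::= \<acute>vZ [<<] Num 1;;
           When (Num 1 [<<] \<acute>vn [<=] \<acute>vZ) (vZ ::= \<acute>vZ [xor] \<acute>vP);;
           When (\<acute>vX [>>] \<acute>vl [mod] Num 2) (vZ ::= \<acute>vZ [xor] \<acute>vY));;
        vY ::= \<acute>vZ [xor] Inp (Num 5 [+] \<acute>vi))"
  let ?s = "While (\<acute>vi [<=] \<acute>vD2)
       (vb ::= Num 5 [+] \<acute>vKappa [+] Num 2 [*] (\<acute>vj [*] \<acute>vD2 [+] (\<acute>vi [-] Num 1));;
        vT ::= (Inp \<acute>vb [*] \<acute>vX [+] Inp (\<acute>vb [+] Num 1)) [mod] \<acute>vp [mod] \<acute>vD3;;
        emit (\<acute>vj [*] \<acute>vD2 [*] \<acute>vD3 [+] (\<acute>vi [-] Num 1) [*] \<acute>vD3 [+] \<acute>vT);;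
        vi ::= \<acute>vi [+] Num 1)"
  \<comment> \<open>The bridge to the specification: the register value \<open>Y\<close> represents
    the evaluated polynomial, and truncating it to \<open>d\<close> bits is reduction modulo
    \<open>2 ^ d\<close>.\<close>
  have result: "set (map (out (Y mod 2 ^ d)) [0..<d2]) = algorithm2 N k F x"
    if Y: "word_poly Y = (\<Sum>l<\<kappa>. cs ! l * word_poly x ^ l) mod P" for Y
  proof -
    define J where "J = Y mod 2 ^ d"
    have "x < 2 ^ u_par N" using x u_par_props(3)[OF N] by linarith
    then have "bin_val (poly_hash P (d_par k) cs (bin (u_par N) x)) = J"
      by (simp add: poly_hash_def Poly_bin cs(1) bin_val_bits J_def d_def flip: Y)
    then have "algorithm2 N k F x =
        (\<lambda>i. J * d2 * d3 + (i - 1) * d3 + lin_hash ?p d3 (Fs ! J ! (i - 1)) x) ` {1..d2}"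
      unfolding algorithm2_def F Setcompr_eq_image by (simp add: Let_def d2_def d3_def)
    also have "\<dots> = (\<lambda>i. out J (i - 1)) ` {1..d2}"
    proof (rule image_cong[OF refl])
      fix i assume "i \<in> {1..d2}"
      moreover have "J < length Fs" using Fs(1) by (simp add: J_def)
      ultimately have "ps ! (J * d2 + (i - 1)) = Fs ! J ! (i - 1)"
        unfolding ps_def by (intro concat_uniform(2) Fs(2)) auto
      then show "J * d2 * d3 + (i - 1) * d3 + lin_hash ?p d3 (Fs ! J ! (i - 1)) x = out J (i - 1)"
        by (simp add: out_def)
    qed
    \<comment> \<open>The specification counts the functions from 1, the output list from 0.\<close>
    also have "{1..d2} = Suc ` {0..<d2}" by (simp add: atLeastLessThanSuc_atLeastAtMost)
    also have "(\<lambda>i. out J (i - 1)) ` Suc ` {0..<d2} = set (map (out J) [0..<d2])"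
      unfolding image_image by simp
    finally show ?thesis by (simp add: J_def)
  qed
  have select: "run w d2 inp (vj ::= \<acute>vY [mod] (Num 1 [<<] \<acute>vD);; vLen ::= Num 0;; vi ::= Num 1;; ?s) (r, m)
      (cost (\<acute>vY [mod] (Num 1 [<<] \<acute>vD) :: var exp) + 1 + (cost (Num 0 :: var exp) + 1 +
        (cost (Num 1 :: var exp) + 1 + (d2 * 60 + 10)))) (\<lambda>s. set (written s) = algorithm2 N k F x)"
    if r: "loaded x r" "r vY < 2 ^ n" "word_poly (r vY) = (\<Sum>l<\<kappa>. cs ! l * word_poly x ^ l) mod P" for r m
  proof -
    have YB: "r vY \<le> B" using r(2) le_B(5) by linarith
    show ?thesis
    proof (rule run_Seq, rule run_Assign[where v = "r vY mod 2 ^ d"], (use r YB in \<open>simp add: loaded_lookup; fail\<close>),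
        rule run_Seq, rule run_Assign[where v = 0], simp,
        rule run_Seq, rule run_Assign[where v = 1], simp)
      let ?r = "r(vj := r vY mod 2 ^ d, vLen := 0, vi := 1)"
      have r': "loaded x ?r" "?r vj = r vY mod 2 ^ d" "?r vi = 1" "?r vLen = 0" "r vY mod 2 ^ d < 2 ^ d"
        using r(1) by simp_all
      show "run w d2 inp ?s (?r, m) (d2 * 60 + 10) (\<lambda>s. set (written s) = algorithm2 N k F x)"
        by (rule run_mono[OF run_select[OF r'(1-4) x r'(5) inp_ps] order.refl])
          (use result[OF r(3)] in \<open>simp_all add: out_def\<close>)
    qed
  qed
  show ?thesis
    unfolding inp_def[symmetric] algorithm2_prog_def
  proof (rule run_le, rule run_Seq)
    have params: "run w d2 inp params_prog (\<lambda>_. 0, \<lambda>_. 0) (u * 10 + d * 15 + 70) (\<lambda>(r', m'). pars r' \<and> m' = (\<lambda>_. 0))"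
      unfolding inp_head by (rule run_params)
    show "run w d2 inp params_prog (\<lambda>_. 0, \<lambda>_. 0) (u * 10 + d * 15 + 70)
      (\<lambda>s. run w d2 inp (vX ::= Inp (Num 2);; vP ::= Inp (Num 3);; vp ::= Inp (Num 4);; vY ::= Num 0;;
          vi ::= \<acute>vKappa;; ?h;; vj ::= \<acute>vY [mod] (Num 1 [<<] \<acute>vD);; vLen ::= Num 0;; vi ::= Num 1;; ?s) s
        (cost (Inp (Num 2) :: var exp) + 1 + (cost (Inp (Num 3) :: var exp) + 1 +
          (cost (Inp (Num 4) :: var exp) + 1 + (cost (Num 0 :: var exp) + 1 + (cost (\<acute>vKappa :: var exp) + 1 +
          (\<kappa> * (n * 50 + 50) + 10 +
        (cost (\<acute>vY [mod] (Num 1 [<<] \<acute>vD) :: var exp) + 1 + (cost (Num 0 :: var exp) + 1 +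
        (cost (Num 1 :: var exp) + 1 + (d2 * 60 + 10)))))))))) (\<lambda>s. set (written s) = algorithm2 N k F x))"
    proof (rule run_mono[OF params order.refl], clarify)
      fix r assume r: "pars r"
      let ?r = "r(vX := x, vP := PW, vp := ?p, vY := 0, vi := \<kappa>)"
      have r': "loaded x ?r" "?r vY = 0" "?r vi = \<kappa>" using r by (simp_all add: loaded_def)
      show "run w d2 inp (vX ::= Inp (Num 2);; vP ::= Inp (Num 3);; vp ::= Inp (Num 4);; vY ::= Num 0;;
          vi ::= \<acute>vKappa;; ?h;; vj ::= \<acute>vY [mod] (Num 1 [<<] \<acute>vD);; vLen ::= Num 0;; vi ::= Num 1;; ?s) (r, \<lambda>_. 0)
        (cost (Inp (Num 2) :: var exp) + 1 + (cost (Inp (Num 3) :: var exp) + 1 +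
          (cost (Inp (Num 4) :: var exp) + 1 + (cost (Num 0 :: var exp) + 1 + (cost (\<acute>vKappa :: var exp) + 1 +
          (\<kappa> * (n * 50 + 50) + 10 +
        (cost (\<acute>vY [mod] (Num 1 [<<] \<acute>vD) :: var exp) + 1 + (cost (Num 0 :: var exp) + 1 +
        (cost (Num 1 :: var exp) + 1 + (d2 * 60 + 10)))))))))) (\<lambda>s. set (written s) = algorithm2 N k F x)"
      proof (rule run_Seq, rule run_Assign[where v = x], (use inp_nth xB in simp; fail),
          rule run_Seq, rule run_Assign[where v = PW], (use inp_nth in simp; fail),
          rule run_Seq, rule run_Assign[where v = ?p], (use inp_nth in simp; fail),
          rule run_Seq, rule run_Assign[where v = 0], simp,
          rule run_Seq, rule run_Assign[where v = \<kappa>], (use r in \<open>simp add: pars_lookup; fail\<close>))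
        show "run w d2 inp (?h;; vj ::= \<acute>vY [mod] (Num 1 [<<] \<acute>vD);; vLen ::= Num 0;; vi ::= Num 1;; ?s) (?r, \<lambda>_. 0)
            (\<kappa> * (n * 50 + 50) + 10 +
        (cost (\<acute>vY [mod] (Num 1 [<<] \<acute>vD) :: var exp) + 1 + (cost (Num 0 :: var exp) + 1 +
        (cost (Num 1 :: var exp) + 1 + (d2 * 60 + 10))))) (\<lambda>s. set (written s) = algorithm2 N k F x)"
          by (rule run_Seq, rule run_mono[OF run_horner[OF r' x inp_cs] order.refl]) (use select in blast)+
      qed
    qed
  qed simp
qed

lemma real_bounds:
  "1 \<le> log 2 (real k)" "1 \<le> log 2 (real N)" "log 2 (real k) \<le> log 2 (real N)" "ln (real k) \<le> log 2 (real k)"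
proof -
  show k1: "1 \<le> log 2 (real k)" using k by (simp add: le_log_iff)
  show k_N: "log 2 (real k) \<le> log 2 (real N)" using k by simp
  then show "1 \<le> log 2 (real N)" using k1 by linarith
  have "ln (2::real) \<le> 1" using ln_le_minus_one[of 2] by simp
  moreover have "0 \<le> ln (real k)" using k by simp
  ultimately have "ln (real k) * ln 2 \<le> ln (real k) * 1" by (intro mult_left_mono)
  then show "ln (real k) \<le> log 2 (real k)" by (simp add: log_def pos_le_divide_eq)
qed

lemma d2_le: "real d2 \<le> 8 * ln (real k) + 1"
  using ln_ge_half[OF k(1)] unfolding d2_def d2_par_def by linarith

lemma \<kappa>_le: "real \<kappa> \<le> 12 * ln (real k) + 1"
  using ln_ge_half[OF k(1)] unfolding \<kappa>_def kappa_def by linarith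

text \<open>The logarithm cancels: \<open>(2 * k / ln k) * (8 * ln k + 1)\<close> is
  \<open>16 * k + 2 * k / ln k\<close>, at most \<open>20 * k\<close> as
  \<open>ln k \<ge> 1 / 2\<close>. Doubled for the pairs and increased by
  \<open>\<kappa> \<le> 12 * k\<close>, this gives \<open>52 * k\<close>.\<close>

lemma cells_le: "real cells \<le> 52 * real k + 2"
proof -
  have "real (2 ^ d) \<le> 2 * (real k / ln (real k))"
    using two_power_d_par[OF k(1)] by (simp add: d_def)
  then have "real (2 ^ d) * real d2 \<le> 2 * (real k / ln (real k)) * (8 * ln (real k) + 1)"
    using d2_le k by (intro mult_mono) auto
  also have "\<dots> = 16 * real k + 2 * (real k / ln (real k))"
    using ln_ge_half[OF k(1)] by (simp add: field_simps)
  also have "real k / ln (real k) \<le> real k / (1 / 2)"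
    using ln_ge_half[OF k(1)] by (intro divide_left_mono) auto
  finally have "real (2 ^ d) * real d2 \<le> 20 * real k" by simp
  moreover have "real \<kappa> \<le> 12 * real k"
    using nat_ceiling_ln_le[OF k(1), of 12] unfolding \<kappa>_def kappa_def
    by (metis of_nat_le_iff of_nat_mult of_nat_numeral)
  ultimately show ?thesis by (simp add: cells_def)
qed

text \<open>With \<open>L = log 2 N\<close>, each of \<open>u\<close>, \<open>d\<close>,
  \<open>n\<close> is at most \<open>2 + L \<le> 3 * L\<close>, while
  \<open>\<kappa> \<le> 13 * L\<close> and \<open>d2 \<le> 9 * L\<close>. The Horner loop dominates
  with \<open>13 * 200 = 2600\<close> times \<open>L ^ 2\<close>; the rest stays below
  \<open>1400 * L ^ 2\<close>.\<close>

lemma time_le: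
  "real (u * 10 + d * 15 + \<kappa> * (n * 50 + 50) + d2 * 60 + 200) \<le> 4000 * (log 2 (real N))\<^sup>2"
proof -
  define L where "L = log 2 (real N)"
  have L: "1 \<le> L" using real_bounds by (simp add: L_def)
  have log_le: "real l \<le> 3 * L" if "2 ^ l \<le> 4 * N" for l
  proof -
    have "(2::real) ^ l \<le> 4 * real N"
      using that by (metis of_nat_le_iff of_nat_mult of_nat_numeral of_nat_power)
    then have "real l \<le> log 2 (4 * real N)" using N by (simp add: le_log_iff powr_realpow)
    also have "\<dots> = log 2 (2 ^ 2) + L" using N by (simp add: log_mult L_def)
    also have "log 2 (2 ^ 2) = (2 :: real)" using log_pow_cancel[of 2 2] by simp
    finally show ?thesis using L by linarith
  qed
  have "2 ^ u \<le> 4 * N" using u_bounds(2) by linarith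
  then have b: "real u \<le> 3 * L" "real d \<le> 3 * L" "real n \<le> 3 * L"
    using log_le d_bounds(2) n_bounds(2) by auto
  have ln: "ln (real k) \<le> L" using real_bounds by (simp add: L_def)
  have c: "real \<kappa> \<le> 13 * L" "real d2 \<le> 9 * L" using \<kappa>_le d2_le ln L by linarith+
  have "real \<kappa> * (real n * 50 + 50) \<le> (13 * L) * ((3 * L) * 50 + 50 * L)"
    using b c L by (intro mult_mono add_mono) auto
  also have "\<dots> = 2600 * (L * L)" by (simp add: algebra_simps)
  finally have "real \<kappa> * (real n * 50 + 50) \<le> 2600 * (L * L)" .
  moreover have "L * 1 \<le> L * L" using L by (intro mult_left_mono) auto
  moreover have "real (u * 10 + d * 15 + \<kappa> * (n * 50 + 50) + d2 * 60 + 200) =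
      real u * 10 + real d * 15 + real \<kappa> * (real n * 50 + 50) + real d2 * 60 + 200"
    by simp
  ultimately show ?thesis
    using b c L unfolding L_def[symmetric] power2_eq_square by linarith
qed

end

lemma word_ram_of_log:
  assumes "1 < N" "2 \<le> k" "k \<le> N" "400 * log 2 (real N) \<le> real w"
  shows "word_ram N k w"
proof
  have "real (N ^ 400) = 2 powr (400 * log 2 (real N))"
    using assms(1) by (simp add: powr_mult_base powr_powr[symmetric] mult.commute powr_realpow flip: powr_numeral)
  also have "\<dots> \<le> 2 powr real w" using assms(4) by simp
  also have "\<dots> = real (2 ^ w)" by (simp add: powr_realpow)
  finally show "N ^ 400 \<le> 2 ^ w" unfolding of_nat_le_iff .
qed (use assms in auto)

text \<open>The constant 400 is the word-size exponent of the locale, and the time polynomial is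
  \<open>4000 * X ^ 2\<close>. The constant 64 absorbs both \<open>52 * k + 24\<close> for Algorithm
  1, as \<open>k \<ge> 2\<close>, and \<open>d2 + 22\<close> for Algorithm 2.\<close>

theorem theorem7:
  "\<exists>(c :: real) (C :: real) (q :: real poly).
     \<forall>(N :: nat) (k :: nat). 1 < N \<and> 2 \<le> k \<and> k \<le> N \<longrightarrow>
       (\<exists>(P :: bit poly) (p :: nat).
          field_modulus N k P \<and> prime p \<and> N \<le> p \<and>
          (\<forall>w :: nat. c * log 2 (real N) \<le> real w \<longrightarrow>
             (\<exists>(sp :: nat) D.
                real sp \<le> C * (real k + log 2 (real k) * log 2 (real N)) \<and>
                runs w sp [N, k] algorithm1_prog D \<and>
                map_pmf result_of D = map_pmf encode (algorithm1 N k P p)) \<and>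
             (\<forall>F \<in> set_pmf (algorithm1 N k P p). \<forall>x < N.
                \<exists>(sp :: nat) (s :: var state) (t :: nat).
                  real sp \<le> C * log 2 (real k) \<and>
                  real t \<le> poly q (log 2 (real N)) \<and>
                  runs w sp ([N, k, x] @ encode F) algorithm2_prog (return_pmf (s, t)) \<and>
                  set (result_of (s, t)) = algorithm2 N k F x)))"
proof (rule exI[of _ 400], rule exI[of _ 64], rule exI[of _ "[:0, 0, 4000:]"], intro allI impI)
  fix N k :: nat assume A: "1 < N \<and> 2 \<le> k \<and> k \<le> N"
  \<comment> \<open>The modulus and the prime must be chosen before the word size \<open>w\<close>,
    so they are defined outside the locale; inside it they coincide with its constants.\<close>
  define n\<^sub>0 where "n\<^sub>0 = max (u_par N) (d_par k)"
  define P\<^sub>0 where "P\<^sub>0 = word_poly (irreducible_word n\<^sub>0)"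
  define p where "p = least_prime N"
  have "0 < n\<^sub>0" using u_par_props(1)[of N] A by (simp add: n\<^sub>0_def)
  show "\<exists>(P :: bit poly) (p :: nat).
          field_modulus N k P \<and> prime p \<and> N \<le> p \<and>
          (\<forall>w :: nat. 400 * log 2 (real N) \<le> real w \<longrightarrow>
             (\<exists>(sp :: nat) D.
                real sp \<le> 64 * (real k + log 2 (real k) * log 2 (real N)) \<and>
                runs w sp [N, k] algorithm1_prog D \<and>
                map_pmf result_of D = map_pmf encode (algorithm1 N k P p)) \<and>
             (\<forall>F \<in> set_pmf (algorithm1 N k P p). \<forall>x < N.
                \<exists>(sp :: nat) (s :: var state) (t :: nat).
                  real sp \<le> 64 * log 2 (real k) \<and>
                  real t \<le> poly [:0, 0, 4000:] (log 2 (real N)) \<and>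
                  runs w sp ([N, k, x] @ encode F) algorithm2_prog (return_pmf (s, t)) \<and>
                  set (result_of (s, t)) = algorithm2 N k F x))"
  proof (rule exI[of _ P\<^sub>0], rule exI[of _ p], intro conjI allI impI ballI)
    show "field_modulus N k P\<^sub>0"
      using irreducible_word[OF \<open>0 < n\<^sub>0\<close>] by (simp add: field_modulus_def P\<^sub>0_def n\<^sub>0_def)
    show "prime p" "N \<le> p" using least_prime[of N] A by (simp_all add: p_def)
  next
    fix w assume "400 * log 2 (real N) \<le> real w"
    then interpret word_ram N k w using A by (intro word_ram_of_log) auto
    have P_eq: "P\<^sub>0 = P" by (simp add: P\<^sub>0_def n\<^sub>0_def P_def n_def)
    show "\<exists>(sp :: nat) D.
                real sp \<le> 64 * (real k + log 2 (real k) * log 2 (real N)) \<and>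
                runs w sp [N, k] algorithm1_prog D \<and>
                map_pmf result_of D = map_pmf encode (algorithm1 N k P\<^sub>0 p)"
    proof -
      obtain D where D: "exec w cells [N, k] algorithm1_prog (\<lambda>_. 0, \<lambda>_. 0) D"
        "map_pmf result_of D = map_pmf encode (algorithm1 N k P\<^sub>0 p)"
        using samples_algorithm1 unfolding samples_def result_of_eq P_eq p_def by blast
      have "real (cells + card (regs algorithm1_prog)) \<le> 52 * real k + 24"
        using cells_le card_regs_le[of algorithm1_prog] by linarith
      also have "\<dots> \<le> 64 * (real k + log 2 (real k) * log 2 (real N))"
      proof -
        define X where "X = log 2 (real k) * log 2 (real N)"
        have "0 \<le> X" using real_bounds by (simp add: X_def)
        moreover have "2 \<le> real k" using k by simp
        ultimately show ?thesis unfolding X_def[symmetric] by (simp add: algebra_simps)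
      qed
      finally show ?thesis using D unfolding runs_def by blast
    qed
  next
    fix w F x assume "400 * log 2 (real N) \<le> real w" and F: "F \<in> set_pmf (algorithm1 N k P\<^sub>0 p)" and x: "x < N"
    then interpret word_ram N k w using A by (intro word_ram_of_log) auto
    show "\<exists>(sp :: nat) (s :: var state) (t :: nat).
                  real sp \<le> 64 * log 2 (real k) \<and>
                  real t \<le> poly [:0, 0, 4000:] (log 2 (real N)) \<and>
                  runs w sp ([N, k, x] @ encode F) algorithm2_prog (return_pmf (s, t)) \<and>
                  set (result_of (s, t)) = algorithm2 N k F x"
    proof -
      have P_eq: "P\<^sub>0 = P" by (simp add: P\<^sub>0_def n\<^sub>0_def P_def n_def)
      obtain s t where st: "exec w d2 ([N, k, x] @ encode F) algorithm2_prog (\<lambda>_. 0, \<lambda>_. 0) (return_pmf (s, t))"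
        "t \<le> u * 10 + d * 15 + \<kappa> * (n * 50 + 50) + d2 * 60 + 200" "set (written s) = algorithm2 N k F x"
        using run_algorithm2[OF F[unfolded P_eq p_def] x] by (rule runE)
      have "real t \<le> real (u * 10 + d * 15 + \<kappa> * (n * 50 + 50) + d2 * 60 + 200)"
        using st(2) unfolding of_nat_le_iff .
      also note time_le
      finally have "real t \<le> poly [:0, 0, 4000:] (log 2 (real N))"
        by (simp add: power2_eq_square mult_ac)
      moreover have "real (d2 + card (regs algorithm2_prog)) \<le> 64 * log 2 (real k)"
        using d2_le real_bounds(1,4) card_regs_le[of algorithm2_prog] unfolding of_nat_add by linarith
      moreover have "runs w (d2 + card (regs algorithm2_prog)) ([N, k, x] @ encode F) algorithm2_prog
          (return_pmf (s, t))"
        using st(1) unfolding runs_def by blast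
      moreover have "set (result_of (s, t)) = algorithm2 N k F x"
        using st(3) by (simp add: result_of_eq)
      ultimately show ?thesis by blast
    qed
  qed
qed

end
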